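(* Let $G$ be a connected infinite graph. Then $G$ contains a $T$-join for every infinite $T\subseteq V(G)$ if and only if there is no $U\subseteq V(G)$ for which every connected component of $G-U$ is connected to $U$ in $G$ by exactly one edge and infinitely many of the connected components of $G-U$ are nontrivial (i.e. do not consist of a single vertex).
   Context: Graphs are undirected, may have multiple edges, have no loops, and may be infinite of arbitrary cardinality. $G-U$ is the graph obtained from $G$ by deleting the vertices in $U$ together with all edges incident to them. Paths are finite. For a graph $G$ and $T\subseteq V(G)$, a $T$-join in $G$ is a system $\mathcal{P}$ of pairwise edge-disjoint finite paths in $G$ such that the sets of endvertices of the paths in $\mathcal{P}$ form a partition of $T$ into two-element sets (that is, every $v\in T$ is an endvertex of exactly one path of $\mathcal{P}$, and each path of $\mathcal{P}$ has two distinct endvertices, both in $T$). *)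

theory Defs
  imports Main
begin

record ('a, 'e) multigraph =
  verts :: "'a set"
  edges :: "'e set"
  ends :: "'e \<Rightarrow> 'a set"

text \<open>Edges carry their own identity, so parallel edges are allowed; an edge has exactly two
  distinct ends, so loops are not.\<close>

definition wf_multigraph :: "('a, 'e) multigraph \<Rightarrow> bool" where
  "wf_multigraph G \<longleftrightarrow> (\<forall>e\<in>edges G. ends G e \<subseteq> verts G \<and> card (ends G e) = 2)"

definition finite_multigraph :: "('a, 'e) multigraph \<Rightarrow> bool" where
  "finite_multigraph G \<longleftrightarrow> finite (verts G) \<and> finite (edges G)"

text \<open>A path \<open>(vs, es)\<close> lists its vertices and its edges in order of traversal; one-vertex paths
  are included.\<close>

type_synonym ('a, 'e) gpath = "'a list \<times> 'e list"

definition is_path :: "('a, 'e) multigraph \<Rightarrow> ('a, 'e) gpath \<Rightarrow> bool" where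
  "is_path G p \<longleftrightarrow> (case p of (vs, es) \<Rightarrow>
     length vs = Suc (length es) \<and> distinct vs \<and> set vs \<subseteq> verts G \<and>
     (\<forall>i<length es. es ! i \<in> edges G \<and> ends G (es ! i) = {vs ! i, vs ! Suc i}))"

definition path_edges :: "('a, 'e) gpath \<Rightarrow> 'e set" where
  "path_edges p = set (snd p)"

definition endvertices :: "('a, 'e) gpath \<Rightarrow> 'a set" where
  "endvertices p = {hd (fst p), last (fst p)}"

definition joined :: "('a, 'e) multigraph \<Rightarrow> 'a \<Rightarrow> 'a \<Rightarrow> bool" where
  "joined G u v \<longleftrightarrow> (\<exists>p. is_path G p \<and> hd (fst p) = u \<and> last (fst p) = v)"

definition connected_multigraph :: "('a, 'e) multigraph \<Rightarrow> bool" where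
  "connected_multigraph G \<longleftrightarrow> verts G \<noteq> {} \<and> (\<forall>u\<in>verts G. \<forall>v\<in>verts G. joined G u v)"

text \<open>Components are represented by their vertex sets.\<close>

definition components :: "('a, 'e) multigraph \<Rightarrow> 'a set set" where
  "components G = (\<lambda>v. {w. joined G v w}) ` verts G"

definition delete_verts :: "('a, 'e) multigraph \<Rightarrow> 'a set \<Rightarrow> ('a, 'e) multigraph" where
  "delete_verts G U =
     \<lparr>verts = verts G - U, edges = {e \<in> edges G. ends G e \<inter> U = {}}, ends = ends G\<rparr>"

definition edges_between :: "('a, 'e) multigraph \<Rightarrow> 'a set \<Rightarrow> 'a set \<Rightarrow> 'e set" where
  "edges_between G X Y = {e \<in> edges G. \<exists>x\<in>X. \<exists>y\<in>Y. ends G e = {x, y}}"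

text \<open>Two distinct members of \<open>P\<close> cannot be the same path traversed in opposite directions:
  they would share an edge, because their endvertices are distinct.\<close>

definition T_join :: "('a, 'e) multigraph \<Rightarrow> 'a set \<Rightarrow> ('a, 'e) gpath set \<Rightarrow> bool" where
  "T_join G T P \<longleftrightarrow>
     (\<forall>p\<in>P. is_path G p \<and> endvertices p \<subseteq> T \<and> card (endvertices p) = 2) \<and>
     (\<forall>p\<in>P. \<forall>q\<in>P. p \<noteq> q \<longrightarrow> path_edges p \<inter> path_edges q = {}) \<and>
     (\<forall>v\<in>T. \<exists>!p. p \<in> P \<and> v \<in> endvertices p)"

end

theory Submission
  imports Defs
begin

text \<open>Call a vertex set pendant if exactly one edge leaves it. A set \<open>U\<close> as in the theorem amounts to
  an infinite family of disjoint pendant sets with at least two vertices, namely the nontrivial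
  components of \<open>G - U\<close>. Given
  such a family, let \<open>T\<close> consist of a vertex of \<open>U\<close> and two vertices from each nontrivial component:
  the component that contains the partner of the vertex in \<open>U\<close> would be left by two paths.

  Conversely, assume that there is no such family. Working upwards in a breadth-first tree, all
  vertices of \<open>T\<close> except for at most one vertex \<open>t\<close> can be joined. From \<open>t\<close> we start an infinite
  trail that breaks up paths of the join: arriving at a path, it is joined to one end of the path,
  and the trail is continued from the other end. The trail is built in finite stages, and after the
  deletion of the edges used so far its current end \<open>x\<close> lies in a component with infinitely many
  vertices of \<open>T\<close>. To continue, choose a path \<open>p\<close> that is not separated from \<open>x\<close> by a single edge
  with only finitely many vertices of \<open>T\<close> on the side of \<open>p\<close>; if there were no such \<open>p\<close>, the maximal
  such sides would form an infinite family of disjoint pendant sets. By Menger's theorem there are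
  edge-disjoint connections from \<open>p\<close> to \<open>x\<close> and to a component that stays infinite.\<close>

subsection \<open>Connection by a set of edges\<close>

text \<open>Since \<open>T\<close> may have any cardinality, its vertices cannot be treated one
  after another. The tree therefore works by a local rule applied everywhere at once: terminals that
  arrive at the same vertex are paired arbitrarily. Infinitely many can always be paired completely,
  so only a finite odd number leaves one over. If infinite descent prevents this rule from being
  evaluated from the leaves, the leftover terminals are joined along infinite rays instead. The
  final leftover cannot be treated locally, because inserting it must not produce another one; hence
  the trail never stops. Its stages are finite for two reasons: deleting finitely many edges creates
  no pendant family if there was none, and only finitely many terminals are lost in components that
  become too small. The requirement of two vertices in a pendant set matches the fact that a side
  containing a path of the join contains both ends of it. Routes are kept as disjoint edge sets
  throughout, because they are constantly glued and trimmed; genuine paths are extracted only when a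
  \<open>T\<close>-join is formed.\<close>

locale wf_graph =
  fixes G :: "('a, 'e) multigraph"
  assumes wf: "wf_multigraph G"
begin

abbreviation "E \<equiv> edges G"
abbreviation "V \<equiv> verts G"
abbreviation "en \<equiv> ends G"

lemma edgeE:
  assumes "e \<in> E"
  obtains u v where "u \<noteq> v" "en e = {u, v}" "u \<in> V" "v \<in> V"
proof -
  have *: "en e \<subseteq> V" "card (en e) = 2" using wf assms by (auto simp: wf_multigraph_def)
  then obtain u v where "en e = {u, v}" "u \<noteq> v" by (auto simp: card_2_iff)
  with * that show ?thesis by auto
qed

lemma finite_ends: "e \<in> E \<Longrightarrow> finite (en e)"
  by (metis edgeE finite.emptyI finite.insertI)

text \<open>Connection is relative to an arbitrary edge set, so that routes are glued by union and
  kept apart by disjointness, without surgery on vertex sequences. \<open>conn_path\<close> turns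
  such a route back into a path.\<close>

definition conn :: "'e set \<Rightarrow> 'a \<Rightarrow> 'a \<Rightarrow> bool" where
  "conn Z u v \<longleftrightarrow> (u, v) \<in> {(a, b). \<exists>e\<in>Z. en e = {a, b}}\<^sup>*"

definition cut :: "'e set \<Rightarrow> 'a set \<Rightarrow> 'e set" where
  "cut Z C = {e \<in> Z. \<exists>u\<in>C. \<exists>v. v \<notin> C \<and> en e = {u, v}}"

lemma conn_refl [simp]: "conn Z u u"
  by (simp add: conn_def)

lemma conn_sym: "conn Z u v \<Longrightarrow> conn Z v u"
proof -
  have "sym {(a, b). \<exists>e\<in>Z. en e = {a, b}}" by (auto simp: sym_def insert_commute)
  then show "conn Z u v \<Longrightarrow> conn Z v u"
    unfolding conn_def by (meson sym_rtrancl symD)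
qed

lemma conn_trans: "conn Z u v \<Longrightarrow> conn Z v w \<Longrightarrow> conn Z u w"
  unfolding conn_def by (rule rtrancl_trans)

lemma conn_mono: "conn Z u v \<Longrightarrow> Z \<subseteq> Z' \<Longrightarrow> conn Z' u v"
  unfolding conn_def by (erule rtrancl_mono[THEN subsetD, rotated]) auto

lemma conn_edge: "e \<in> Z \<Longrightarrow> en e = {u, v} \<Longrightarrow> conn Z u v"
  unfolding conn_def by (rule r_into_rtrancl) auto

lemma conn_step: "conn Z u v \<Longrightarrow> e \<in> Z \<Longrightarrow> en e = {v, w} \<Longrightarrow> conn Z u w"
  by (rule conn_trans[OF _ conn_edge])

lemma conn_join: "conn A u v \<Longrightarrow> conn B v w \<Longrightarrow> conn (A \<union> B) u w"
  by (meson conn_mono conn_trans sup_ge1 sup_ge2)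

lemma conn_induct [consumes 1, case_names refl step]:
  assumes "conn Z u v" "P u"
    "\<And>a b e. conn Z u a \<Longrightarrow> P a \<Longrightarrow> e \<in> Z \<Longrightarrow> en e = {a, b} \<Longrightarrow> P b"
  shows "P v"
  using assms(1) unfolding conn_def
  by (induction rule: rtrancl_induct) (use assms(2,3) in \<open>auto simp: conn_def\<close>)

lemma conn_cutE:
  assumes "conn Z u v" "u \<in> C" "v \<notin> C"
  obtains e a b where "e \<in> Z" "a \<in> C" "b \<notin> C" "en e = {a, b}" "conn Z u a" "e \<in> cut Z C"
proof -
  have "v \<in> C \<or> (\<exists>e\<in>Z. \<exists>a\<in>C. \<exists>b. b \<notin> C \<and> en e = {a, b} \<and> conn Z u a)"
    using assms(1)
  proof (induction rule: conn_induct)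
    case refl
    then show ?case using assms(2) by auto
  next
    case (step a b e)
    then show ?case by blast
  qed
  with assms(3) obtain e a b where "e \<in> Z" "a \<in> C" "b \<notin> C" "en e = {a, b}" "conn Z u a"
    by blast
  then show ?thesis using that unfolding cut_def by blast
qed

lemma cutE:
  assumes "e \<in> cut Z C"
  obtains a b where "e \<in> Z" "a \<in> C" "b \<notin> C" "en e = {a, b}"
  using assms unfolding cut_def by blast

lemma cut_nonempty: "conn Z u v \<Longrightarrow> u \<in> C \<Longrightarrow> v \<notin> C \<Longrightarrow> cut Z C \<noteq> {}"
  by (metis conn_cutE empty_iff)

lemma cut_nonempty': "conn Z u v \<Longrightarrow> v \<in> C \<Longrightarrow> u \<notin> C \<Longrightarrow> cut Z C \<noteq> {}"
  using cut_nonempty conn_sym by blast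

lemma conn_finite:
  assumes "conn Z u v"
  obtains F where "F \<subseteq> Z" "finite F" "conn F u v"
proof -
  have "\<exists>F\<subseteq>Z. finite F \<and> conn F u v"
    using assms
  proof (induction rule: conn_induct)
    case refl
    then show ?case by (intro exI[of _ "{}"]) auto
  next
    case (step a b e)
    then obtain F where F: "F \<subseteq> Z" "finite F" "conn F u a" by auto
    have "conn (F \<union> {e}) u b"
      using F(3) conn_edge[of e "{e}" a b] step by (blast intro: conn_join)
    then show ?case using F step by (intro exI[of _ "F \<union> {e}"]) auto
  qed
  then show ?thesis using that by auto
qed

text \<open>Every edge used by a walk from \<open>x\<close> has both ends reachable from
  \<open>x\<close>. Trimming a route in this way frees its remaining edges for other routes.\<close>

lemma conn_component:
  assumes "conn Z x v"
  shows "conn {e \<in> Z. \<forall>w\<in>en e. conn Z x w} x v"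
  using assms
proof (induction rule: conn_induct)
  case refl
  then show ?case by simp
next
  case (step a b e)
  have "conn Z x b" by (rule conn_step[OF step.hyps])
  then have "e \<in> {e \<in> Z. \<forall>w\<in>en e. conn Z x w}" using step by auto
  then show ?case using conn_step[OF step.IH _ step.hyps(3)] by blast
qed

lemma path_conn:
  assumes "is_path G (vs, es)" "i \<le> j" "j < length vs"
  shows "conn ((!) es ` {i..<j}) (vs ! i) (vs ! j)"
  using assms(2,3)
proof (induction j rule: dec_induct)
  case base
  then show ?case by simp
next
  case (step j)
  have "en (es ! j) = {vs ! j, vs ! Suc j}"
    using assms(1) step by (auto simp: is_path_def)
  then have "conn {es ! j} (vs ! j) (vs ! Suc j)" by (intro conn_edge) auto
  moreover have "(!) es ` {i..<Suc j} = (!) es ` {i..<j} \<union> {es ! j}"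
    using step by (auto simp: less_Suc_eq)
  ultimately show ?case
    using conn_join[OF step.IH, of "{es ! j}"] step.prems by simp
qed

lemma path_distinct_edges:
  assumes "is_path G (vs, es)"
  shows "distinct es"
proof -
  have *: "length vs = Suc (length es)" "distinct vs"
    "\<And>i. i < length es \<Longrightarrow> en (es ! i) = {vs ! i, vs ! Suc i}"
    using assms by (auto simp: is_path_def)
  have "es ! i \<noteq> es ! j" if "i < j" "j < length es" for i j
  proof
    assume "es ! i = es ! j"
    then have "vs ! i \<in> {vs ! j, vs ! Suc j}" using *(3)[of i] *(3)[of j] that by auto
    then show False using that * by (auto simp: nth_eq_iff_index_eq)
  qed
  then show ?thesis by (metis distinct_conv_nth linorder_neqE_nat)
qed

lemma path_edge_verts:
  assumes "is_path G p" "e \<in> path_edges p"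
  shows "en e \<subseteq> set (fst p)" "e \<in> E"
proof -
  obtain vs es where p: "p = (vs, es)" by force
  then obtain i where i: "i < length es" "e = es ! i"
    using assms(2) by (auto simp: path_edges_def in_set_conv_nth)
  then have "en e = {vs ! i, vs ! Suc i}" "e \<in> E" "length vs = Suc (length es)"
    using assms(1) p by (auto simp: is_path_def)
  then show "en e \<subseteq> set (fst p)" "e \<in> E" using i p by (auto intro: nth_mem)
qed

lemma path_verts_conn:
  assumes "is_path G p" "x \<in> set (fst p)" "y \<in> set (fst p)"
  shows "conn (path_edges p) x y"
proof -
  obtain vs es where p: "p = (vs, es)" by force
  have len: "length vs = Suc (length es)" using assms(1) p by (auto simp: is_path_def)
  have "conn (path_edges p) (vs ! 0) z" if z: "z \<in> set (fst p)" for z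
  proof -
    obtain j where j: "j < length vs" "z = vs ! j" using z p by (auto simp: in_set_conv_nth)
    have "(!) es ` {0..<j} \<subseteq> set es" using j len by auto
    then show ?thesis
      using path_conn[of vs es 0 j] assms(1) j p by (auto simp: path_edges_def intro: conn_mono)
  qed
  then show ?thesis using assms(2,3) by (blast intro: conn_trans[OF conn_sym])
qed

text \<open>Whichever of \<open>x\<close> and \<open>y\<close> comes first on \<open>p\<close> uses
  the initial segment, and the other one uses the final segment. Hence their order decides which end
  of \<open>p\<close> is called \<open>t1\<close>.\<close>

lemma path_split:
  assumes p: "is_path G p" and x: "x \<in> set (fst p)" and y: "y \<in> set (fst p)"
    and c: "card (endvertices p) = 2"
  obtains Z1 Z2 t1 t2 where "endvertices p = {t1, t2}" "t1 \<noteq> t2"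
    "Z1 \<subseteq> path_edges p" "Z2 \<subseteq> path_edges p" "Z1 \<inter> Z2 = {}" "conn Z1 x t1" "conn Z2 y t2"
proof -
  note goal = that
  obtain vs es where pe: "p = (vs, es)" by force
  have len: "length vs = Suc (length es)" using p pe by (auto simp: is_path_def)
  have ends: "endvertices p = {vs ! 0, vs ! length es}"
  proof -
    have "vs \<noteq> []" using len by auto
    then have "hd vs = vs ! 0" "last vs = vs ! length es"
      using len by (simp_all add: hd_conv_nth last_conv_nth)
    then show ?thesis using pe by (simp add: endvertices_def)
  qed
  have ne: "vs ! 0 \<noteq> vs ! length es" using c ends by auto
  have dis: "distinct es" using path_distinct_edges p pe by blast
  have *: thesis if ij: "i \<le> j" "j < length vs" and xy: "{x, y} = {vs ! i, vs ! j}" for i j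
  proof -
    let ?A = "(!) es ` {0..<i}" and ?B = "(!) es ` {j..<length es}"
    have sub: "?A \<subseteq> path_edges p" "?B \<subseteq> path_edges p"
      using ij len pe by (auto simp: path_edges_def)
    have dj: "?A \<inter> ?B = {}" using dis ij len by (auto simp: nth_eq_iff_index_eq)
    have A: "conn ?A (vs ! i) (vs ! 0)" and B: "conn ?B (vs ! j) (vs ! length es)"
      using path_conn[of vs es 0 i, THEN conn_sym] path_conn[of vs es j "length es"] p pe ij len
      by simp_all
    show thesis
    proof (cases "x = vs ! i \<and> y = vs ! j")
      case True
      then show ?thesis using goal[of "vs ! 0" "vs ! length es" ?A ?B] ends ne sub dj A B by auto
    next
      case False
      then have "x = vs ! j \<and> y = vs ! i" using xy by (auto simp: doubleton_eq_iff)
      then show ?thesis using goal[of "vs ! length es" "vs ! 0" ?B ?A] ends ne sub dj A B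
        by (simp add: insert_commute Int_commute)
    qed
  qed
  obtain i j where "i < length vs" "x = vs ! i" "j < length vs" "y = vs ! j"
    using x y pe by (auto simp: in_set_conv_nth)
  then show thesis using *[of i j] *[of j i] by (cases "i \<le> j") (auto simp: insert_commute)
qed

lemma conn_path:
  assumes "conn Z u v" "Z \<subseteq> E" "u \<in> V"
  obtains p where "is_path G p" "hd (fst p) = u" "last (fst p) = v" "path_edges p \<subseteq> Z"
proof -
  have "\<exists>vs es. is_path G (vs, es) \<and> hd vs = u \<and> last vs = v \<and> set es \<subseteq> Z"
    using assms(1)
  proof (induction rule: conn_induct)
    case refl
    then show ?case using assms by (intro exI[of _ "[u]"] exI[of _ "[]"]) (auto simp: is_path_def)
  next
    case (step a b e)
    then obtain vs es where p: "is_path G (vs, es)" "hd vs = u" "last vs = a" "set es \<subseteq> Z" by auto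
    have len: "length vs = Suc (length es)" "vs \<noteq> []" using p by (auto simp: is_path_def)
    show ?case
    proof (cases "b \<in> set vs")
      case False
      have "b \<in> V" using step assms(2) edgeE[of e] by (metis doubleton_eq_iff subsetD)
      moreover have "vs ! length es = a" using p(3) len by (simp add: last_conv_nth)
      ultimately have "is_path G (vs @ [b], es @ [e])"
        using p(1) False step assms(2) len
        by (auto simp: is_path_def nth_append less_Suc_eq not_less)
      then show ?thesis using p step len
        by (intro exI[of _ "vs @ [b]"] exI[of _ "es @ [e]"]) auto
    next
      case True
      \<comment> \<open>The new vertex already lies on the path, so the path is cut back to
        it.\<close>
      then obtain k where k: "k < length vs" "vs ! k = b" by (auto simp: in_set_conv_nth)
      have "is_path G (take (Suc k) vs, take k es)"
        using p(1) k by (auto simp: is_path_def dest: in_set_takeD)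
      moreover have "last (take (Suc k) vs) = b"
        using k by (simp add: take_Suc_conv_app_nth)
      moreover have "hd (take (Suc k) vs) = u" using p len by simp
      moreover have "set (take k es) \<subseteq> Z" using p(4) by (auto dest: in_set_takeD)
      ultimately show ?thesis by blast
    qed
  qed
  then obtain vs es where "is_path G (vs, es)" "hd vs = u" "last vs = v" "set es \<subseteq> Z" by blast
  then show ?thesis using that[of "(vs, es)"] by (simp add: path_edges_def)
qed

lemma joined_iff:
  assumes "u \<in> V"
  shows "joined G u v \<longleftrightarrow> conn E u v"
proof
  assume "joined G u v"
  then obtain p where p: "is_path G p" "hd (fst p) = u" "last (fst p) = v"
    by (auto simp: joined_def)
  then have "fst p \<noteq> []" by (auto simp: is_path_def)
  then have "conn (path_edges p) u v" using p path_verts_conn by (metis hd_in_set last_in_set)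
  then show "conn E u v" using path_edge_verts(2)[OF p(1)] by (auto intro: conn_mono)
next
  assume "conn E u v"
  then obtain p where "is_path G p" "hd (fst p) = u" "last (fst p) = v"
    using conn_path[of E u v] assms by blast
  then show "joined G u v" unfolding joined_def by blast
qed

end

subsection \<open>Edge-disjoint joins\<close>

text \<open>A fixed-point-free involution, which encodes a partition of \<open>N\<close> into
  two-element sets.\<close>

definition pairing :: "('b \<Rightarrow> 'b) \<Rightarrow> 'b set \<Rightarrow> bool" where
  "pairing m N \<longleftrightarrow> (\<forall>t\<in>N. m t \<in> N \<and> m t \<noteq> t \<and> m (m t) = t)"

lemma pairing_finite:
  "finite N \<Longrightarrow> even (card N) \<Longrightarrow> \<exists>m. pairing m N"
proof (induction "card N" arbitrary: N rule: less_induct)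
  case less
  show ?case
  proof (cases "N = {}")
    case True
    then show ?thesis by (auto simp: pairing_def)
  next
    case False
    then obtain a where a: "a \<in> N" by auto
    have "N \<noteq> {a}" using less by auto
    then obtain b where b: "b \<in> N" "b \<noteq> a" using a by auto
    have c: "card (N - {a, b}) = card N - 2" "card N \<ge> 2"
      using a b less.prems card_mono[of N "{a, b}"] by (auto simp: card_Diff_subset)
    then obtain m where m: "pairing m (N - {a, b})"
      using less.hyps[of "N - {a, b}"] less.prems by auto
    have "pairing (m(a := b, b := a)) N"
      using m a b by (auto simp: pairing_def)
    then show ?thesis by blast
  qed
qed

text \<open>An infinite set is equinumerous with the disjoint sum of two copies of itself, and
  exchanging the copies is a pairing. This covers every cardinality.\<close>

lemma pairing_infinite:
  fixes N :: "'b set"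
  assumes "infinite N"
  shows "\<exists>m. pairing m N"
proof -
  obtain f where f: "bij_betw f (N <+> N) N"
    using card_of_Plus_infinite1[OF assms ordIso_imp_ordLeq[OF card_of_refl]] card_of_ordIso
    by blast
  define sw where "sw = (\<lambda>x :: 'b + 'b. case x of Inl a \<Rightarrow> Inr a | Inr a \<Rightarrow> Inl a)"
  have sw: "sw x \<noteq> x" "sw (sw x) = x" "x \<in> N <+> N \<Longrightarrow> sw x \<in> N <+> N" for x
    by (auto simp: sw_def split: sum.splits)
  let ?g = "inv_into (N <+> N) f"
  have g: "?g t \<in> N <+> N" "f (?g t) = t" if "t \<in> N" for t
    using f that by (auto simp: bij_betw_def inv_into_into f_inv_into_f)
  have fN: "f x \<in> N" "?g (f x) = x" if "x \<in> N <+> N" for x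
    using f that by (auto simp: bij_betw_def)
  have "pairing (\<lambda>t. f (sw (?g t))) N"
    unfolding pairing_def
  proof (intro ballI conjI)
    fix t assume t: "t \<in> N"
    show "f (sw (?g t)) \<in> N" using t g fN sw by simp
    show "f (sw (?g (f (sw (?g t))))) = t" using t g fN sw by simp
    show "f (sw (?g t)) \<noteq> t" using t g fN sw by metis
  qed
  then show ?thesis by blast
qed

context wf_graph
begin

definition joinable :: "'e set \<Rightarrow> 'a set \<Rightarrow> bool" where
  "joinable D T \<longleftrightarrow> (\<exists>m Z. pairing m T \<and>
     (\<forall>t\<in>T. Z t \<subseteq> D \<and> Z (m t) = Z t \<and> conn (Z t) t (m t) \<and>
       (\<forall>s\<in>T. s \<noteq> t \<longrightarrow> s \<noteq> m t \<longrightarrow> Z s \<inter> Z t = {})))"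

lemma joinable_empty [simp]: "joinable D {}"
  by (simp add: joinable_def pairing_def)

lemma joinable_mono: "joinable D T \<Longrightarrow> D \<subseteq> D' \<Longrightarrow> joinable D' T"
  unfolding joinable_def by (meson subset_trans)

lemma joinable_pair:
  assumes "conn D u v" "u \<noteq> v"
  shows "joinable D {u, v}"
  unfolding joinable_def
proof (intro exI conjI)
  show "pairing (id(u := v, v := u)) {u, v}" using assms by (auto simp: pairing_def)
  show "\<forall>t\<in>{u, v}. D \<subseteq> D \<and> D = D \<and> conn D t ((id(u := v, v := u)) t) \<and>
       (\<forall>s\<in>{u, v}. s \<noteq> t \<longrightarrow> s \<noteq> (id(u := v, v := u)) t \<longrightarrow> D \<inter> D = {})"
    using assms conn_sym by auto
qed

lemma joinable_UN:
  assumes j: "\<And>i. i \<in> I \<Longrightarrow> joinable (D i) (T i)"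
    and D: "\<And>i j. i \<in> I \<Longrightarrow> j \<in> I \<Longrightarrow> i \<noteq> j \<Longrightarrow> D i \<inter> D j = {}"
    and T: "\<And>i j. i \<in> I \<Longrightarrow> j \<in> I \<Longrightarrow> i \<noteq> j \<Longrightarrow> T i \<inter> T j = {}"
  shows "joinable (\<Union>i\<in>I. D i) (\<Union>i\<in>I. T i)"
proof -
  have "\<forall>i\<in>I. \<exists>m Z. pairing m (T i) \<and>
     (\<forall>t\<in>T i. Z t \<subseteq> D i \<and> Z (m t) = Z t \<and> conn (Z t) t (m t) \<and>
       (\<forall>s\<in>T i. s \<noteq> t \<longrightarrow> s \<noteq> m t \<longrightarrow> Z s \<inter> Z t = {}))"
    using j by (simp add: joinable_def)
  then obtain m Z where m: "\<And>i. i \<in> I \<Longrightarrow> pairing (m i) (T i)"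
    and Z: "\<And>i t. i \<in> I \<Longrightarrow> t \<in> T i \<Longrightarrow> Z i t \<subseteq> D i \<and> Z i (m i t) = Z i t \<and>
      conn (Z i t) t (m i t) \<and> (\<forall>s\<in>T i. s \<noteq> t \<longrightarrow> s \<noteq> m i t \<longrightarrow> Z i s \<inter> Z i t = {})"
    by metis
  define idx where "idx t = (SOME i. i \<in> I \<and> t \<in> T i)" for t
  have idx: "idx t = i" if "i \<in> I" "t \<in> T i" for i t
  proof -
    have "idx t \<in> I \<and> t \<in> T (idx t)" unfolding idx_def using that by (intro someI) auto
    then show ?thesis using T[of i "idx t"] that by auto
  qed
  have mT: "m i t \<in> T i" if "i \<in> I" "t \<in> T i" for i t
    using m that by (auto simp: pairing_def)
  show ?thesis
    unfolding joinable_def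
  proof (intro exI conjI ballI impI)
    show "pairing (\<lambda>t. m (idx t) t) (\<Union>i\<in>I. T i)"
      using m idx mT by (fastforce simp: pairing_def)
    fix t assume "t \<in> (\<Union>i\<in>I. T i)"
    then obtain i where i: "i \<in> I" "t \<in> T i" by auto
    show "Z (idx t) t \<subseteq> (\<Union>i\<in>I. D i)" using Z[OF i] idx[OF i] i by auto
    show "Z (idx (m (idx t) t)) (m (idx t) t) = Z (idx t) t"
      using Z[OF i] idx[OF i] idx[OF i(1) mT[OF i]] by auto
    show "conn (Z (idx t) t) t (m (idx t) t)" using Z[OF i] idx[OF i] by auto
    fix s assume s: "s \<in> (\<Union>i\<in>I. T i)" "s \<noteq> t" "s \<noteq> m (idx t) t"
    then obtain j where j: "j \<in> I" "s \<in> T j" by auto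
    show "Z (idx s) s \<inter> Z (idx t) t = {}"
    proof (cases "i = j")
      case True
      then show ?thesis using Z[OF i] idx[OF i] idx[OF j] s j by auto
    next
      case False
      then show ?thesis using Z[OF i] Z[OF j] idx[OF i] idx[OF j] D[OF i(1) j(1)] by auto
    qed
  qed
qed

lemma joinable_Un:
  assumes "joinable A S" "joinable B T" "A \<inter> B = {}" "S \<inter> T = {}"
  shows "joinable (A \<union> B) (S \<union> T)"
proof -
  have "joinable (\<Union>b\<in>{True, False}. if b then A else B) (\<Union>b\<in>{True, False}. if b then S else T)"
    by (rule joinable_UN) (use assms in \<open>auto split: if_splits\<close>)
  then show ?thesis by (simp add: Un_commute)
qed

text \<open>All routes meet at \<open>w\<close>, so any pairing of \<open>N\<close> will do: two
  partners are connected through \<open>w\<close> by the union of their routes.\<close>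

lemma joinable_at_vertex:
  assumes "\<And>t. t \<in> N \<Longrightarrow> conn (R t) t w"
    and "\<And>s t. s \<in> N \<Longrightarrow> t \<in> N \<Longrightarrow> s \<noteq> t \<Longrightarrow> R s \<inter> R t = {}"
    and "infinite N \<or> even (card N)"
  shows "joinable (\<Union>t\<in>N. R t) N"
proof -
  obtain m where m: "pairing m N"
    using pairing_finite pairing_infinite assms(3) by blast
  show ?thesis
    unfolding joinable_def
  proof (intro exI conjI ballI impI)
    show "pairing m N" by fact
    fix t assume t: "t \<in> N"
    then have mt: "m t \<in> N" "m (m t) = t" using m by (auto simp: pairing_def)
    show "R t \<union> R (m t) \<subseteq> (\<Union>t\<in>N. R t)" using t mt by auto
    show "R (m t) \<union> R (m (m t)) = R t \<union> R (m t)" using mt by auto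
    show "conn (R t \<union> R (m t)) t (m t)"
      by (rule conn_join[OF assms(1) conn_sym[OF assms(1)]]) (use t mt in auto)
    fix s assume s: "s \<in> N" "s \<noteq> t" "s \<noteq> m t"
    then have ms: "m s \<in> N" "m (m s) = s" using m by (auto simp: pairing_def)
    have "m s \<noteq> t" "m s \<noteq> m t" using s ms mt by auto
    then show "(R s \<union> R (m s)) \<inter> (R t \<union> R (m t)) = {}"
      using assms(2) s t mt ms by (simp add: Int_Un_distrib Int_Un_distrib2)
  qed
qed

text \<open>Each vertex \<open>w\<close> of \<open>X\<close> stands for a terminal
  \<open>\<tau> w\<close> that waits to be joined from there. The join of \<open>X\<close> is
  prolonged at both ends of every connection by the routes \<open>R\<close>.\<close>

lemma joinable_transfer:
  assumes "joinable D X" and inj: "inj_on \<tau> X"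
    and R: "\<And>w. w \<in> X \<Longrightarrow> conn (R w) (\<tau> w) w" "\<And>w. w \<in> X \<Longrightarrow> R w \<inter> D = {}"
      "\<And>v w. v \<in> X \<Longrightarrow> w \<in> X \<Longrightarrow> v \<noteq> w \<Longrightarrow> R v \<inter> R w = {}"
  shows "joinable (D \<union> (\<Union>w\<in>X. R w)) (\<tau> ` X)"
proof -
  obtain m Z where m: "pairing m X"
    and Z0: "\<forall>t\<in>X. Z t \<subseteq> D \<and> Z (m t) = Z t \<and> conn (Z t) t (m t) \<and>
       (\<forall>s\<in>X. s \<noteq> t \<longrightarrow> s \<noteq> m t \<longrightarrow> Z s \<inter> Z t = {})"
    using assms(1) unfolding joinable_def by blast
  note Z = bspec[OF Z0]
  define g where "g = inv_into X \<tau>"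
  have g: "g (\<tau> x) = x" if "x \<in> X" for x using that inj by (simp add: g_def)
  have mX: "m x \<in> X" "m x \<noteq> x" "m (m x) = x" if "x \<in> X" for x
    using m that by (auto simp: pairing_def)
  let ?Z = "\<lambda>x. Z x \<union> R x \<union> R (m x)"
  show ?thesis
    unfolding joinable_def
  proof (intro exI conjI ballI impI)
    show "pairing (\<lambda>t. \<tau> (m (g t))) (\<tau> ` X)"
      unfolding pairing_def using g mX inj by (auto simp: inj_on_eq_iff)
    fix t assume "t \<in> \<tau> ` X"
    then obtain x where x: "x \<in> X" "t = \<tau> x" by auto
    note mx = mX[OF x(1)]
    show "?Z (g t) \<subseteq> D \<union> (\<Union>w\<in>X. R w)" using x(2) g[OF x(1)] g[OF mx(1)] mx x(1) Z[OF x(1)] by auto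
    show "?Z (g (\<tau> (m (g t)))) = ?Z (g t)" using x(2) g[OF x(1)] g[OF mx(1)] mx x(1) Z[OF x(1)] by auto
    have "conn (R x \<union> (Z x \<union> R (m x))) (\<tau> x) (\<tau> (m x))"
      using R(1)[OF x(1)] Z[OF x(1)] conn_sym[OF R(1)[OF mx(1)]] by (blast intro: conn_join)
    then show "conn (?Z (g t)) t (\<tau> (m (g t)))" using x g by (simp add: Un_ac)
    fix s assume s: "s \<in> \<tau> ` X" "s \<noteq> t" "s \<noteq> \<tau> (m (g t))"
    then obtain y where y: "y \<in> X" "s = \<tau> y" by auto
    note my = mX[OF y(1)]
    have ne: "y \<noteq> x" "y \<noteq> m x" "m y \<noteq> x" "m y \<noteq> m x" using s x y g mx my by auto
    have "Z y \<inter> Z x = {}" using Z[OF x(1)] y ne by auto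
    moreover have "R a \<inter> R b = {}" if "a \<in> {y, m y}" "b \<in> {x, m x}" for a b
      using that R(3)[of a b] ne x y mx my by auto
    moreover have "R a \<inter> Z b = {}" "Z b \<inter> R a = {}" if "a \<in> X" "b \<in> X" for a b
      using that R(2)[of a] Z[of b] by auto
    ultimately show "?Z (g s) \<inter> ?Z (g t) = {}"
      using x y g mx my by (simp add: Int_Un_distrib Int_Un_distrib2)
  qed
qed

lemma joinable_T_join:
  assumes "joinable E T" "T \<subseteq> V"
  shows "\<exists>P. T_join G T P"
proof -
  obtain m Z where m: "pairing m T"
    and Z0: "\<forall>t\<in>T. Z t \<subseteq> E \<and> Z (m t) = Z t \<and> conn (Z t) t (m t) \<and>
       (\<forall>s\<in>T. s \<noteq> t \<longrightarrow> s \<noteq> m t \<longrightarrow> Z s \<inter> Z t = {})"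
    using assms(1) unfolding joinable_def by blast
  note Z = bspec[OF Z0]
  have mT: "m t \<in> T" "m t \<noteq> t" "m (m t) = t" if "t \<in> T" for t
    using m that by (auto simp: pairing_def)
  have "\<exists>p. is_path G p \<and> endvertices p = {t, m t} \<and> path_edges p \<subseteq> Z t" if t: "t \<in> T" for t
  proof -
    obtain p where "is_path G p" "hd (fst p) = t" "last (fst p) = m t" "path_edges p \<subseteq> Z t"
      using conn_path[of "Z t" t "m t"] Z[OF t] t assms(2) by blast
    then show ?thesis by (auto simp: endvertices_def simp del: split_paired_Ex intro!: exI[of _ p])
  qed
  \<comment> \<open>The path is chosen for the pair and not for the single terminal, so that both
    partners receive the same path.\<close>
  then have "\<forall>q\<in>(\<lambda>t. {t, m t}) ` T. \<exists>p. is_path G p \<and> endvertices p = q \<and>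
      (\<forall>t\<in>q. path_edges p \<subseteq> Z t)"
    using Z by auto
  then obtain f where f: "\<And>q. q \<in> (\<lambda>t. {t, m t}) ` T \<Longrightarrow> is_path G (f q) \<and> endvertices (f q) = q \<and>
      (\<forall>t\<in>q. path_edges (f q) \<subseteq> Z t)"
    by metis
  have fT: "is_path G (f {t, m t})" "endvertices (f {t, m t}) = {t, m t}"
    "path_edges (f {t, m t}) \<subseteq> Z t" if "t \<in> T" for t
    using f[of "{t, m t}"] that by auto
  have "T_join G T (f ` (\<lambda>t. {t, m t}) ` T)"
    unfolding T_join_def
  proof (intro conjI ballI impI)
    fix p assume "p \<in> f ` (\<lambda>t. {t, m t}) ` T"
    then obtain t where t: "t \<in> T" "p = f {t, m t}" by auto
    show "is_path G p" "endvertices p \<subseteq> T" "card (endvertices p) = 2"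
      using t fT mT[OF t(1)] by auto
    fix q assume "q \<in> f ` (\<lambda>t. {t, m t}) ` T" "p \<noteq> q"
    then obtain s where s: "s \<in> T" "q = f {s, m s}" by auto
    have "s \<noteq> t" "s \<noteq> m t" using s t \<open>p \<noteq> q\<close> mT[OF t(1)] by (auto simp: insert_commute)
    then have "Z s \<inter> Z t = {}" using Z[OF t(1)] s by auto
    then show "path_edges p \<inter> path_edges q = {}" using fT[OF t(1)] fT[OF s(1)] s t by auto
  next
    fix v assume v: "v \<in> T"
    show "\<exists>!p. p \<in> f ` (\<lambda>t. {t, m t}) ` T \<and> v \<in> endvertices p"
    proof (intro ex1I conjI)
      show "f {v, m v} \<in> f ` (\<lambda>t. {t, m t}) ` T" "v \<in> endvertices (f {v, m v})"
        using v fT by auto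
      fix p assume p: "p \<in> f ` (\<lambda>t. {t, m t}) ` T \<and> v \<in> endvertices p"
      then obtain t where t: "t \<in> T" "p = f {t, m t}" by auto
      then have "v = t \<or> v = m t" using p fT by auto
      then show "p = f {v, m v}" using t mT[OF t(1)] by (auto simp: insert_commute)
    qed
  qed
  then show ?thesis by blast
qed

end

subsection \<open>Joins in rooted trees\<close>

text \<open>Every second element of each orbit is taken. As \<open>f\<close> raises
  \<open>d\<close>, only finitely many steps back from \<open>x\<close> are possible;
  \<open>A x\<close> collects their numbers, and the parity of its size decides whether
  \<open>x\<close> is taken.\<close>

lemma halving:
  fixes d :: "'b \<Rightarrow> nat"
  assumes f: "\<And>x. x \<in> X \<Longrightarrow> f x \<in> X" and inj: "inj_on f X"
    and d: "\<And>x. x \<in> X \<Longrightarrow> d x < d (f x)"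
  shows "\<exists>Y\<subseteq>X. X = Y \<union> f ` Y \<and> Y \<inter> f ` Y = {}"
proof -
  define A where "A x = {k. k \<ge> 1 \<and> x \<in> (f ^^ k) ` X}" for x
  have fk: "(f ^^ k) x \<in> X \<and> d x + k \<le> d ((f ^^ k) x)" if "x \<in> X" for k x
  proof (induction k)
    case (Suc k)
    then show ?case using f d[of "(f ^^ k) x"] by auto
  qed (use that in simp)
  have fin: "finite (A x)" for x
  proof (rule finite_subset)
    show "A x \<subseteq> {..d x}"
    proof
      fix k assume "k \<in> A x"
      then obtain y where "y \<in> X" "x = (f ^^ k) y" by (auto simp: A_def)
      then show "k \<in> {..d x}" using fk[of y k] by auto
    qed
  qed simp
  have Af: "A (f x) = insert 1 (Suc ` A x)" if x: "x \<in> X" for x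
  proof (intro equalityI subsetI)
    fix k assume "k \<in> A (f x)"
    then obtain y j where y: "y \<in> X" "f x = (f ^^ Suc j) y" "k = Suc j"
      by (cases k) (auto simp: A_def)
    then have "x = (f ^^ j) y" using inj x fk[of y j] by (auto simp: inj_on_def)
    then show "k \<in> insert 1 (Suc ` A x)" using y by (cases "j = 0") (auto simp: A_def)
  next
    fix k assume "k \<in> insert 1 (Suc ` A x)"
    then show "k \<in> A (f x)" using x by (auto simp: A_def)
  qed
  have c: "card (A (f x)) = Suc (card (A x))" if "x \<in> X" for x
  proof -
    have "1 \<notin> Suc ` A x" by (auto simp: A_def)
    then show ?thesis using Af[OF that] fin by (simp add: card_image)
  qed
  let ?Y = "{x \<in> X. even (card (A x))}"
  have "x \<in> f ` ?Y" if "x \<in> X" "x \<notin> ?Y" for x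
  proof -
    have "A x \<noteq> {}" using that by auto
    then obtain k y where y: "y \<in> X" "x = (f ^^ Suc k) y"
      unfolding A_def by (auto simp: gr0_conv_Suc Suc_le_eq)
    let ?z = "(f ^^ k) y"
    have z: "?z \<in> X" "x = f ?z" using fk[OF y(1)] y by auto
    then have "?z \<in> ?Y" using c[of ?z] that by auto
    then show ?thesis using z by blast
  qed
  moreover have "f x \<notin> ?Y" if "x \<in> ?Y" for x using c[of x] that by auto
  ultimately show ?thesis using f by (intro exI[of _ ?Y]) auto
qed

text \<open>The depth decreases along \<open>par\<close>, which excludes cycles and makes every
  ascent end at \<open>r\<close>. Each tree edge is named by its lower end.\<close>

locale spanning_tree = wf_graph G for G :: "('a, 'e) multigraph" +
  fixes r :: 'a and par :: "'a \<Rightarrow> 'a" and pe :: "'a \<Rightarrow> 'e" and dep :: "'a \<Rightarrow> nat" and T :: "'a set"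
  assumes par: "\<And>v. v \<in> V \<Longrightarrow> v \<noteq> r \<Longrightarrow>
      par v \<in> V \<and> pe v \<in> E \<and> en (pe v) = {v, par v} \<and> dep v = Suc (dep (par v))"
begin

text \<open>The conditions on \<open>c\<close> cut off the arbitrary values of \<open>par\<close> at
  \<open>r\<close> and outside \<open>V\<close>.\<close>

definition child :: "'a \<Rightarrow> 'a \<Rightarrow> bool" where
  "child c v \<longleftrightarrow> c \<in> V \<and> c \<noteq> r \<and> par c = v"

definition S :: "'a \<Rightarrow> 'a set" where
  "S v = {w. (w, v) \<in> {(c, u). child c u}\<^sup>*}"

text \<open>The edges of the subtree at \<open>v\<close>. The edge from \<open>v\<close> to its
  parent is excluded and enters only through \<open>route\<close>.\<close>

definition ES :: "'a \<Rightarrow> 'e set" where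
  "ES v = pe ` (S v - {v})"

lemma S_refl [simp]: "v \<in> S v"
  by (simp add: S_def)

lemma S_trans: "u \<in> S v \<Longrightarrow> v \<in> S w \<Longrightarrow> u \<in> S w"
  by (auto simp: S_def)

lemma S_child: "child c v \<Longrightarrow> c \<in> S v"
  by (auto simp: S_def)

lemma S_up: "w \<in> S v \<Longrightarrow> w \<noteq> v \<Longrightarrow> child w (par w) \<and> par w \<in> S v"
  unfolding S_def by (auto elim: converse_rtranclE simp: child_def)

lemma S_down:
  assumes "w \<in> S v" "w \<noteq> v"
  obtains c where "child c v" "w \<in> S c"
  using assms unfolding S_def by (auto elim: rtranclE)

lemma S_induct [consumes 1, case_names top up]:
  assumes "w \<in> S v" "P v" "\<And>x. child x (par x) \<Longrightarrow> par x \<in> S v \<Longrightarrow> P (par x) \<Longrightarrow> P x"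
  shows "P w"
  using assms(1) unfolding S_def mem_Collect_eq
proof (induction rule: converse_rtrancl_induct)
  case (step x y)
  then have "y = par x" "child x y" by (simp_all add: child_def)
  then show ?case using assms(3)[of x] step by (simp add: S_def)
qed (rule assms(2))

lemma child_dep: "child c v \<Longrightarrow> dep c = Suc (dep v)"
  using par by (auto simp: child_def)

lemma S_dep: "w \<in> S v \<Longrightarrow> dep v \<le> dep w"
  by (induction rule: S_induct) (auto dest: child_dep)

lemma S_dep_less: "w \<in> S v \<Longrightarrow> w \<noteq> v \<Longrightarrow> dep v < dep w"
  by (metis S_dep S_up child_dep le_imp_less_Suc)

lemma S_antisym: "u \<in> S v \<Longrightarrow> v \<in> S u \<Longrightarrow> u = v"
  by (metis S_dep S_dep_less leD)

lemma S_linear: "w \<in> S u \<Longrightarrow> w \<in> S v \<Longrightarrow> u \<in> S v \<or> v \<in> S u"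
proof -
  have "single_valued {(c, u). child c u}" by (auto simp: single_valued_def child_def)
  then show "w \<in> S u \<Longrightarrow> w \<in> S v \<Longrightarrow> u \<in> S v \<or> v \<in> S u"
    unfolding S_def mem_Collect_eq by (rule single_valued_confluent)
qed

lemma S_proper: "w \<in> S v \<Longrightarrow> w \<noteq> v \<Longrightarrow> w \<in> V - {r}"
  using S_up by (auto simp: child_def)

text \<open>Two vertices with the same parent edge would be parents of each other, which the depths
  forbid. Disjointness of edge sets in the tree thereby reduces to disjointness of vertex
  sets.\<close>

lemma pe_inj: "inj_on pe (V - {r})"
proof (rule inj_onI)
  fix v w assume vw: "v \<in> V - {r}" "w \<in> V - {r}" "pe v = pe w"
  then have *: "{v, par v} = {w, par w}" "dep v = Suc (dep (par v))" "dep w = Suc (dep (par w))"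
    using par[of v] par[of w] by simp_all
  show "v = w"
  proof (rule ccontr)
    assume "v \<noteq> w"
    then have "v = par w" "w = par v" using *(1) by (auto simp: doubleton_eq_iff)
    then show False using *(2,3) by simp
  qed
qed

lemma pe_disjoint: "A \<subseteq> V - {r} \<Longrightarrow> B \<subseteq> V - {r} \<Longrightarrow> A \<inter> B = {} \<Longrightarrow> pe ` A \<inter> pe ` B = {}"
  using inj_on_image_Int[OF pe_inj, of A B] by auto

lemma child_S: "child c v \<Longrightarrow> S c \<subseteq> V - {r}"
proof
  fix x assume "child c v" "x \<in> S c"
  then show "x \<in> V - {r}" using S_proper[of x c] by (cases "x = c") (auto simp: child_def)
qed

lemma child_ES: "child c v \<Longrightarrow> pe ` S c = insert (pe c) (ES c)"
  by (auto simp: ES_def)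

lemma child_notin: "child c v \<Longrightarrow> v \<notin> S c"
  by (metis S_dep child_dep Suc_n_not_le_n)

lemma pe_notin_ES: "child c v \<Longrightarrow> pe c \<notin> ES c"
proof
  assume c: "child c v" and "pe c \<in> ES c"
  then obtain x where "x \<in> S c" "x \<noteq> c" "pe x = pe c" unfolding ES_def by force
  then show False using child_S[OF c] pe_inj by (metis S_refl inj_onD subsetD)
qed

text \<open>A subtree is resolved if its terminals can be joined inside it, up to at most one terminal
  for which a route to the root of the subtree is kept free.\<close>

definition settled :: "'a \<Rightarrow> bool" where
  "settled v \<longleftrightarrow> joinable (ES v) (T \<inter> S v)"

definition sends :: "'a \<Rightarrow> 'a \<Rightarrow> 'e set \<Rightarrow> bool" where
  "sends v t R \<longleftrightarrow> t \<in> T \<inter> S v \<and> R \<subseteq> ES v \<and> conn R t v \<and> joinable (ES v - R) (T \<inter> S v - {t})"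

definition resolved :: "'a \<Rightarrow> bool" where
  "resolved v \<longleftrightarrow> settled v \<or> (\<exists>t R. sends v t R)"

definition tok :: "'a \<Rightarrow> 'a" where
  "tok v = (SOME t. \<exists>R. sends v t R)"

text \<open>The edge \<open>pe v\<close> is added because the token is to be handed to the parent of
  \<open>v\<close>.\<close>

definition route :: "'a \<Rightarrow> 'e set" where
  "route v = insert (pe v) (SOME R. sends v (tok v) R)"

text \<open>A subtree that can be settled is settled; only otherwise does it pass a token upwards,
  so every child contributes at most one.\<close>

definition sender :: "'a \<Rightarrow> bool" where
  "sender c \<longleftrightarrow> resolved c \<and> \<not> settled c"

lemma sender:
  assumes "sender c" "child c w"
  shows "tok c \<in> T" "tok c \<in> S c" "route c \<subseteq> pe ` S c" "conn (route c) (tok c) w"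
    "joinable (ES c - route c) (T \<inter> S c - {tok c})"
proof -
  have "\<exists>R. sends c (tok c) R"
    unfolding tok_def by (rule someI_ex) (use assms in \<open>auto simp: sender_def resolved_def\<close>)
  then have "sends c (tok c) (SOME R. sends c (tok c) R)" by (rule someI_ex)
  then obtain R where R: "sends c (tok c) R" "route c = insert (pe c) R"
    unfolding route_def by blast
  then show "tok c \<in> T" "tok c \<in> S c" "route c \<subseteq> pe ` S c"
    using child_ES[OF assms(2)] by (auto simp: sends_def)
  have "conn {pe c} c w" using assms(2) par by (intro conn_edge) (auto simp: child_def)
  then show "conn (route c) (tok c) w"
    using R conn_join[of R "tok c" c "{pe c}" w] by (auto simp: sends_def)
  have "ES c - route c = ES c - R" using R(2) pe_notin_ES[OF assms(2)] by auto
  then show "joinable (ES c - route c) (T \<inter> S c - {tok c})" using R by (simp add: sends_def)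
qed

definition tokens :: "'a \<Rightarrow> 'a set" where
  "tokens w = (T \<inter> {w}) \<union> tok ` {c. child c w \<and> sender c}"

text \<open>Written as a union so that the terminal at \<open>w\<close> itself gets the empty route.
  For any other token the union has a single member by \<open>troute_child\<close>.\<close>

definition troute :: "'a \<Rightarrow> 'a \<Rightarrow> 'e set" where
  "troute w t = \<Union>{route c | c. child c w \<and> sender c \<and> tok c = t}"

text \<open>Infinitely many tokens can be paired off completely, so a leftover arises only from a
  finite odd number.\<close>

definition odd_at :: "'a \<Rightarrow> bool" where
  "odd_at w \<longleftrightarrow> finite (tokens w) \<and> odd (card (tokens w))"

definition spare :: "'a \<Rightarrow> 'a" where
  "spare w = (SOME t. t \<in> tokens w)"

lemma siblings_disjoint: "child c w \<Longrightarrow> child c' w \<Longrightarrow> c \<noteq> c' \<Longrightarrow> S c \<inter> S c' = {}"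
  by (metis S_dep_less S_linear child_dep disjoint_iff less_irrefl)

lemma troute_child:
  assumes "child c w" "sender c"
  shows "troute w (tok c) = route c"
proof -
  have "c' = c" if "child c' w" "sender c'" "tok c' = tok c" for c'
    using siblings_disjoint[of c w c'] sender(2)[OF assms(2,1)] sender(2)[OF that(2,1)] that assms
    by auto
  then show ?thesis using assms by (auto simp: troute_def)
qed

lemma tok_neq: "child c w \<Longrightarrow> sender c \<Longrightarrow> tok c \<noteq> w"
  using sender(2) child_notin by metis

lemma troute_self: "troute w w = {}"
  using tok_neq by (auto simp: troute_def)

lemma tokensE:
  assumes "t \<in> tokens w"
  obtains "t = w" "t \<in> T" "troute w t = {}"
  | c where "child c w" "sender c" "t = tok c" "troute w t = route c"
  using assms troute_child troute_self by (auto simp: tokens_def)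

lemma tokens_sub: "tokens w \<subseteq> T \<inter> S w"
proof
  fix t assume "t \<in> tokens w"
  then show "t \<in> T \<inter> S w"
    by (cases rule: tokensE) (auto dest: sender S_child intro: S_trans)
qed

lemma troute_conn: "t \<in> tokens w \<Longrightarrow> conn (troute w t) t w"
  by (erule tokensE) (auto dest: sender)

lemma troute_disjoint:
  assumes "s \<in> tokens w" "t \<in> tokens w" "s \<noteq> t"
  shows "troute w s \<inter> troute w t = {}"
  using assms(1)
proof (cases rule: tokensE)
  case (2 c)
  note c = this
  from assms(2) show ?thesis
  proof (cases rule: tokensE)
    case (2 c')
    then have "S c \<inter> S c' = {}" using siblings_disjoint c assms by blast
    then have "pe ` S c \<inter> pe ` S c' = {}" using pe_disjoint child_S c 2 by metis
    then show ?thesis using c 2 sender(3)[OF c(2,1)] sender(3)[OF 2(2,1)] by auto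
  qed auto
qed auto

lemma spare: "odd_at w \<Longrightarrow> spare w \<in> tokens w"
  unfolding spare_def odd_at_def by (rule someI_ex) (metis card.empty ex_in_conv even_zero)

text \<open>\<open>D\<close> is a top part of the subtree at \<open>v0\<close>, and the subtrees
  hanging from it are resolved. Terminals are treated in three layers: inside the hanging subtrees,
  by pairing tokens that arrive at the same vertex of \<open>D\<close>, and, for the spare tokens at
  \<open>X\<close>, by prolonging the given join of \<open>X\<close> in the tree edges of
  \<open>D\<close>. The spare tokens at \<open>L\<close> and their routes stay free.\<close>

lemma region_joinable:
  assumes v0: "v0 \<in> D" "D \<subseteq> S v0"
    and up: "\<And>w. w \<in> D \<Longrightarrow> w \<noteq> v0 \<Longrightarrow> par w \<in> D"
    and bdry: "\<And>w c. w \<in> D \<Longrightarrow> child c w \<Longrightarrow> c \<in> D \<longleftrightarrow> \<not> resolved c"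
    and X: "X \<subseteq> D \<inter> Collect odd_at" "joinable (pe ` (D - {v0})) X"
  defines "L \<equiv> D \<inter> Collect odd_at - X"
  shows "joinable (ES v0 - (\<Union>w\<in>L. troute w (spare w))) (T \<inter> S v0 - spare ` L)"
proof -
  \<comment> \<open>The roots of the hanging subtrees. These subtrees and \<open>D\<close> partition
    \<open>S v0\<close>, which makes the edge sets of different parts disjoint.\<close>
  define bd where "bd = {c. c \<notin> D \<and> (\<exists>w\<in>D. child c w)}"
  have bd_child: "child c (par c)" "par c \<in> D" if "c \<in> bd" for c
    using that by (auto simp: bd_def child_def)
  have bd_res: "resolved c" if "c \<in> bd" for c
    using that bdry by (auto simp: bd_def)
  have D_res: "c \<in> bd" if "child c w" "w \<in> D" "sender c" for c w
    using that bdry[of w c] by (auto simp: bd_def sender_def)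
  have S_bd: "S c \<subseteq> S v0" "v0 \<notin> S c" if "c \<in> bd" for c
  proof -
    have "S (par c) \<subseteq> S v0" using bd_child[OF that] v0 S_trans by blast
    moreover have "S c \<subseteq> S (par c)" using bd_child[OF that] S_child S_trans by blast
    ultimately show "S c \<subseteq> S v0" by blast
    show "v0 \<notin> S c"
      using bd_child[OF that] v0 S_dep[of v0 c] S_dep[of "par c" v0] child_dep[of c "par c"] by auto
  qed
  have D_bd: "D \<inter> S c = {}" if c: "c \<in> bd" for c
  proof -
    have "y \<in> D \<longrightarrow> c \<in> D" if "y \<in> S c" for y
      using that
    proof (induction rule: S_induct)
      case (up x)
      then have "x \<in> S c" using S_child S_trans by blast
      then have "x \<noteq> v0" using S_bd(2)[OF c] by auto
      then show ?case using up assms(3)[of x] by auto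
    qed simp
    then show ?thesis using c by (auto simp: bd_def)
  qed
  have bd_disj: "S c \<inter> S c' = {}" if cc: "c \<in> bd" "c' \<in> bd" "c \<noteq> c'" for c c'
  proof -
    have "a \<notin> S b" if "a \<in> bd" "b \<in> bd" "a \<noteq> b" for a b
      using S_up[of a b] that bd_child[of a] D_bd[of b] by auto
    then show ?thesis using S_linear cc by blast
  qed
  have cover: "x \<in> D \<or> (\<exists>c\<in>bd. x \<in> S c)" if "x \<in> S v0" for x
    using that
  proof (induction rule: S_induct)
    case (up x)
    then show ?case
      using S_child[OF up(1)] S_trans by (cases "x \<in> D") (auto simp: bd_def)
  qed (use v0 in simp)
  have bd_V: "S c \<subseteq> V - {r}" if "c \<in> bd" for c
    using child_S bd_child that by blast
  have D_V: "D - {v0} \<subseteq> V - {r}" using S_proper v0 by blast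
  have peS: "pe ` S c \<inter> pe ` S c' = {}" if "c \<in> bd" "c' \<in> bd" "c \<noteq> c'" for c c'
    by (rule pe_disjoint) (use bd_V bd_disj that in auto)
  have peD: "pe ` (D - {v0}) \<inter> pe ` S c = {}" if "c \<in> bd" for c
    by (rule pe_disjoint) (use bd_V[OF that] D_V D_bd[OF that] in auto)
  have ES_bd: "pe ` S c \<subseteq> ES v0" if "c \<in> bd" for c
    using S_bd[OF that] by (auto simp: ES_def)
  have ES_D: "pe ` (D - {v0}) \<subseteq> ES v0" using v0 by (auto simp: ES_def)
  have ES_sub: "ES c \<subseteq> pe ` S c" for c by (auto simp: ES_def)
  let ?Dc = "\<lambda>c. if sender c then ES c - route c else ES c"
  let ?Tc = "\<lambda>c. if sender c then T \<inter> S c - {tok c} else T \<inter> S c"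
  let ?O = "D \<inter> Collect odd_at"
  let ?N = "\<lambda>w. if odd_at w then tokens w - {spare w} else tokens w"
  \<comment> \<open>First layer: everything inside the hanging subtrees except the tokens they
    send.\<close>
  define U1 where "U1 = (\<Union>c\<in>bd. ?Dc c)"
  define T1 where "T1 = (\<Union>c\<in>bd. ?Tc c)"
  have j1: "joinable U1 T1"
    unfolding U1_def T1_def
  proof (rule joinable_UN)
    fix c assume c: "c \<in> bd"
    show "joinable (?Dc c) (?Tc c)"
      using sender(5) bd_child[OF c] bd_res[OF c] by (auto simp: sender_def settled_def)
    fix c' assume c': "c' \<in> bd" "c \<noteq> c'"
    have "?Dc c \<subseteq> pe ` S c" "?Dc c' \<subseteq> pe ` S c'" using ES_sub by auto
    then show "?Dc c \<inter> ?Dc c' = {}" using peS[OF c c'] by blast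
    show "?Tc c \<inter> ?Tc c' = {}" using bd_disj[OF c c'] by auto
  qed
  \<comment> \<open>Second layer: the tokens paired off at their vertex, with one spare token set
    aside where their number is odd.\<close>
  define U2 where "U2 = (\<Union>w\<in>D. \<Union>t\<in>?N w. troute w t)"
  define T2 where "T2 = (\<Union>w\<in>D. ?N w)"
  have troute_S: "troute w t = {} \<or> (\<exists>c\<in>bd. child c w \<and> sender c \<and> t = tok c \<and> troute w t = route c \<and> troute w t \<subseteq> pe ` S c)"
    if t: "t \<in> tokens w" "w \<in> D" for w t
    using t(1)
  proof (cases rule: tokensE)
    case (2 c)
    then show ?thesis using D_res[of c w] t sender(3)[of c w] by auto
  qed simp
  have disj: "troute w t \<inter> troute w' t' = {}"
    if t: "t \<in> tokens w" "w \<in> D" "t' \<in> tokens w'" "w' \<in> D" "w \<noteq> w'" for w t w' t'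
  proof (rule ccontr)
    assume ne: "\<not> ?thesis"
    obtain c where c: "c \<in> bd" "child c w" "troute w t \<subseteq> pe ` S c"
      using troute_S[OF t(1,2)] ne by auto
    obtain c' where c': "c' \<in> bd" "child c' w'" "troute w' t' \<subseteq> pe ` S c'"
      using troute_S[OF t(3,4)] ne by auto
    have "c \<noteq> c'" using c c' t by (auto simp: child_def)
    then show False using peS[OF c(1) c'(1)] c c' ne by blast
  qed
  have tokens_disj: "tokens w \<inter> tokens w' = {}" if w: "w \<in> D" "w' \<in> D" "w \<noteq> w'" for w w'
  proof -
    have *: "t = w \<or> (\<exists>c\<in>bd. child c w \<and> t \<in> S c)" if "t \<in> tokens w" "w \<in> D" for t w
      using that(1)
    proof (cases rule: tokensE)
      case (2 c)
      then show ?thesis using D_res[of c w] that sender(2)[of c w] by auto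
    qed simp
    show ?thesis
    proof (rule ccontr)
      assume "\<not> ?thesis"
      then obtain t where t: "t \<in> tokens w" "t \<in> tokens w'" by auto
      consider "t \<in> D" "t = w \<or> t = w'"
        | c c' where "c \<in> bd" "child c w" "t \<in> S c" "c' \<in> bd" "child c' w'" "t \<in> S c'"
        using *[OF t(1) w(1)] *[OF t(2) w(2)] w by blast
      then show False
      proof cases
        case 1
        then show ?thesis using *[OF t(1) w(1)] *[OF t(2) w(2)] D_bd w(3) by blast
      next
        case (2 c c')
        then have "c \<noteq> c'" using w(3) by (auto simp: child_def)
        then show ?thesis using bd_disj 2 by blast
      qed
    qed
  qed
  have N_card: "infinite (?N w) \<or> even (card (?N w))" for w
    using spare[of w] by (auto simp: odd_at_def)
  have j2: "joinable U2 T2"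
    unfolding U2_def T2_def
  proof (rule joinable_UN)
    fix w assume w: "w \<in> D"
    show "joinable (\<Union>t\<in>?N w. troute w t) (?N w)"
    proof (rule joinable_at_vertex)
      show "infinite (?N w) \<or> even (card (?N w))" by (rule N_card)
    qed (use troute_conn troute_disjoint in \<open>auto split: if_splits\<close>)
    fix w' assume w': "w' \<in> D" "w \<noteq> w'"
    have "?N w \<subseteq> tokens w" "?N w' \<subseteq> tokens w'" by auto
    then show "?N w \<inter> ?N w' = {}" using tokens_disj[OF w w'] by blast
    show "(\<Union>t\<in>?N w. troute w t) \<inter> (\<Union>t\<in>?N w'. troute w' t) = {}"
      using disj[of _ w _ w'] w w' by (fastforce split: if_splits)
  qed
  \<comment> \<open>Third layer: the spare tokens at \<open>X\<close>, brought to their vertices and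
    joined there through \<open>D\<close>.\<close>
  define U3 where "U3 = pe ` (D - {v0}) \<union> (\<Union>w\<in>X. troute w (spare w))"
  have spareO: "spare w \<in> tokens w" "w \<in> D" if "w \<in> ?O" for w using spare that by auto
  have inj: "inj_on spare ?O"
  proof (rule inj_onI)
    fix v w assume vw: "v \<in> ?O" "w \<in> ?O" "spare v = spare w"
    then have "spare v \<in> tokens v \<inter> tokens w" using spareO(1)[of v] spareO(1)[of w] by simp
    then show "v = w" using tokens_disj[of v w] vw by auto
  qed
  have peDt: "pe ` (D - {v0}) \<inter> troute w t = {}" if "t \<in> tokens w" "w \<in> D" for t w
    using troute_S[OF that] peD by fastforce
  have j3: "joinable U3 (spare ` X)"
    unfolding U3_def
  proof (rule joinable_transfer[OF X(2)])
    show "inj_on spare X" using inj X(1) by (rule inj_on_subset)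
    fix w assume w: "w \<in> X"
    then have wO: "w \<in> ?O" using X by auto
    show "conn (troute w (spare w)) (spare w) w" using spareO[OF wO] troute_conn by auto
    show "troute w (spare w) \<inter> pe ` (D - {v0}) = {}" using peDt spareO[OF wO] by auto
    fix v assume v: "v \<in> X" "v \<noteq> w"
    then have vO: "v \<in> ?O" using X by auto
    show "troute v (spare v) \<inter> troute w (spare w) = {}" using disj spareO vO wO v by metis
  qed
  have troute_sender: "?Dc c \<inter> troute w t = {}"
    if tw: "t \<in> tokens w" "w \<in> D" and c: "c \<in> bd" for c w t
  proof (cases "troute w t = {}")
    case False
    then obtain c' where c': "c' \<in> bd" "sender c'" "troute w t = route c'" "troute w t \<subseteq> pe ` S c'"
      using troute_S[OF tw] by auto
    show ?thesis
    proof (cases "c = c'")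
      case False
      have "?Dc c \<subseteq> pe ` S c" using ES_sub by auto
      then show ?thesis using peS[OF c c'(1) False] c'(4) by blast
    qed (use c' in auto)
  qed simp
  have tok_T1: "t \<notin> T1" if t: "t \<in> tokens w" "w \<in> D" for t w
  proof
    assume "t \<in> T1"
    then obtain c where c: "c \<in> bd" "t \<in> ?Tc c" by (auto simp: T1_def)
    from t(1) show False
    proof (cases rule: tokensE)
      case 1
      then show ?thesis using c D_bd t by (auto split: if_splits)
    next
      case (2 c')
      then have c': "c' \<in> bd" "t \<in> S c'" using D_res sender(2) t by auto
      then have "c = c'" using c bd_disj by (fastforce split: if_splits)
      then show ?thesis using c 2 by auto
    qed
  qed
  have d12: "U1 \<inter> U2 = {}" and t12: "T1 \<inter> T2 = {}"
  proof -
    show "U1 \<inter> U2 = {}" using troute_sender unfolding U1_def U2_def by (fastforce split: if_splits)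
    show "T1 \<inter> T2 = {}" using tok_T1 unfolding T2_def by (auto split: if_splits)
  qed
  have XO: "w \<in> ?O" if "w \<in> X" for w using that X by auto
  have d3: "(U1 \<union> U2) \<inter> (U3 \<union> (\<Union>w\<in>L. troute w (spare w))) = {}"
  proof -
    have LX: "w \<in> ?O" if "w \<in> L \<or> w \<in> X" for w using that X by (auto simp: L_def)
    have a: "?Dc c \<inter> pe ` (D - {v0}) = {}" if "c \<in> bd" for c
    proof -
      have "?Dc c \<subseteq> pe ` S c" using ES_sub by auto
      then show ?thesis using peD[OF that] by blast
    qed
    have b: "troute w t \<inter> troute w' (spare w') = {}"
      if "w \<in> D" "t \<in> ?N w" "w' \<in> ?O" for w t w'
    proof (cases "w = w'")
      case True
      then have "t \<in> tokens w" "spare w \<in> tokens w" "t \<noteq> spare w"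
        using that spare by auto
      then show ?thesis using True troute_disjoint by auto
    next
      case False
      then show ?thesis using disj[of t w "spare w'" w'] that spareO[OF that(3)] by (auto split: if_splits)
    qed
    have c: "troute w t \<inter> pe ` (D - {v0}) = {}" if "w \<in> D" "t \<in> ?N w" for w t
      using peDt[of t w] that by (auto split: if_splits)
    have d: "?Dc c \<inter> troute w (spare w) = {}" if "c \<in> bd" "w \<in> ?O" for c w
      using troute_sender[OF spareO[OF that(2)] that(1)] .
    have "x \<notin> U3 \<union> (\<Union>w\<in>L. troute w (spare w))" if x: "x \<in> U1" for x
    proof -
      obtain c where "c \<in> bd" "x \<in> ?Dc c" using x unfolding U1_def by blast
      then show ?thesis using a[of c] d[of c] LX unfolding U3_def by blast
    qed
    moreover have "x \<notin> U3 \<union> (\<Union>w\<in>L. troute w (spare w))" if x: "x \<in> U2" for x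
    proof -
      obtain w t where "w \<in> D" "t \<in> ?N w" "x \<in> troute w t" using x unfolding U2_def by blast
      then show ?thesis using b[of w t] c[of w t] LX unfolding U3_def by blast
    qed
    ultimately show ?thesis by blast
  qed
  have t3: "(T1 \<union> T2) \<inter> spare ` ?O = {}"
  proof -
    have "spare w \<notin> T2" if w: "w \<in> ?O" for w
    proof
      assume "spare w \<in> T2"
      then obtain w' where w': "w' \<in> D" "spare w \<in> ?N w'" by (auto simp: T2_def)
      then have "w' = w" using tokens_disj[of w' w] spareO[OF w] by (auto split: if_splits)
      then show False using w' w by auto
    qed
    then show ?thesis using tok_T1 spareO by blast
  qed
  have j: "joinable (U1 \<union> U2 \<union> U3) (T1 \<union> T2 \<union> spare ` X)"
    by (intro joinable_Un j1 j2 j3 d12 t12) (use d3 t3 XO in blast)+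
  have TS: "T \<inter> S v0 = T1 \<union> T2 \<union> spare ` ?O"
  proof (intro equalityI subsetI)
    fix x assume x: "x \<in> T \<inter> S v0"
    have tk: "y \<in> T2 \<union> spare ` ?O" if "y \<in> tokens w" "w \<in> D" for y w
      using that unfolding T2_def by (cases "y = spare w \<and> odd_at w") auto
    consider "x \<in> D" | c where "c \<in> bd" "x \<in> S c" using cover x by auto
    then show "x \<in> T1 \<union> T2 \<union> spare ` ?O"
    proof cases
      case 1
      then show ?thesis using tk[of x x] x by (auto simp: tokens_def)
    next
      case (2 c)
      show ?thesis
      proof (cases "sender c \<and> x = tok c")
        case True
        then show ?thesis using tk[of x "par c"] 2 bd_child[OF 2(1)] by (auto simp: tokens_def)
      next
        case False
        then have "x \<in> ?Tc c" using 2 x by auto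
        then show ?thesis using 2 unfolding T1_def by blast
      qed
    qed
  next
    fix x assume "x \<in> T1 \<union> T2 \<union> spare ` ?O"
    then consider c where "c \<in> bd" "x \<in> ?Tc c" | w where "w \<in> D" "x \<in> tokens w"
      using spareO unfolding T1_def T2_def by (auto split: if_splits)
    then show "x \<in> T \<inter> S v0"
    proof cases
      case (1 c)
      then show ?thesis using S_bd by (auto split: if_splits)
    next
      case (2 w)
      then show ?thesis using tokens_sub v0 S_trans by blast
    qed
  qed
  have OX: "?O = X \<union> L" "X \<inter> L = {}" using X by (auto simp: L_def)
  have "spare ` X \<inter> spare ` L = {}"
    using inj_on_image_Int[OF inj, of X L] OX by auto
  then have "T1 \<union> T2 \<union> spare ` X = T \<inter> S v0 - spare ` L"
    using TS t3 OX by (auto simp: image_Un)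
  moreover have "U1 \<union> U2 \<union> U3 \<subseteq> ES v0 - (\<Union>w\<in>L. troute w (spare w))"
  proof -
    have tr: "troute w t \<subseteq> ES v0" if "t \<in> tokens w" "w \<in> D" for w t
      using troute_S[OF that] ES_bd by blast
    have "?Dc c \<subseteq> ES v0" if "c \<in> bd" for c
      using ES_bd[OF that] ES_sub[of c] by auto
    then have "U1 \<subseteq> ES v0" unfolding U1_def by blast
    moreover have "U2 \<subseteq> ES v0" unfolding U2_def
      by (intro UN_least tr) (auto split: if_splits)
    moreover have "U3 \<subseteq> ES v0" using tr spareO XO ES_D unfolding U3_def by blast
    moreover have "U3 \<inter> (\<Union>w\<in>L. troute w (spare w)) = {}"
    proof -
      have "troute w (spare w) \<inter> troute w' (spare w') = {}" if "w \<in> X" "w' \<in> L" for w w'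
        using disj[of "spare w" w "spare w'" w'] spareO that OX by blast
      moreover have "pe ` (D - {v0}) \<inter> troute w (spare w) = {}" if "w \<in> L" for w
        using peDt spareO that OX by blast
      ultimately show ?thesis unfolding U3_def by blast
    qed
    ultimately show ?thesis using d3 by blast
  qed
  ultimately show ?thesis using j joinable_mono by metis
qed

text \<open>If no spare token remains, \<open>v0\<close> is settled. If only the one at
  \<open>v0\<close> remains, it becomes the token that \<open>v0\<close> sends, because its route
  already ends at \<open>v0\<close>.\<close>

lemma region_resolved:
  assumes "v0 \<in> D" "D \<subseteq> S v0"
    and "\<And>w. w \<in> D \<Longrightarrow> w \<noteq> v0 \<Longrightarrow> par w \<in> D"
    and "\<And>w c. w \<in> D \<Longrightarrow> child c w \<Longrightarrow> c \<in> D \<longleftrightarrow> \<not> resolved c"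
    and X: "X = D \<inter> Collect odd_at \<or> odd_at v0 \<and> X = D \<inter> Collect odd_at - {v0}"
      "joinable (pe ` (D - {v0})) X"
  shows "resolved v0"
proof -
  let ?L = "D \<inter> Collect odd_at - X"
  have key: "joinable (ES v0 - (\<Union>w\<in>?L. troute w (spare w))) (T \<inter> S v0 - spare ` ?L)"
    by (rule region_joinable[OF assms(1,2)]) (use assms(3,4) X in auto)
  show ?thesis using X(1)
  proof
    assume "X = D \<inter> Collect odd_at"
    then have "settled v0"
      using key by (auto simp: settled_def)
    then show ?thesis by (simp add: resolved_def)
  next
    assume *: "odd_at v0 \<and> X = D \<inter> Collect odd_at - {v0}"
    then have L: "D \<inter> Collect odd_at - X = {v0}" using assms(1) by auto
    have "joinable (ES v0 - troute v0 (spare v0)) (T \<inter> S v0 - {spare v0})"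
      using key L by simp
    moreover have "troute v0 (spare v0) \<subseteq> ES v0"
    proof -
      have "route c \<subseteq> ES v0" if "child c v0" "sender c" for c
      proof -
        have "S c \<subseteq> S v0 - {v0}" using that S_child S_trans child_notin by blast
        then have "pe ` S c \<subseteq> ES v0" by (auto simp: ES_def)
        then show ?thesis using sender(3)[OF that(2,1)] by blast
      qed
      then show ?thesis by (auto simp: troute_def)
    qed
    ultimately have "sends v0 (spare v0) (troute v0 (spare v0))"
      using * spare[of v0] tokens_sub troute_conn by (auto simp: sends_def)
    then show ?thesis by (auto simp: resolved_def)
  qed
qed

text \<open>Below an unresolved vertex, the unresolved vertices split into rays, each of which meets
  odd vertices infinitely often, and consecutive odd vertices on a ray can be joined.\<close>

lemma all_resolved: "resolved v0"
proof (rule ccontr)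
  assume v0: "\<not> resolved v0"
  \<comment> \<open>The vertices reached downwards from \<open>v0\<close> through unresolved
    vertices only, so that the hanging subtrees are resolved as \<open>region_resolved\<close>
    demands.\<close>
  define D where "D = {w \<in> S v0. \<forall>u. w \<in> S u \<longrightarrow> u \<in> S v0 \<longrightarrow> \<not> resolved u}"
  have D0: "v0 \<in> D" using v0 S_antisym by (auto simp: D_def)
  have DS: "D \<subseteq> S v0" by (auto simp: D_def)
  have Dnot: "\<not> resolved w" if "w \<in> D" for w using that by (auto simp: D_def)
  have Dup: "u \<in> D" if "w \<in> D" "w \<in> S u" "u \<in> S v0" for w u
    using that S_trans by (auto simp: D_def)
  have Dpar: "par w \<in> D" if "w \<in> D" "w \<noteq> v0" for w
    using that S_up[of w v0] Dup[of w "par w"] S_child DS by blast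
  have Dchild: "c \<in> D \<longleftrightarrow> \<not> resolved c" if "w \<in> D" "child c w" for w c
  proof
    assume c: "\<not> resolved c"
    have "\<not> resolved u" if u: "c \<in> S u" "u \<in> S v0" for u
    proof (cases "u = c")
      case False
      then have "w \<in> S u" using S_up[of c u] u \<open>child c w\<close> by (auto simp: child_def)
      then show ?thesis using \<open>w \<in> D\<close> u by (auto simp: D_def)
    qed (use c in simp)
    moreover have "c \<in> S v0" using that S_child[of c w] S_trans[of c w v0] DS by blast
    ultimately show "c \<in> D" by (auto simp: D_def)
  qed (use Dnot in simp)
  \<comment> \<open>Otherwise all children of \<open>w\<close> are resolved and the region
    \<open>{w}\<close> resolves \<open>w\<close>: a spare token, if there is one, is sent by
    \<open>w\<close> itself.\<close>
  have down: "\<exists>c\<in>D. child c w" if w: "w \<in> D" for w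
  proof (rule ccontr)
    assume no: "\<not> ?thesis"
    have "resolved w"
    proof (rule region_resolved[of w "{w}" "{}"])
      fix u c assume "u \<in> {w}" "child c u"
      then have "child c w" "c \<noteq> w" using child_dep[of c u] by auto
      then show "c \<in> {w} \<longleftrightarrow> \<not> resolved c" using no Dchild[OF w, of c] by blast
    qed auto
    then show False using Dnot w by auto
  qed
  \<comment> \<open>Otherwise the part of \<open>D\<close> below \<open>w\<close> has no spare
    tokens, and as a region with empty \<open>X\<close> it resolves \<open>w\<close>.\<close>
  have odd_below: "\<exists>z\<in>D. z \<in> S w \<and> odd_at z" if w: "w \<in> D" for w
  proof (rule ccontr)
    assume no: "\<not> ?thesis"
    have v0w: "v0 \<in> S w \<Longrightarrow> v0 = w" using w DS S_antisym by auto
    have "resolved w"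
    proof (rule region_resolved[of w "D \<inter> S w" "{}"])
      fix u assume u: "u \<in> D \<inter> S w" "u \<noteq> w"
      then show "par u \<in> D \<inter> S w" using Dpar[of u] S_up[of u w] v0w by auto
    next
      fix u c assume "u \<in> D \<inter> S w" "child c u"
      then show "c \<in> D \<inter> S w \<longleftrightarrow> \<not> resolved c"
        using Dchild[of u c] S_child S_trans by blast
    qed (use w no in auto)
    then show False using Dnot w by auto
  qed
  \<comment> \<open>The number of levels from \<open>w\<close> down to the nearest odd vertex of
    \<open>D\<close>; it is 0 if \<open>w\<close> is odd.\<close>
  define h where "h w = (LEAST k. \<exists>z\<in>D. z \<in> S w \<and> odd_at z \<and> dep z = dep w + k)" for w
  have hz: "\<exists>z\<in>D. z \<in> S w \<and> odd_at z \<and> dep z = dep w + h w" if w: "w \<in> D" for w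
  proof -
    obtain z where "z \<in> D" "z \<in> S w" "odd_at z" using odd_below w by blast
    then have "\<exists>k. \<exists>z\<in>D. z \<in> S w \<and> odd_at z \<and> dep z = dep w + k"
      using S_dep[of z w] by (metis le_add_diff_inverse)
    then show ?thesis unfolding h_def by (rule LeastI_ex)
  qed
  have h_le: "h w \<le> dep z - dep w" if "z \<in> D" "z \<in> S w" "odd_at z" for w z
    unfolding h_def using that S_dep[of z w] by (intro Least_le) auto
  \<comment> \<open>The child \<open>n w\<close> is one with the nearest odd vertex below it, so
    \<open>h\<close> decreases along \<open>n\<close> until an odd vertex is reached. As
    \<open>par\<close> inverts \<open>n\<close>, the iterates of \<open>n\<close> form rays that
    never merge.\<close>
  have "\<exists>c. (c \<in> D \<and> child c w) \<and> (\<forall>c'. c' \<in> D \<and> child c' w \<longrightarrow> h c \<le> h c')" if "w \<in> D" for w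
    using down[OF that] ex_has_least_nat[of "\<lambda>c. c \<in> D \<and> child c w" _ h] by blast
  then obtain n where n: "\<And>w. w \<in> D \<Longrightarrow> n w \<in> D" "\<And>w. w \<in> D \<Longrightarrow> child (n w) w"
    and n_least: "\<And>w c. w \<in> D \<Longrightarrow> c \<in> D \<Longrightarrow> child c w \<Longrightarrow> h (n w) \<le> h c"
    by metis
  have nk: "(n ^^ k) w \<in> D" if "w \<in> D" for w k
    by (induction k) (use that n in auto)
  have dep_n: "dep ((n ^^ k) w) = dep w + k" if "w \<in> D" for w k
    by (induction k) (use child_dep[OF n(2)[OF nk[OF that]]] in auto)
  have inj_nk: "v = w" if "v \<in> D" "w \<in> D" "(n ^^ k) v = (n ^^ k) w" for v w k
    using that(3)
  proof (induction k)
    case (Suc k)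
    have "par ((n ^^ Suc k) u) = (n ^^ k) u" if "u \<in> D" for u
      using n(2)[OF nk[OF that]] by (simp add: child_def)
    then show ?case using Suc that by metis
  qed simp
  have hit0: "\<exists>k. odd_at ((n ^^ k) w)" if "w \<in> D" for w
    using that
  proof (induction "h w" arbitrary: w rule: less_induct)
    case less
    show ?case
    proof (cases "odd_at w")
      case True
      then show ?thesis by (intro exI[of _ 0]) simp
    next
      case False
      obtain z where z: "z \<in> D" "z \<in> S w" "odd_at z" "dep z = dep w + h w" using hz less by blast
      with False have "z \<noteq> w" by auto
      with z obtain c where c: "child c w" "z \<in> S c" by (blast elim: S_down)
      have "c \<in> D" using Dup[OF z(1) c(2)] S_child[OF c(1)] less.prems DS S_trans by blast
      then have "h (n w) \<le> dep z - dep c"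
        using n_least[OF less.prems _ c(1)] h_le[OF z(1) c(2) z(3)] by auto
      then have "h (n w) < h w"
        using child_dep[OF c(1)] S_dep_less[OF z(2) \<open>z \<noteq> w\<close>] z(4) by linarith
      then obtain k where "odd_at ((n ^^ k) (n w))" using less n by blast
      then show ?thesis by (intro exI[of _ "Suc k"]) (simp add: funpow_swap1)
    qed
  qed
  define k where "k w = (LEAST j. 1 \<le> j \<and> odd_at ((n ^^ j) w))" for w
  have k: "1 \<le> k w" "odd_at ((n ^^ k w) w)" if w: "w \<in> D" for w
  proof -
    obtain j where "odd_at ((n ^^ j) (n w))" using hit0 n w by blast
    then have "1 \<le> Suc j \<and> odd_at ((n ^^ Suc j) w)" by (simp add: funpow_swap1)
    then have "1 \<le> k w \<and> odd_at ((n ^^ k w) w)" unfolding k_def by (rule LeastI)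
    then show "1 \<le> k w" "odd_at ((n ^^ k w) w)" by auto
  qed
  have k_le: "k w \<le> j" if "1 \<le> j" "odd_at ((n ^^ j) w)" for w j
    unfolding k_def using that by (intro Least_le) auto
  define X where "X = D \<inter> Collect odd_at"
  \<comment> \<open>If two segments between consecutive odd vertices overlapped, going back along
    \<open>par\<close> would place the odd vertex \<open>v\<close> strictly inside the segment from
    \<open>w\<close>, against the minimality of \<open>k w\<close>.\<close>
  have disj_aux: "v = w"
    if "v \<in> X" "w \<in> X" "i \<le> j" "1 \<le> i" "j \<le> k w" "(n ^^ i) v = (n ^^ j) w" for v w i j
  proof (rule ccontr)
    assume "v \<noteq> w"
    have "(n ^^ j) w = (n ^^ i) ((n ^^ (j - i)) w)"
      using that(3) by (metis comp_apply funpow_add le_add_diff_inverse)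
    then have v: "v = (n ^^ (j - i)) w"
      using inj_nk[of v "(n ^^ (j - i)) w" i] nk[of w "j - i"] that by (auto simp: X_def)
    then have "j \<noteq> i" using \<open>v \<noteq> w\<close> by auto
    then have "k w \<le> j - i" using that v by (intro k_le) (auto simp: X_def)
    then show False using that \<open>j \<noteq> i\<close> by linarith
  qed
  have disj: "v = w"
    if "v \<in> X" "w \<in> X" "1 \<le> i" "i \<le> k v" "1 \<le> j" "j \<le> k w" "(n ^^ i) v = (n ^^ j) w" for v w i j
    using disj_aux[of v w i j] disj_aux[of w v j i] that by (cases "i \<le> j") auto
  define f where "f w = (n ^^ k w) w" for w
  have fX: "f w \<in> X" if "w \<in> X" for w
    using that k[of w] nk by (auto simp: f_def X_def)
  have "inj_on f X"
  proof (rule inj_onI)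
    fix v w assume vw: "v \<in> X" "w \<in> X" "f v = f w"
    then have "1 \<le> k v" "1 \<le> k w" using k(1) by (auto simp: X_def)
    then show "v = w" using disj[OF vw(1,2), of "k v" "k w"] vw(3) by (simp add: f_def)
  qed
  moreover have "dep w < dep (f w)" if "w \<in> X" for w
    using that dep_n[of w "k w"] k[of w] by (auto simp: f_def X_def)
  \<comment> \<open>Every second odd vertex of a ray is joined to the next one. No odd vertex is
    left over at the end of a ray, since rays are infinite.\<close>
  ultimately obtain Y where Y: "Y \<subseteq> X" "X = Y \<union> f ` Y" "Y \<inter> f ` Y = {}"
    using halving[of X f dep] fX by blast
  define Z where "Z w = pe ` (\<lambda>i. (n ^^ i) w) ` {1..k w}" for w
  have conn_n: "conn (pe ` (\<lambda>i. (n ^^ i) w) ` {1..j}) w ((n ^^ j) w)" if "w \<in> D" for w j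
  proof (induction j)
    case (Suc j)
    have "child ((n ^^ Suc j) w) ((n ^^ j) w)" using n(2)[OF nk[OF that]] by simp
    then have "en (pe ((n ^^ Suc j) w)) = {(n ^^ j) w, (n ^^ Suc j) w}"
      using par by (auto simp: child_def)
    moreover have "conn (pe ` (\<lambda>i. (n ^^ i) w) ` {1..Suc j}) w ((n ^^ j) w)"
      by (rule conn_mono[OF Suc]) auto
    moreover have "pe ((n ^^ Suc j) w) \<in> pe ` (\<lambda>i. (n ^^ i) w) ` {1..Suc j}"
      by (rule imageI, rule image_eqI[of _ _ "Suc j"]) auto
    ultimately show ?case by (metis conn_step)
  qed simp
  have "joinable (\<Union>w\<in>Y. Z w) (\<Union>w\<in>Y. {w, f w})"
  proof (rule joinable_UN)
    fix w assume w: "w \<in> Y"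
    then have wX: "w \<in> X" "w \<in> D" using Y by (auto simp: X_def)
    have "w \<noteq> f w" using w Y by auto
    then show "joinable (Z w) {w, f w}"
      using conn_n[of w "k w"] wX by (intro joinable_pair) (auto simp: Z_def f_def)
    fix v assume v: "v \<in> Y" "w \<noteq> v"
    then have vX: "v \<in> X" "v \<in> D" using Y by (auto simp: X_def)
    have "w \<noteq> f v" "v \<noteq> f w" using w v Y by auto
    moreover have "f v \<noteq> f w" using \<open>inj_on f X\<close> v vX wX by (auto simp: inj_on_def)
    ultimately show "{w, f w} \<inter> {v, f v} = {}" using v by auto
    have sub: "(\<lambda>i. (n ^^ i) u) ` {1..k u} \<subseteq> V - {r}" if "u \<in> D" for u
    proof
      fix x assume "x \<in> (\<lambda>i. (n ^^ i) u) ` {1..k u}"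
      then obtain i where "x = (n ^^ Suc i) u" by (auto simp: Suc_le_eq gr0_conv_Suc)
      then show "x \<in> V - {r}" using n(2)[OF nk[OF that, of i]] by (simp add: child_def)
    qed
    show "Z w \<inter> Z v = {}"
      unfolding Z_def
    proof (rule pe_disjoint)
      show "(\<lambda>i. (n ^^ i) w) ` {1..k w} \<inter> (\<lambda>i. (n ^^ i) v) ` {1..k v} = {}"
        using disj[OF wX(1) vX(1)] v by auto
    qed (use sub wX vX in auto)
  qed
  moreover have "(\<Union>w\<in>Y. {w, f w}) = X" using Y by auto
  moreover have "(\<Union>w\<in>Y. Z w) \<subseteq> pe ` (D - {v0})"
  proof
    fix e assume "e \<in> (\<Union>w\<in>Y. Z w)"
    then obtain w i where w: "w \<in> Y" "1 \<le> i" "e = pe ((n ^^ i) w)" by (auto simp: Z_def)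
    then have "w \<in> D" using Y by (auto simp: X_def)
    moreover have "(n ^^ i) w \<noteq> v0"
      using dep_n[OF \<open>w \<in> D\<close>, of i] w S_dep[of w v0] DS \<open>w \<in> D\<close> by auto
    ultimately show "e \<in> pe ` (D - {v0})" using nk w by auto
  qed
  ultimately have "joinable (pe ` (D - {v0})) X" by (metis joinable_mono)
  then have "resolved v0"
    by (intro region_resolved[of v0 D X] disjI1) (use D0 DS Dpar Dchild in \<open>auto simp: X_def\<close>)
  then show False using v0 by simp
qed

end

section \<open>A join of all terminals but at most one\<close>

context wf_graph
begin

text \<open>With \<open>dep\<close> the distance from \<open>r\<close>, the last edge of a shortest
  walk leads to a vertex one level higher, which gives the tree. The claim is that its root is
  resolved.\<close>

lemma joinable_almost:
  assumes conn: "\<And>v. v \<in> V \<Longrightarrow> conn E r v" and r: "r \<in> V" and T: "T \<subseteq> V"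
  shows "joinable E T \<or> (\<exists>t\<in>T. joinable E (T - {t}))"
proof -
  let ?A = "{(a, b). \<exists>e\<in>E. en e = {a, b}}"
  define dep where "dep v = (LEAST k. (r, v) \<in> ?A ^^ k)" for v
  have dep: "(r, v) \<in> ?A ^^ dep v" if "v \<in> V" for v
  proof -
    have "\<exists>k. (r, v) \<in> ?A ^^ k" using conn[OF that] by (simp add: conn_def rtrancl_power)
    then show ?thesis unfolding dep_def by (rule LeastI_ex)
  qed
  have dep_le: "dep v \<le> k" if "(r, v) \<in> ?A ^^ k" for v k
    unfolding dep_def using that by (rule Least_le)
  have "\<exists>u e. u \<in> V \<and> e \<in> E \<and> en e = {v, u} \<and> dep v = Suc (dep u)" if v: "v \<in> V" "v \<noteq> r" for v
  proof -
    have "dep v \<noteq> 0" using dep[OF v(1)] v(2) by (metis IdE fst_conv pair_in_Id_conv relpow.simps(1))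
    then obtain k where k: "dep v = Suc k" by (cases "dep v") auto
    then obtain u where u: "(r, u) \<in> ?A ^^ k" "(u, v) \<in> ?A"
      using dep[OF v(1)] by auto
    then obtain e where e: "e \<in> E" "en e = {u, v}" by auto
    then have "u \<in> V" using wf by (auto simp: wf_multigraph_def)
    have "(r, v) \<in> ?A ^^ Suc (dep u)" using dep[OF \<open>u \<in> V\<close>] u(2) by auto
    then have "dep v \<le> Suc (dep u)" by (rule dep_le)
    moreover have "dep u \<le> k" using u(1) by (rule dep_le)
    ultimately have "dep v = Suc (dep u)" using k by simp
    then show ?thesis using e \<open>u \<in> V\<close> by (auto simp: insert_commute)
  qed
  then obtain par pe where parpe: "\<And>v. v \<in> V \<Longrightarrow> v \<noteq> r \<Longrightarrow>
      par v \<in> V \<and> pe v \<in> E \<and> en (pe v) = {v, par v} \<and> dep v = Suc (dep (par v))"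
    by metis
  then interpret spanning_tree G r par pe dep T
    by unfold_locales (rule parpe)
  have up: "v \<in> S r" if "v \<in> V" for v
    using that
  proof (induction "dep v" arbitrary: v rule: less_induct)
    case less
    show ?case
    proof (cases "v = r")
      case False
      then have "child v (par v)" "par v \<in> V" "dep (par v) < dep v"
        using par[of v] less.prems by (auto simp: child_def)
      then show ?thesis using less.hyps[of "par v"] S_child S_trans by blast
    qed simp
  qed
  have ES: "ES r \<subseteq> E" using par S_proper by (auto simp: ES_def)
  have TS: "T \<inter> S r = T" using up T by auto
  have "resolved r" by (rule all_resolved)
  then show ?thesis
    unfolding resolved_def settled_def sends_def TS using ES joinable_mono
    by (meson Diff_subset subset_trans)
qed

subsection \<open>Two edge-disjoint connections\<close>

text \<open>Just before its first use of \<open>e\<close>, a walk from \<open>x\<close> stands at an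
  end of \<open>e\<close>.\<close>

lemma conn_remove:
  assumes "conn F x s" "en e = {a, b}"
  shows "conn (F - {e}) x s \<or> conn (F - {e}) x a \<or> conn (F - {e}) x b"
  using assms(1)
proof (induction rule: conn_induct)
  case refl
  then show ?case by simp
next
  case (step u v h)
  show ?case
  proof (cases "h = e")
    case True
    then have "u = a \<or> u = b" using step.hyps(3) assms(2) by (auto simp: doubleton_eq_iff)
    then show ?thesis using step.IH by auto
  next
    case False
    then have "h \<in> F - {e}" using step.hyps by simp
    then show ?thesis using step.IH conn_step[OF _ _ step.hyps(3)] by blast
  qed
qed

text \<open>Menger's theorem for two edge-disjoint paths from \<open>S\<close>, one to \<open>x\<close> and one to \<open>K\<close>. The
  induction moves the end \<open>b\<close> of an edge \<open>e\<close> leaving \<open>S\<close> into \<open>S\<close>; if both paths then start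
  at \<open>b\<close>, a connection from \<open>S\<close> to one of them avoiding \<open>e\<close> replaces its beginning.\<close>

lemma two_disjoint_conns:
  assumes "finite F" "F \<subseteq> H" "conn F x s" "s \<in> S"
    and "\<And>R. S \<subseteq> R \<Longrightarrow> R \<inter> K = {} \<Longrightarrow> cut H R \<noteq> {} \<and> (x \<notin> R \<longrightarrow> (\<forall>e. cut H R \<noteq> {e}))"
  shows "\<exists>A B a b y. A \<subseteq> H \<and> B \<subseteq> H \<and> A \<inter> B = {} \<and> a \<in> S \<and> b \<in> S \<and> y \<in> K \<and> conn A x a \<and> conn B b y"
  using assms
proof (induction "card F" arbitrary: F H S s rule: less_induct)
  case less
  note cutH = less.prems(5)
  have ex: "\<exists>A B a b y. A \<subseteq> H \<and> B \<subseteq> H \<and> A \<inter> B = {} \<and> a \<in> S \<and> b \<in> S \<and> y \<in> K \<and> conn A x a \<and> conn B b y"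
    if "A \<subseteq> H" "B \<subseteq> H" "A \<inter> B = {}" "a \<in> S" "b \<in> S" "y \<in> K" "conn A x a" "conn B b y" for A B a b y
    using that by (intro exI conjI)
  show ?case
  proof (cases "x \<in> S")
    case True
    \<comment> \<open>The set reachable from \<open>S\<close> has no boundary, so it must meet
      \<open>K\<close>; the route to \<open>x\<close> is trivial here.\<close>
    let ?R = "{v. \<exists>s\<in>S. conn H s v}"
    have "cut H ?R = {}"
    proof (rule ccontr)
      assume "cut H ?R \<noteq> {}"
      then obtain h where "h \<in> cut H ?R" by blast
      then obtain u v where "h \<in> H" "u \<in> ?R" "v \<notin> ?R" "en h = {u, v}" by (rule cutE)
      then show False using conn_step[of H _ u h v] by blast
    qed
    moreover have "S \<subseteq> ?R" using conn_refl by blast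
    ultimately obtain b y where "b \<in> S" "y \<in> K" "conn H b y" using cutH[of ?R] by blast
    then show ?thesis using True
      by (intro ex[of "{}" H x b y]) auto
  next
    case False
    have sx: "conn F s x" using less.prems(3) by (rule conn_sym)
    obtain e a b where e: "e \<in> F" "a \<in> S" "b \<notin> S" "en e = {a, b}"
      by (rule conn_cutE[OF sx less.prems(4) False])
    have eH: "e \<in> H" using e less.prems by auto
    have ab: "conn {e} a b" using conn_edge[of e "{e}"] e by auto
    \<comment> \<open>Without \<open>e\<close>, the vertex \<open>x\<close> still reaches
      \<open>S\<close> or the new vertex \<open>b\<close>, so the smaller set \<open>F - {e}\<close>
      serves for the induction.\<close>
    obtain s' where s': "s' \<in> insert b S" "conn (F - {e}) x s'"
      using conn_remove[OF less.prems(3) e(4)] e less.prems(4) by blast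
    have "\<exists>A B a' b' y. A \<subseteq> H - {e} \<and> B \<subseteq> H - {e} \<and> A \<inter> B = {} \<and> a' \<in> insert b S \<and>
        b' \<in> insert b S \<and> y \<in> K \<and> conn A x a' \<and> conn B b' y"
    proof (rule less.hyps[of "F - {e}"])
      show "card (F - {e}) < card F" using e less.prems(1) by (intro card_Diff1_less)
      fix R assume R: "insert b S \<subseteq> R" "R \<inter> K = {}"
      then have "e \<notin> cut H R" using e by (auto simp: cut_def doubleton_eq_iff)
      then have "cut (H - {e}) R = cut H R" by (auto simp: cut_def)
      then show "cut (H - {e}) R \<noteq> {} \<and> (x \<notin> R \<longrightarrow> (\<forall>h. cut (H - {e}) R \<noteq> {h}))"
        using cutH[of R] R by simp
    qed (use less.prems s' in auto)
    then obtain A B a' b' y where IH: "A \<subseteq> H - {e}" "B \<subseteq> H - {e}" "A \<inter> B = {}"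
        "a' \<in> insert b S" "b' \<in> insert b S" "y \<in> K" "conn A x a'" "conn B b' y"
      by blast
    show ?thesis
    proof (cases "a' = b \<and> b' = b")
      case False
      show ?thesis
      proof (cases "a' = b")
        case True
        then have "conn (A \<union> {e}) x a" using conn_join[OF IH(7), of "{e}" a] conn_sym[OF ab] by blast
        then show ?thesis using IH True False e eH
          by (intro ex[of "A \<union> {e}" B a b' y]) auto
      next
        case a: False
        show ?thesis
        proof (cases "b' = b")
          case True
          then have "conn ({e} \<union> B) a y" using conn_join[OF ab, of B y] IH(8) by blast
          then show ?thesis using IH True a e eH
            by (intro ex[of A "{e} \<union> B" a' a y]) auto
        qed (use IH a in blast)
      qed
    next
      case True
      \<comment> \<open>Both routes start at \<open>b\<close>, but only one of them can be prolonged
        by \<open>e\<close>. Trimming them to what is reachable from \<open>x\<close> and from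
        \<open>b\<close> leaves the most edges for a second connection.\<close>
      define A' where "A' = {h \<in> A. \<forall>v\<in>en h. conn A x v}"
      define B' where "B' = {h \<in> B. \<forall>v\<in>en h. conn B b v}"
      have A': "conn A' x v" if "conn A x v" for v
        using conn_component[OF that] by (simp add: A'_def)
      have B': "conn B' b v" if "conn B b v" for v
        using conn_component[OF that] by (simp add: B'_def)
      have sub: "A' \<subseteq> H - {e}" "B' \<subseteq> H - {e}" "A' \<inter> B' = {}"
        using IH by (auto simp: A'_def B'_def)
      let ?D = "H - {e} - A' - B'"
      let ?R = "{v. \<exists>s\<in>S. conn ?D s v}"
      have eA: "conn (A' \<union> {e}) x a" and eB: "conn ({e} \<union> B') a y"
        using conn_join[OF A' conn_sym[OF ab]] conn_join[OF ab B'] IH(7,8) True by blast+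
      have SR: "S \<subseteq> ?R" using conn_refl by blast
      \<comment> \<open>The set reachable from \<open>S\<close> by the remaining edges may meet
        \<open>K\<close>, which gives a new route to \<open>K\<close> while \<open>e\<close>
        prolongs the one to \<open>x\<close>. If it meets one of the two routes, that route is
        entered there and the other one takes \<open>e\<close>.\<close>
      consider (K) "?R \<inter> K \<noteq> {}" | (A) z where "z \<in> ?R" "conn A x z"
        | (B) z where "z \<in> ?R" "conn B b z"
        | (none) "?R \<inter> K = {}" "\<And>z. z \<in> ?R \<Longrightarrow> \<not> conn A x z" "\<And>z. z \<in> ?R \<Longrightarrow> \<not> conn B b z"
        by blast
      then show ?thesis
      proof cases
        case K
        then obtain s z where "s \<in> S" "z \<in> K" "conn ?D s z" by blast
        then show ?thesis using eA sub e eH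
          by (intro ex[of "A' \<union> {e}" ?D a s z]) auto
      next
        case (A z)
        then obtain s where s: "s \<in> S" "conn ?D s z" by blast
        have "conn (A' \<union> ?D) x s" by (rule conn_join[OF A'[OF A(2)] conn_sym[OF s(2)]])
        then show ?thesis using eB sub e eH s IH(6)
          by (intro ex[of "A' \<union> ?D" "{e} \<union> B'" s a y]) auto
      next
        case (B z)
        then obtain s where s: "s \<in> S" "conn ?D s z" by blast
        have "conn B' z y"
          using conn_trans[OF conn_sym[OF B'[OF B(2)]] B'] IH(8) True by blast
        then have "conn (?D \<union> B') s y" by (rule conn_join[OF s(2)])
        then show ?thesis using eA sub e eH s IH(6)
          by (intro ex[of "A' \<union> {e}" "?D \<union> B'" a s y]) auto
      next
        \<comment> \<open>No trimmed route touches the reachable set, so \<open>e\<close> is the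
          only edge that can leave it, contrary to the hypothesis on cuts.\<close>
        case none
        have "h = e" if h: "h \<in> cut H ?R" for h
        proof (rule ccontr)
          assume "h \<noteq> e"
          obtain u v where u: "h \<in> H" "u \<in> ?R" "v \<notin> ?R" "en h = {u, v}" by (rule cutE[OF h])
          have "\<not> conn A x u" "\<not> conn B b u" using none(2,3)[OF u(2)] by auto
          then have "h \<notin> A'" "h \<notin> B'" using u(4) by (auto simp: A'_def B'_def)
          then have "h \<in> ?D" using u \<open>h \<noteq> e\<close> by auto
          then show False using u conn_step[of ?D _ u h v] by blast
        qed
        moreover have "x \<notin> ?R" using none(2)[of x] by auto
        ultimately show ?thesis using cutH[OF SR none(1)] by blast
      qed
    qed
  qed
qed

subsection \<open>Breaking up paths along a trail\<close>

text \<open>A step \<open>Inl e\<close> traverses the edge \<open>e\<close>. A step \<open>Inr p\<close> jumps between two vertices of the path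
  \<open>p\<close>, at which \<open>p\<close> will be broken up. Hence no label may occur twice.\<close>

definition link :: "'e + ('a, 'e) gpath \<Rightarrow> 'a \<Rightarrow> 'a \<Rightarrow> bool" where
  "link l x z \<longleftrightarrow> (case l of Inl e \<Rightarrow> en e = {x, z} | Inr p \<Rightarrow> {x, z} \<subseteq> set (fst p))"

primrec walk :: "'a \<Rightarrow> ('e + ('a, 'e) gpath) list \<Rightarrow> 'a \<Rightarrow> bool" where
  "walk x [] y \<longleftrightarrow> x = y"
| "walk x (l # ls) y \<longleftrightarrow> (\<exists>z. link l x z \<and> walk z ls y)"

lemma walk_append: "walk x (k @ l) y \<longleftrightarrow> (\<exists>z. walk x k z \<and> walk z l y)"
  by (induction k arbitrary: x) auto

text \<open>Any two vertices of \<open>p\<close> are linked by one jump, so everything between two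
  jumps along \<open>p\<close> can be skipped.\<close>

lemma walk_shorten_jump:
  assumes "walk x (a @ [Inr p] @ b @ [Inr p] @ c) y"
  shows "walk x (a @ [Inr p] @ c) y"
  using assms by (auto simp: walk_append link_def)

text \<open>If both traversals have the same direction, one of them and the part between are
  skipped. If they are opposite, the walk stands before the first where it continues after the
  second, and both are dropped.\<close>

lemma walk_shorten_edge:
  assumes "walk x (a @ [Inl e] @ b @ [Inl e] @ c) y"
  shows "walk x (a @ [Inl e] @ c) y \<or> walk x (a @ c) y"
  using assms by (fastforce simp: walk_append link_def doubleton_eq_iff)

lemma conn_walk:
  assumes "conn Z x y"
  obtains es where "walk x (map Inl es) y" "distinct es" "set es \<subseteq> Z"
proof -
  have "\<exists>es. walk x (map Inl es) y \<and> set es \<subseteq> Z"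
    using assms
  proof (induction rule: conn_induct)
    case refl
    show ?case by (intro exI[of _ "[]"]) auto
  next
    case (step a b e)
    then obtain es where "walk x (map Inl es) a" "set es \<subseteq> Z" by blast
    then show ?case using step.hyps
      by (intro exI[of _ "es @ [e]"]) (auto simp: walk_append link_def)
  qed
  then obtain es where es: "walk x (map Inl es) y" "set es \<subseteq> Z" by blast
  have "\<exists>es'. walk x (map Inl es') y \<and> distinct es' \<and> set es' \<subseteq> set es"
    using es(1)
  proof (induction "length es" arbitrary: es rule: less_induct)
    case less
    show ?case
    proof (cases "distinct es")
      case False
      then obtain a b c e where d: "es = a @ [e] @ b @ [e] @ c"
        using not_distinct_decomp by blast
      then have "walk x (map Inl (a @ [e] @ c)) y \<or> walk x (map Inl (a @ c)) y"
        using walk_shorten_edge[of x "map Inl a" e "map Inl b" "map Inl c" y] less.prems by auto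
      then obtain es' where es': "walk x (map Inl es') y" "es' = a @ [e] @ c \<or> es' = a @ c"
        by blast
      then have "length es' < length es" "set es' \<subseteq> set es" using d by auto
      then show ?thesis using less.hyps[of es'] es' by (meson subset_trans)
    qed (use less.prems in auto)
  qed
  then show ?thesis using that es(2) by (meson subset_trans)
qed

text \<open>A trail from \<open>x\<close> to \<open>y\<close> is broken up: \<open>x\<close> is joined to \<open>t0\<close>, and \<open>t1\<close> is the terminal that
  remains to be joined from \<open>y\<close>.\<close>

definition absorbs :: "'e set \<Rightarrow> 'a set \<Rightarrow> 'a \<Rightarrow> 'a \<Rightarrow> bool" where
  "absorbs D W x y \<longleftrightarrow> (\<exists>t0\<in>W. \<exists>t1\<in>W. \<exists>Za Zb Zc. t0 \<noteq> t1 \<and> Za \<union> Zb \<union> Zc \<subseteq> D \<and>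
     Za \<inter> Zb = {} \<and> Za \<inter> Zc = {} \<and> Zb \<inter> Zc = {} \<and> conn Za x t0 \<and> conn Zb t1 y \<and>
     joinable Zc (W - {t0, t1}))"

lemma absorbsI:
  assumes "t0 \<in> W" "t1 \<in> W" "t0 \<noteq> t1" "Za \<subseteq> D" "Zb \<subseteq> D" "Zc \<subseteq> D" "Za \<inter> Zb = {}"
    "Za \<inter> Zc = {}" "Zb \<inter> Zc = {}" "conn Za x t0" "conn Zb t1 y" "joinable Zc (W - {t0, t1})"
  shows "absorbs D W x y"
  unfolding absorbs_def using assms
  by (intro bexI[of _ t0] bexI[of _ t1] exI[of _ Za] exI[of _ Zb] exI[of _ Zc] conjI) simp_all

definition ledges :: "'e + ('a, 'e) gpath \<Rightarrow> 'e set" where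
  "ledges l = (case l of Inl e \<Rightarrow> {e} | Inr p \<Rightarrow> path_edges p)"

definition lends :: "'e + ('a, 'e) gpath \<Rightarrow> 'a set" where
  "lends l = (case l of Inl e \<Rightarrow> {} | Inr p \<Rightarrow> endvertices p)"

text \<open>A jump along \<open>p\<close> from \<open>x\<close> to \<open>z\<close> joins
  \<open>x\<close> to \<open>t1\<close> and leaves \<open>t2\<close> connected to \<open>z\<close>.
  If the rest of the trail has jumps, its first loose terminal meets \<open>t2\<close> at
  \<open>z\<close> and is paired with it. The alternative without jumps is carried along because a
  tail of the trail may contain none.\<close>

lemma walk_absorbs:
  assumes "walk x ls y" "distinct ls"
    and "\<And>p. Inr p \<in> set ls \<Longrightarrow> is_path G p \<and> card (endvertices p) = 2"
    and "\<And>k l. k \<in> set ls \<Longrightarrow> l \<in> set ls \<Longrightarrow> k \<noteq> l \<Longrightarrow> ledges k \<inter> ledges l = {} \<and> lends k \<inter> lends l = {}"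
  shows "(if \<exists>p. Inr p \<in> set ls then absorbs (\<Union>(ledges ` set ls)) (\<Union>(lends ` set ls)) x y
     else conn (\<Union>(ledges ` set ls)) x y)"
  using assms
proof (induction ls arbitrary: x)
  case Nil
  then show ?case by simp
next
  case (Cons l ls)
  define D W where "D = \<Union>(ledges ` set ls)" and "W = \<Union>(lends ` set ls)"
  note DW = this
  obtain z where z: "link l x z" "walk z ls y" using Cons.prems(1) by auto
  have IH: "if \<exists>p. Inr p \<in> set ls then absorbs D W z y else conn D z y"
    unfolding DW by (rule Cons.IH) (use z Cons.prems in auto)
  have new: "ledges l \<inter> D = {}" "lends l \<inter> W = {}"
    using Cons.prems(2) Cons.prems(4)[of l] unfolding DW by auto
  show ?case
  proof (cases l)
    case (Inl e)
    have e: "conn {e} x z" using z(1) Inl by (intro conn_edge[of e]) (auto simp: link_def)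
    have le: "ledges l = {e}" "lends l = {}" using Inl by (auto simp: ledges_def lends_def)
    show ?thesis
    proof (cases "\<exists>p. Inr p \<in> set ls")
      case True
      then have "absorbs D W z y" using IH by simp
      then obtain t0 t1 Za Zb Zc where a: "t0 \<in> W" "t1 \<in> W" "t0 \<noteq> t1" "Za \<union> Zb \<union> Zc \<subseteq> D"
        "Za \<inter> Zb = {}" "Za \<inter> Zc = {}" "Zb \<inter> Zc = {}" "conn Za z t0" "conn Zb t1 y"
        "joinable Zc (W - {t0, t1})"
        unfolding absorbs_def by blast
      have "absorbs ({e} \<union> D) W x y"
        by (rule absorbsI[of t0 _ t1 "{e} \<union> Za" _ Zb Zc])
          (use a conn_join[OF e a(8)] new(1) le in auto)
      then show ?thesis using True le by (auto simp: DW)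
    next
      case False
      then have "conn ({e} \<union> D) x y" using IH conn_join[OF e] by auto
      then show ?thesis using False le Inl by (auto simp: DW)
    qed
  next
    case (Inr p)
    have le: "ledges l = path_edges p" "lends l = endvertices p"
      using Inr by (auto simp: ledges_def lends_def)
    have p: "is_path G p" "x \<in> set (fst p)" "z \<in> set (fst p)" "card (endvertices p) = 2"
      using Cons.prems(3)[of p] Inr z(1) by (auto simp: link_def)
    obtain Z1 Z2 t1 t2 where s: "endvertices p = {t1, t2}" "t1 \<noteq> t2"
      "Z1 \<subseteq> path_edges p" "Z2 \<subseteq> path_edges p" "Z1 \<inter> Z2 = {}" "conn Z1 x t1" "conn Z2 z t2"
      by (rule path_split[OF p])
    have "absorbs (path_edges p \<union> D) (endvertices p \<union> W) x y"
    proof (cases "\<exists>p. Inr p \<in> set ls")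
      case True
      then have "absorbs D W z y" using IH by simp
      then obtain u0 u1 Za Zb Zc where a: "u0 \<in> W" "u1 \<in> W" "u0 \<noteq> u1" "Za \<union> Zb \<union> Zc \<subseteq> D"
        "Za \<inter> Zb = {}" "Za \<inter> Zc = {}" "Zb \<inter> Zc = {}" "conn Za z u0" "conn Zb u1 y"
        "joinable Zc (W - {u0, u1})"
        unfolding absorbs_def by blast
      have ne: "t2 \<noteq> u0" "t1 \<noteq> u1" "t2 \<notin> W" "t1 \<notin> W" using new(2) le s(1) a(1,2) by auto
      have "joinable (Z2 \<union> Za) {t2, u0}"
        by (rule joinable_pair[OF conn_join[OF conn_sym[OF s(7)] a(8)] ne(1)])
      then have "joinable ((Z2 \<union> Za) \<union> Zc) ({t2, u0} \<union> (W - {u0, u1}))"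
        by (rule joinable_Un[OF _ a(10)]) (use a s new le ne in auto)
      moreover have "{t2, u0} \<union> (W - {u0, u1}) = (endvertices p \<union> W) - {t1, u1}"
        unfolding s(1) using s(2) a(1-3) ne by blast
      ultimately have j: "joinable ((Z2 \<union> Za) \<union> Zc) ((endvertices p \<union> W) - {t1, u1})" by simp
      have pD: "path_edges p \<inter> D = {}" using new(1) le(1) by simp
      show ?thesis
      proof (rule absorbsI[OF _ _ ne(2) _ _ _ _ _ _ s(6) a(9) j])
        show "t1 \<in> endvertices p \<union> W" "u1 \<in> endvertices p \<union> W" using s(1) a(2) by simp_all
        show "Z1 \<subseteq> path_edges p \<union> D" "Zb \<subseteq> path_edges p \<union> D"
          "(Z2 \<union> Za) \<union> Zc \<subseteq> path_edges p \<union> D"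
          using s(3,4) a(4) by blast+
        show "Z1 \<inter> Zb = {}" using s(3) a(4) pD by blast
        show "Z1 \<inter> ((Z2 \<union> Za) \<union> Zc) = {}" using s(3,5) a(4) pD by blast
        show "Zb \<inter> ((Z2 \<union> Za) \<union> Zc) = {}" using s(4) a(4,5,7) pD by blast
      qed
    next
      case False
      have c: "conn D z y" by (rule iffD1[OF if_not_P[OF False] IH])
      have nj: "Inr q \<notin> set ls" for q using False by blast
      have "lends k = {}" if k: "k \<in> set ls" for k
      proof (cases k)
        case (Inr q)
        then show ?thesis using nj[of q] k by simp
      qed (simp add: lends_def)
      then have W: "W = {}" by (simp add: DW)
      have pD: "path_edges p \<inter> D = {}" using new(1) le(1) by simp
      show ?thesis
      proof (rule absorbsI[OF _ _ s(2) _ _ _ _ _ _ s(6) conn_join[OF conn_sym[OF s(7)] c], of _ _ "{}"])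
        show "Z1 \<inter> (Z2 \<union> D) = {}" using s(3,5) pD by blast
        show "joinable {} (endvertices p \<union> W - {t1, t2})" unfolding W s(1) by simp
      qed (use s(1,3,4) in auto)
    qed
    then have "absorbs (\<Union>(ledges ` set (l # ls))) (\<Union>(lends ` set (l # ls))) x y"
      using le by (simp add: DW)
    moreover have "Inr p \<in> set (l # ls)" using Inr by simp
    ultimately show ?thesis by (simp only: if_P[OF exI])
  qed
qed

lemma T_joinD:
  assumes "T_join G T P"
  shows "\<And>p. p \<in> P \<Longrightarrow> is_path G p" "\<And>p. p \<in> P \<Longrightarrow> card (endvertices p) = 2"
    "\<And>p q. p \<in> P \<Longrightarrow> q \<in> P \<Longrightarrow> p \<noteq> q \<Longrightarrow> path_edges p \<inter> path_edges q = {}"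
    "\<And>p q. p \<in> P \<Longrightarrow> q \<in> P \<Longrightarrow> p \<noteq> q \<Longrightarrow> endvertices p \<inter> endvertices q = {}"
    "(\<Union>p\<in>P. endvertices p) = T"
proof -
  have P: "\<And>p. p \<in> P \<Longrightarrow> is_path G p \<and> endvertices p \<subseteq> T \<and> card (endvertices p) = 2"
    and disj: "\<And>p q. p \<in> P \<Longrightarrow> q \<in> P \<Longrightarrow> p \<noteq> q \<Longrightarrow> path_edges p \<inter> path_edges q = {}"
    and ex1: "\<And>v. v \<in> T \<Longrightarrow> \<exists>!p. p \<in> P \<and> v \<in> endvertices p"
    using assms unfolding T_join_def by auto
  show "is_path G p" "card (endvertices p) = 2" if "p \<in> P" for p using P[OF that] by auto
  show "path_edges p \<inter> path_edges q = {}" if "p \<in> P" "q \<in> P" "p \<noteq> q" for p q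
    by (rule disj[OF that])
  show "endvertices p \<inter> endvertices q = {}" if pq: "p \<in> P" "q \<in> P" "p \<noteq> q" for p q
  proof (rule ccontr)
    assume "\<not> ?thesis"
    then obtain v where v: "v \<in> endvertices p" "v \<in> endvertices q" by auto
    then have "v \<in> T" using P[OF pq(1)] by auto
    then show False using ex1[of v] v pq by auto
  qed
  show "(\<Union>p\<in>P. endvertices p) = T"
  proof (intro equalityI subsetI)
    fix v assume "v \<in> T"
    then obtain p where "p \<in> P" "v \<in> endvertices p" using ex1[of v] by auto
    then show "v \<in> (\<Union>p\<in>P. endvertices p)" by auto
  qed (use P in auto)
qed

text \<open>Edges occur only once, so only jumps can repeat. Shortening at a repeated jump retains
  one copy of it, hence some jump always survives.\<close>

lemma walk_distinct_jumps:
  assumes "walk x ls y" "distinct (filter isl ls)" "\<exists>p. Inr p \<in> set ls"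
  shows "\<exists>ls'. walk x ls' y \<and> distinct ls' \<and> set ls' \<subseteq> set ls \<and> (\<exists>q. Inr q \<in> set ls')"
  using assms
proof (induction "length ls" arbitrary: ls rule: less_induct)
  case less
  show ?case
  proof (cases "distinct ls")
    case False
    then obtain a b c l where d: "ls = a @ [l] @ b @ [l] @ c"
      using not_distinct_decomp by blast
    have "\<not> isl l" using less.prems(2) d by auto
    then obtain q where q: "l = Inr q" by (cases l) auto
    let ?ls = "a @ [l] @ c"
    have "walk x ?ls y" using walk_shorten_jump[of x a q b c y] less.prems(1) d q by auto
    moreover have "length ?ls < length ls" "set ?ls \<subseteq> set ls" using d by auto
    moreover have "distinct (filter isl ?ls)" using less.prems(2) d by auto
    moreover have "Inr q \<in> set ?ls" using q by simp
    ultimately have "\<exists>ls'. walk x ls' y \<and> distinct ls' \<and> set ls' \<subseteq> set ?ls \<and> (\<exists>q. Inr q \<in> set ls')"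
      using less.hyps[of ?ls] by blast
    then show ?thesis using \<open>set ?ls \<subseteq> set ls\<close> by (meson subset_trans)
  qed (use less.prems in auto)
qed

text \<open>The trail follows \<open>A\<close> to \<open>p\<close>, jumps along \<open>p\<close>,
  and follows \<open>B\<close> to \<open>y\<close>. The jump ensures that at least one path is
  broken up even if \<open>A\<close> and \<open>B\<close> avoid the join. \<open>F\<close> holds the
  edges used that lie on no path of the join.\<close>

lemma absorb_route:
  assumes P: "T_join G T P" and A: "conn A x s" and B: "conn B s' y" and AB: "A \<inter> B = {}"
    and p: "p \<in> P" "s \<in> set (fst p)" "s' \<in> set (fst p)"
  shows "\<exists>Q F. finite Q \<and> Q \<subseteq> insert p {q \<in> P. path_edges q \<inter> (A \<union> B) \<noteq> {}} \<and> finite F \<and>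
    F \<subseteq> A \<union> B \<and> (\<forall>q\<in>P. path_edges q \<inter> F = {}) \<and>
    absorbs (F \<union> (\<Union>q\<in>Q. path_edges q)) (\<Union>q\<in>Q. endvertices q) x y"
proof -
  obtain as where as: "walk x (map Inl as) s" "distinct as" "set as \<subseteq> A" by (rule conn_walk[OF A])
  obtain bs where bs: "walk s' (map Inl bs) y" "distinct bs" "set bs \<subseteq> B" by (rule conn_walk[OF B])
  \<comment> \<open>Using an edge of a path of the join destroys that path, so its traversal is read
    as a jump along the path.\<close>
  define lab where "lab e = (if \<exists>q\<in>P. e \<in> path_edges q
    then Inr (SOME q. q \<in> P \<and> e \<in> path_edges q) else Inl e)" for e
  have lab: "(lab e = Inl e \<and> (\<forall>q\<in>P. e \<notin> path_edges q)) \<or>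
      (\<exists>q\<in>P. e \<in> path_edges q \<and> lab e = Inr q)" for e
  proof (cases "\<exists>q\<in>P. e \<in> path_edges q")
    case True
    then have "\<exists>q. q \<in> P \<and> e \<in> path_edges q" by blast
    then have "(SOME q. q \<in> P \<and> e \<in> path_edges q) \<in> P \<and> e \<in> path_edges (SOME q. q \<in> P \<and> e \<in> path_edges q)"
      by (rule someI_ex)
    then show ?thesis using True unfolding lab_def by auto
  qed (auto simp: lab_def)
  have link_lab: "link (lab e) u v" if "link (Inl e) u v" for e u v
  proof -
    have "en e = {u, v}" using that by (simp add: link_def)
    then show ?thesis using lab[of e] path_edge_verts(1) T_joinD(1)[OF P] that
      by (auto simp: link_def) blast+
  qed
  have walk_lab: "walk u (map lab es) v" if "walk u (map Inl es) v" for u v es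
    using that by (induction es arbitrary: u) (use link_lab in fastforce)+
  have filt: "filter isl (map lab es) = map Inl (filter (\<lambda>e. isl (lab e)) es)" for es
  proof (induction es)
    case (Cons e es)
    then show ?case using lab[of e] by auto
  qed simp
  let ?ls = "map lab as @ [Inr p] @ map lab bs"
  have "link (Inr p) s s'" using p by (simp add: link_def)
  then have w: "walk x ?ls y"
    using walk_lab[OF as(1)] walk_lab[OF bs(1)] by (auto simp: walk_append)
  \<comment> \<open>The disjointness of \<open>A\<close> and \<open>B\<close> makes the edge labels
    distinct; repeated jumps are removed afterwards.\<close>
  have d: "distinct (filter isl ?ls)"
    using as bs AB by (auto simp: filt distinct_map inj_on_def)
  have "Inr p \<in> set ?ls" by simp
  then have "\<exists>ls. walk x ls y \<and> distinct ls \<and> set ls \<subseteq> set ?ls \<and> (\<exists>q. Inr q \<in> set ls)"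
    using walk_distinct_jumps[OF w d] by blast
  then obtain ls q0 where ls: "walk x ls y" "distinct ls" "set ls \<subseteq> set ?ls" "Inr q0 \<in> set ls"
    by blast
  define Q where "Q = {q. Inr q \<in> set ls}"
  define F where "F = {e. Inl e \<in> set ls}"
  have in_ls: "l = Inr p \<or> (\<exists>e\<in>A \<union> B. l = lab e)" if "l \<in> set ls" for l
    using ls(3) that as(3) bs(3) by auto
  have Q: "q = p \<or> (q \<in> P \<and> path_edges q \<inter> (A \<union> B) \<noteq> {})" if "q \<in> Q" for q
  proof -
    have "Inr q = Inr p \<or> (\<exists>e\<in>A \<union> B. Inr q = lab e)"
      using in_ls[of "Inr q"] that unfolding Q_def by blast
    then show ?thesis
    proof
      assume "\<exists>e\<in>A \<union> B. Inr q = lab e"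
      then obtain e where e: "e \<in> A \<union> B" "Inr q = lab e" by blast
      then show ?thesis using lab[of e] by auto
    qed simp
  qed
  have F: "e \<in> A \<union> B" "\<forall>q\<in>P. e \<notin> path_edges q" if e: "e \<in> F" for e
  proof -
    obtain h where h: "h \<in> A \<union> B" "Inl e = lab h"
      using in_ls[of "Inl e"] e unfolding F_def by blast
    then show "e \<in> A \<union> B" "\<forall>q\<in>P. e \<notin> path_edges q" using lab[of h] by auto
  qed
  have QP: "q \<in> P" if "q \<in> Q" for q using Q[OF that] p by auto
  have fin: "finite Q" "finite F"
  proof -
    have "Inr ` Q \<subseteq> set ls" "Inl ` F \<subseteq> set ls" by (auto simp: Q_def F_def)
    then show "finite Q" "finite F" by (meson finite_imageD finite_set finite_subset inj_Inl inj_Inr)+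
  qed
  have lsE: "(\<exists>e\<in>F. l = Inl e) \<or> (\<exists>q\<in>Q. l = Inr q)" if l: "l \<in> set ls" for l
  proof (cases l)
    case (Inl e)
    then show ?thesis using l by (simp add: F_def)
  next
    case (Inr q)
    then show ?thesis using l by (simp add: Q_def)
  qed
  have abs: "if \<exists>p. Inr p \<in> set ls then absorbs (\<Union>(ledges ` set ls)) (\<Union>(lends ` set ls)) x y
     else conn (\<Union>(ledges ` set ls)) x y"
  proof (rule walk_absorbs[OF ls(1,2)])
    fix q assume "Inr q \<in> set ls"
    then show "is_path G q \<and> card (endvertices q) = 2" using QP T_joinD(1,2)[OF P] by (simp add: Q_def)
  next
    fix k l assume kl: "k \<in> set ls" "l \<in> set ls" "k \<noteq> l"
    show "ledges k \<inter> ledges l = {} \<and> lends k \<inter> lends l = {}"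
      using lsE[OF kl(1)] lsE[OF kl(2)]
    proof (elim disjE bexE)
      fix q q' assume q: "q \<in> Q" "k = Inr q" "q' \<in> Q" "l = Inr q'"
      then have "q \<noteq> q'" "q \<in> P" "q' \<in> P" using kl QP by auto
      then show ?thesis using q T_joinD(3,4)[OF P] by (simp add: ledges_def lends_def)
    qed (use kl F QP in \<open>auto simp: ledges_def lends_def\<close>)
  qed
  have "\<Union>(ledges ` set ls) = F \<union> (\<Union>q\<in>Q. path_edges q)"
  proof (intro equalityI subsetI)
    fix e assume "e \<in> \<Union>(ledges ` set ls)"
    then obtain l where l: "l \<in> set ls" "e \<in> ledges l" by blast
    then show "e \<in> F \<union> (\<Union>q\<in>Q. path_edges q)" using lsE[OF l(1)] by (auto simp: ledges_def)
  next
    fix e assume "e \<in> F \<union> (\<Union>q\<in>Q. path_edges q)"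
    then consider "Inl e \<in> set ls" | q where "Inr q \<in> set ls" "e \<in> path_edges q"
      by (auto simp: F_def Q_def)
    then show "e \<in> \<Union>(ledges ` set ls)" by cases (auto simp: ledges_def intro!: bexI)
  qed
  moreover have "\<Union>(lends ` set ls) = (\<Union>q\<in>Q. endvertices q)"
  proof (intro equalityI subsetI)
    fix t assume "t \<in> \<Union>(lends ` set ls)"
    then obtain l where l: "l \<in> set ls" "t \<in> lends l" by blast
    then show "t \<in> (\<Union>q\<in>Q. endvertices q)" using lsE[OF l(1)] by (auto simp: lends_def)
  next
    fix t assume "t \<in> (\<Union>q\<in>Q. endvertices q)"
    then obtain q where "Inr q \<in> set ls" "t \<in> endvertices q" by (auto simp: Q_def)
    then show "t \<in> \<Union>(lends ` set ls)" by (auto simp: lends_def intro!: bexI)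
  qed
  moreover have "absorbs (\<Union>(ledges ` set ls)) (\<Union>(lends ` set ls)) x y"
    by (rule iffD1[OF if_P[OF exI[of "\<lambda>q. Inr q \<in> set ls", OF ls(4)]] abs])
  ultimately have "absorbs (F \<union> (\<Union>q\<in>Q. path_edges q)) (\<Union>q\<in>Q. endvertices q) x y"
    by simp
  then show ?thesis using fin Q F
    by (intro exI[of _ Q] exI[of _ F]) blast
qed

end

subsection \<open>Pendant families\<close>

lemma finite_meeting:
  assumes "finite W" "\<And>a b. a \<in> M \<Longrightarrow> b \<in> M \<Longrightarrow> a \<noteq> b \<Longrightarrow> f a \<inter> f b = {}"
  shows "finite {a \<in> M. f a \<inter> W \<noteq> {}}"
proof -
  have "finite {a \<in> M. w \<in> f a}" for w
  proof (cases "\<exists>a\<in>M. w \<in> f a")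
    case True
    then obtain a where "a \<in> M" "w \<in> f a" by blast
    then have "{a \<in> M. w \<in> f a} \<subseteq> {a}" using assms(2) by blast
    then show ?thesis by (rule finite_subset) simp
  next
    case False
    then have empty: "{a \<in> M. w \<in> f a} = {}" by blast
    show ?thesis unfolding empty by simp
  qed
  then have "finite (\<Union>w\<in>W. {a \<in> M. w \<in> f a})" using assms(1) by simp
  then show ?thesis by (rule rev_finite_subset) blast
qed

context wf_graph
begin

lemma path_ends:
  assumes "is_path G p"
  shows "hd (fst p) \<in> endvertices p" "endvertices p \<subseteq> set (fst p)" "finite (path_edges p)"
    "finite (endvertices p)"
proof -
  have "fst p \<noteq> []" using assms by (auto simp: is_path_def)
  then show "hd (fst p) \<in> endvertices p" "endvertices p \<subseteq> set (fst p)" "finite (path_edges p)"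
    "finite (endvertices p)"
    by (auto simp: endvertices_def path_edges_def)
qed

lemma conn_V: "conn Z x v \<Longrightarrow> Z \<subseteq> E \<Longrightarrow> x \<in> V \<Longrightarrow> v \<in> V"
proof (induction rule: conn_induct)
  case (step a b e)
  then show ?case using wf by (auto simp: wf_multigraph_def)
qed

text \<open>Neither a set \<open>U\<close> nor connectedness of the members is mentioned, so that
  families can be formed in \<open>E - Y\<close>, which may be disconnected.
  \<open>pendant_components\<close> recovers the components when the whole graph is
  connected.\<close>

definition pendant_family :: "'e set \<Rightarrow> 'a set set \<Rightarrow> bool" where
  "pendant_family Z M \<longleftrightarrow> infinite M \<and> (\<forall>C\<in>M. \<forall>C'\<in>M. C \<noteq> C' \<longrightarrow> C \<inter> C' = {}) \<and>
     (\<forall>C\<in>M. C \<subseteq> V \<and> (\<exists>u\<in>C. \<exists>v\<in>C. u \<noteq> v) \<and> (\<exists>e. cut Z C = {e}))"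

text \<open>Only finitely many of the disjoint members contain an end of an edge of
  \<open>Y\<close>. All others have the same boundary with and without \<open>Y\<close>.\<close>

lemma pendant_family_delete:
  assumes M: "pendant_family (E - Y) M" and Y: "finite Y" "Y \<subseteq> E"
  shows "\<exists>M. pendant_family E M"
proof -
  let ?W = "\<Union>e\<in>Y. en e"
  have "finite ?W" using Y finite_ends by blast
  then have "finite {C \<in> M. C \<inter> ?W \<noteq> {}}"
    using M by (intro finite_meeting[of _ _ "\<lambda>C. C"]) (auto simp: pendant_family_def)
  then have "infinite (M - {C \<in> M. C \<inter> ?W \<noteq> {}})"
    using M by (auto simp: pendant_family_def)
  moreover have "cut E C = cut (E - Y) C" if "C \<inter> ?W = {}" for C
    using that by (auto simp: cut_def)
  ultimately have "pendant_family E (M - {C \<in> M. C \<inter> ?W \<noteq> {}})"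
    using M by (auto simp: pendant_family_def)
  then show ?thesis by blast
qed

section \<open>Uncrossing of sets with a single boundary edge\<close>

lemma cutI: "e \<in> Z \<Longrightarrow> en e = {a, b} \<Longrightarrow> a \<in> C \<Longrightarrow> b \<notin> C \<Longrightarrow> e \<in> cut Z C"
  by (auto simp: cut_def)

lemma cut_Int: "cut Z (C \<inter> D) \<subseteq> cut Z C \<union> cut Z D"
  by (rule subsetI, erule cutE) (auto intro: cutI)

lemma cut_Un: "cut Z (C \<union> D) \<subseteq> cut Z C \<union> cut Z D"
  by (rule subsetI, erule cutE) (auto intro: cutI)

lemma cut_Diff: "cut Z (C - D) \<subseteq> cut Z C \<union> cut Z D"
proof
  fix e assume "e \<in> cut Z (C - D)"
  then obtain a b where "e \<in> Z" "a \<in> C - D" "b \<notin> C - D" "en e = {a, b}" by (rule cutE)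
  then show "e \<in> cut Z C \<union> cut Z D"
    using cutI[of e Z a b C] cutI[of e Z b a D] by (auto simp: insert_commute)
qed

text \<open>If \<open>e\<close> and \<open>f\<close> both left the union, then an edge leaving the
  intersection, which exists because \<open>x\<close> is connected to \<open>v\<close>, would run
  from \<open>C \<inter> D\<close> to the outside of \<open>C \<union> D\<close>. It would belong to
  both boundaries, so \<open>e = f\<close>.\<close>

lemma cut_union:
  assumes C: "cut Z C = {e}" "cut Z D = {f}" and v: "v \<in> C \<inter> D" "conn Z x v" "x \<notin> C \<union> D"
  shows "\<exists>g. cut Z (C \<union> D) = {g}"
proof -
  have ne: "cut Z (C \<union> D) \<noteq> {}" "cut Z (C \<inter> D) \<noteq> {}"
    using v cut_nonempty'[of Z x v] by auto
  have sub: "cut Z (C \<union> D) \<subseteq> {e, f}"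
  proof
    fix h assume "h \<in> cut Z (C \<union> D)"
    then have "h \<in> cut Z C \<union> cut Z D" using cut_Un by blast
    then show "h \<in> {e, f}" using C by auto
  qed
  have "e = f" if ef: "e \<in> cut Z (C \<union> D)" "f \<in> cut Z (C \<union> D)"
  proof -
    obtain h where h: "h \<in> cut Z (C \<inter> D)" using ne by blast
    then have "h \<in> cut Z C \<union> cut Z D" using cut_Int by blast
    then have "h \<in> cut Z (C \<union> D)" using C ef by auto
    then obtain c d where cd: "c \<in> C \<union> D" "d \<notin> C \<union> D" "en h = {c, d}" by (rule cutE)
    obtain a b where ab: "h \<in> Z" "a \<in> C \<inter> D" "b \<notin> C \<inter> D" "en h = {a, b}" using h by (rule cutE)
    have "b = d" using ab cd by (auto simp: doubleton_eq_iff)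
    then have "h \<in> cut Z C" "h \<in> cut Z D" using ab cd cutI[of h Z a b] by auto
    then show ?thesis using C by auto
  qed
  then show ?thesis using sub ne by auto
qed

text \<open>If \<open>C - D\<close> were nonempty, both \<open>C - D\<close> and
  \<open>C \<inter> D\<close> would have \<open>e\<close> as a boundary edge, being connected to
  \<open>x\<close> outside. Then both ends of \<open>e\<close> would lie in
  \<open>C\<close>.\<close>

lemma cut_determines:
  assumes C: "cut Z C = {e}" "cut Z D = {e}" and v: "v \<in> C \<inter> D" "conn Z x v" "x \<notin> C \<union> D"
    and K: "\<And>w. w \<in> C \<Longrightarrow> conn Z x w"
  shows "C \<subseteq> D"
proof
  fix w assume w: "w \<in> C"
  show "w \<in> D"
  proof (rule ccontr)
    assume "w \<notin> D"
    then have "cut Z (C - D) \<noteq> {}" using w v cut_nonempty'[OF K[OF w], of "C - D"] by auto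
    then obtain h where h: "h \<in> cut Z (C - D)" by blast
    then have "h \<in> cut Z C \<union> cut Z D" using cut_Diff by blast
    then have eA: "e \<in> cut Z (C - D)" using h C by auto
    have "cut Z (C \<inter> D) \<noteq> {}" using v cut_nonempty'[OF v(2), of "C \<inter> D"] by auto
    then obtain h' where h': "h' \<in> cut Z (C \<inter> D)" by blast
    then have "h' \<in> cut Z C \<union> cut Z D" using cut_Int by blast
    then have eI: "e \<in> cut Z (C \<inter> D)" using h' C by auto
    obtain a b where ab: "a \<in> C - D" "b \<notin> C - D" "en e = {a, b}" using eA by (rule cutE)
    obtain c d where cd: "c \<in> C \<inter> D" "d \<notin> C \<inter> D" "en e = {c, d}" using eI by (rule cutE)
    have "en e \<subseteq> C" using ab cd by (auto simp: doubleton_eq_iff)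
    moreover have "e \<in> cut Z C" using C by simp
    ultimately show False by (auto simp: cut_def)
  qed
qed

lemma unseparated_path:
  assumes P: "T_join G T P" and PK: "PK \<subseteq> P" "infinite PK"
    and Z: "Z \<subseteq> E" "\<not> (\<exists>M. pendant_family Z M)" and x: "x \<in> V"
    and K: "\<And>p v. p \<in> PK \<Longrightarrow> v \<in> set (fst p) \<Longrightarrow> conn Z x v"
  shows "\<exists>p\<in>PK. \<forall>C e. x \<notin> C \<longrightarrow> C \<subseteq> {v. conn Z x v} \<longrightarrow> set (fst p) \<subseteq> C \<longrightarrow> cut Z C = {e} \<longrightarrow>
    infinite (T \<inter> C)"
proof (rule ccontr)
  assume separated: "\<not> ?thesis"
  define CC where "CC = {C. x \<notin> C \<and> C \<subseteq> {v. conn Z x v} \<and> (\<exists>e. cut Z C = {e}) \<and> finite (T \<inter> C) \<and>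
    (\<exists>p\<in>PK. set (fst p) \<subseteq> C)}"
  have ex: "\<exists>C\<in>CC. set (fst p) \<subseteq> C" if p: "p \<in> PK" for p
  proof -
    obtain C e where C: "x \<notin> C" "C \<subseteq> {v. conn Z x v}" "set (fst p) \<subseteq> C" "cut Z C = {e}"
      "finite (T \<inter> C)"
      using p separated by meson
    then have "C \<in> CC" using p unfolding CC_def by (intro CollectI conjI exI[of _ e] bexI[of _ p])
    then show ?thesis using C(3) by blast
  qed
  have path: "is_path G p" "card (endvertices p) = 2" if "p \<in> PK" for p
    using T_joinD(1,2)[OF P] PK that by blast+
  define M where "M = {C \<in> CC. \<forall>C'\<in>CC. C \<subseteq> C' \<longrightarrow> C = C'}"
  \<comment> \<open>Each side that contains \<open>v\<close> cuts the fixed finite connection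
    \<open>F\<close> from \<open>x\<close> to \<open>v\<close>, and by \<open>cut_determines\<close>
    its boundary edge determines it. So only finitely many sides contain \<open>v\<close>, and a
    maximal one exists.\<close>
  have max: "\<exists>D\<in>M. C \<subseteq> D" if C: "C \<in> CC" for C
  proof -
    obtain p where p: "p \<in> PK" "set (fst p) \<subseteq> C" using C by (auto simp: CC_def)
    define v where "v = hd (fst p)"
    have v: "v \<in> C" "conn Z x v"
      using p path_ends(1,2)[OF path(1)[OF p(1)]] K[OF p(1)] by (auto simp: v_def)
    obtain F where F: "F \<subseteq> Z" "finite F" "conn F x v" by (rule conn_finite[OF v(2)])
    let ?A = "{D \<in> CC. v \<in> D}"
    have "?A \<subseteq> (\<Union>e\<in>F. {D \<in> CC. v \<in> D \<and> cut Z D = {e}})"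
    proof
      fix D assume D: "D \<in> ?A"
      then obtain e where e: "cut Z D = {e}" by (auto simp: CC_def)
      have "cut F D \<noteq> {}" using D cut_nonempty'[OF F(3), of D] by (auto simp: CC_def)
      moreover have "cut F D \<subseteq> cut Z D \<inter> F" using F by (auto simp: cut_def)
      ultimately have "e \<in> F" using e by auto
      then show "D \<in> (\<Union>e\<in>F. {D \<in> CC. v \<in> D \<and> cut Z D = {e}})" using D e by auto
    qed
    moreover have "finite {D \<in> CC. v \<in> D \<and> cut Z D = {e}}" for e
    proof -
      have "D \<subseteq> D'" if "D \<in> CC" "v \<in> D" "cut Z D = {e}" "D' \<in> CC" "v \<in> D'" "cut Z D' = {e}" for D D'
        by (rule cut_determines[of Z D e D' v x]) (use that v(2) in \<open>auto simp: CC_def\<close>)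
      then have "D = D'" if "D \<in> CC" "v \<in> D" "cut Z D = {e}" "D' \<in> CC" "v \<in> D'" "cut Z D' = {e}" for D D'
        using that by (intro subset_antisym)
      then have "{D \<in> CC. v \<in> D \<and> cut Z D = {e}} \<subseteq> {SOME D. D \<in> CC \<and> v \<in> D \<and> cut Z D = {e}}"
        by (smt (verit, best) mem_Collect_eq singletonI someI_ex subsetI)
      then show ?thesis by (rule finite_subset) simp
    qed
    ultimately have "finite ?A" using F(2) by (meson finite_UN_I finite_subset)
    moreover have "C \<in> ?A" using C v by auto
    ultimately obtain D where D: "D \<in> ?A" "C \<subseteq> D" "\<forall>D'\<in>?A. D \<subseteq> D' \<longrightarrow> D = D'"
      using finite_has_maximal2[of ?A C] by blast
    then have "D \<in> M" unfolding M_def by blast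
    then show ?thesis using D by blast
  qed
  \<comment> \<open>By uncrossing, the union of two intersecting sides is again a side, and
    maximality makes both equal to it.\<close>
  have disj: "C = D" if CD: "C \<in> M" "D \<in> M" "C \<inter> D \<noteq> {}" for C D
  proof -
    obtain v where v: "v \<in> C \<inter> D" using CD by blast
    have CD': "C \<in> CC" "D \<in> CC" using CD by (auto simp: M_def)
    then obtain e f where ef: "cut Z C = {e}" "cut Z D = {f}" by (auto simp: CC_def)
    have "\<exists>g. cut Z (C \<union> D) = {g}"
      by (rule cut_union[OF ef v, of x]) (use CD' v in \<open>auto simp: CC_def\<close>)
    moreover obtain p where "p \<in> PK" "set (fst p) \<subseteq> C" using CD' by (auto simp: CC_def)
    then have "\<exists>p\<in>PK. set (fst p) \<subseteq> C \<union> D" by blast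
    ultimately have CuD: "C \<union> D \<in> CC" using CD' by (auto simp: CC_def Int_Un_distrib)
    have M: "A = B" if "A \<in> M" "B \<in> CC" "A \<subseteq> B" for A B using that by (simp add: M_def)
    have "C = C \<union> D" by (rule M[OF CD(1) CuD]) simp
    moreover have "D = C \<union> D" by (rule M[OF CD(2) CuD]) simp
    ultimately show ?thesis by simp
  qed
  \<comment> \<open>A side contains finitely many terminals and hence finitely many paths, but
    \<open>PK\<close> is infinite.\<close>
  have "infinite M"
  proof
    assume "finite M"
    moreover have "finite {p \<in> PK. set (fst p) \<subseteq> C}" if "C \<in> M" for C
    proof (rule finite_subset)
      show "{p \<in> PK. set (fst p) \<subseteq> C} \<subseteq> {p \<in> PK. endvertices p \<inter> (T \<inter> C) \<noteq> {}}"
      proof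
        fix p assume p: "p \<in> {p \<in> PK. set (fst p) \<subseteq> C}"
        then have "hd (fst p) \<in> endvertices p" "hd (fst p) \<in> C" "p \<in> P"
          using path_ends[of p] path(1)[of p] PK by auto
        then show "p \<in> {p \<in> PK. endvertices p \<inter> (T \<inter> C) \<noteq> {}}"
          using T_joinD(5)[OF P] p by auto
      qed
      show "finite {p \<in> PK. endvertices p \<inter> (T \<inter> C) \<noteq> {}}"
      proof (rule finite_meeting)
        show "finite (T \<inter> C)" using that by (simp add: M_def CC_def)
        fix p q assume "p \<in> PK" "q \<in> PK" "p \<noteq> q"
        then show "endvertices p \<inter> endvertices q = {}" using T_joinD(4)[OF P, of p q] PK(1) by blast
      qed
    qed
    ultimately have "finite (\<Union>C\<in>M. {p \<in> PK. set (fst p) \<subseteq> C})" by blast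
    moreover have "PK \<subseteq> (\<Union>C\<in>M. {p \<in> PK. set (fst p) \<subseteq> C})"
    proof
      fix p assume p: "p \<in> PK"
      then obtain C where "C \<in> CC" "set (fst p) \<subseteq> C" using ex by blast
      then obtain D where "D \<in> M" "set (fst p) \<subseteq> D" using max[of C] by blast
      then show "p \<in> (\<Union>C\<in>M. {p \<in> PK. set (fst p) \<subseteq> C})" using p by blast
    qed
    ultimately show False using PK(2) finite_subset by blast
  qed
  moreover have "C \<subseteq> V \<and> (\<exists>u\<in>C. \<exists>v\<in>C. u \<noteq> v) \<and> (\<exists>e. cut Z C = {e})" if C: "C \<in> M" for C
  proof -
    have CC: "C \<in> CC" using C by (simp add: M_def)
    then obtain p where p: "p \<in> PK" "set (fst p) \<subseteq> C" by (auto simp: CC_def)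
    then have "endvertices p \<subseteq> C" using path_ends(2)[OF path(1)[OF p(1)]] by auto
    moreover obtain u v where "endvertices p = {u, v}" "u \<noteq> v"
      using path(2)[OF p(1)] by (auto simp: card_2_iff)
    ultimately have "\<exists>u\<in>C. \<exists>v\<in>C. u \<noteq> v" by auto
    moreover have "C \<subseteq> V" using CC conn_V[OF _ Z(1) x] by (auto simp: CC_def)
    ultimately show ?thesis using CC by (auto simp: CC_def)
  qed
  ultimately have "pendant_family Z M" using disj unfolding pendant_family_def by blast
  then show False using Z(2) by blast
qed

subsection \<open>Extending the trail\<close>

text \<open>\<open>Y\<close> contains the edges used so far, \<open>B\<close> the paths broken up so far, and \<open>x\<close> is the current
  end of the trail.\<close>

definition stage :: "'a set \<Rightarrow> ('a, 'e) gpath set \<Rightarrow> 'e set \<Rightarrow> ('a, 'e) gpath set \<Rightarrow> 'a \<Rightarrow> bool" where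
  "stage T P Y B x \<longleftrightarrow> finite Y \<and> Y \<subseteq> E \<and> finite B \<and> B \<subseteq> P \<and> (\<forall>p\<in>B. path_edges p \<subseteq> Y) \<and>
     (\<forall>p\<in>P - B. path_edges p \<inter> Y = {}) \<and> x \<in> V \<and> infinite (T \<inter> {v. conn (E - Y) x v})"

text \<open>Every component of \<open>Z - Y\<close> within the component of \<open>x\<close>
  contains \<open>x\<close> or an end of an edge of \<open>Y\<close>. So there are finitely many,
  and those with finitely many terminals have only finitely many altogether.\<close>

lemma finite_small_components:
  assumes Y: "finite Y" "Y \<subseteq> E"
  shows "finite (T \<inter> {v. conn Z x v \<and> finite (T \<inter> {w. conn (Z - Y) v w})})"
proof -
  let ?W = "insert x (\<Union>e\<in>Y. en e)"
  have W: "finite ?W" using Y finite_ends by blast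
  have rep: "\<exists>w\<in>?W. conn (Z - Y) w v" if "conn Z x v" for v
    using that
  proof (induction rule: conn_induct)
    case refl
    then show ?case by auto
  next
    case (step a b e)
    show ?case
    proof (cases "e \<in> Y")
      case True
      then have "b \<in> ?W" using step.hyps(3) by auto
      then show ?thesis using conn_refl by blast
    next
      case False
      then have "e \<in> Z - Y" using step.hyps(2) by simp
      then show ?thesis using step.IH conn_step[OF _ _ step.hyps(3)] by blast
    qed
  qed
  let ?U = "\<Union>w\<in>{w \<in> ?W. finite (T \<inter> {u. conn (Z - Y) w u})}. T \<inter> {u. conn (Z - Y) w u}"
  have "finite {w \<in> ?W. finite (T \<inter> {u. conn (Z - Y) w u})}"
    using W by (rule rev_finite_subset) blast
  then have "finite ?U" by (rule finite_UN_I) blast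
  moreover have "T \<inter> {v. conn Z x v \<and> finite (T \<inter> {w. conn (Z - Y) v w})} \<subseteq> ?U"
  proof
    fix v assume v: "v \<in> T \<inter> {v. conn Z x v \<and> finite (T \<inter> {w. conn (Z - Y) v w})}"
    then obtain w where w: "w \<in> ?W" "conn (Z - Y) w v" using rep[of v] by blast
    then have "{u. conn (Z - Y) w u} = {u. conn (Z - Y) v u}"
      using conn_trans conn_sym by blast
    then have "finite (T \<inter> {u. conn (Z - Y) w u})" using v by simp
    then show "v \<in> ?U" using v w by blast
  qed
  ultimately show ?thesis by (rule rev_finite_subset)
qed

lemma stage_step:
  assumes P: "T_join G T P" and T: "T \<subseteq> V" and nopend: "\<not> (\<exists>M. pendant_family E M)"
    and st: "stage T P Y B x"
  shows "\<exists>Y' B' y. stage T P Y' B' y \<and> Y \<subseteq> Y' \<and> B \<subseteq> B' \<and>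
    absorbs (Y' - Y) (\<Union>p\<in>B' - B. endvertices p) x y"
proof -
  define Z where "Z = E - Y"
  have Y: "finite Y" "Y \<subseteq> E" and B: "finite B" "B \<subseteq> P"
    and BY: "\<And>p. p \<in> B \<Longrightarrow> path_edges p \<subseteq> Y" and PY: "\<And>p. p \<in> P \<Longrightarrow> p \<notin> B \<Longrightarrow> path_edges p \<inter> Y = {}"
    and x: "x \<in> V" and inf: "infinite (T \<inter> {v. conn Z x v})"
    using st by (auto simp: stage_def Z_def)
  have ZE: "Z \<subseteq> E" by (auto simp: Z_def)
  have Znopend: "\<not> (\<exists>M. pendant_family Z M)"
    using pendant_family_delete Y nopend by (auto simp: Z_def)
  have path: "is_path G p" "path_edges p \<subseteq> E" if "p \<in> P" for p
    using T_joinD(1)[OF P that] path_edge_verts(2)[of p] by auto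
  have pZ: "path_edges p \<subseteq> Z" if "p \<in> P" "p \<notin> B" for p
    using path(2)[OF that(1)] PY[OF that] by (auto simp: Z_def)
  \<comment> \<open>The unbroken paths in the component of \<open>x\<close>. Every terminal of that
    component is an end of one of these or of one of the finitely many broken paths.\<close>
  define PK where "PK = {p \<in> P - B. set (fst p) \<subseteq> {v. conn Z x v}}"
  have "infinite PK"
  proof
    assume "finite PK"
    then have "finite (\<Union>p\<in>B \<union> PK. endvertices p)"
      using B path_ends(4) path(1) by (intro finite_UN_I) (auto simp: PK_def)
    moreover have "T \<inter> {v. conn Z x v} \<subseteq> (\<Union>p\<in>B \<union> PK. endvertices p)"
    proof
      fix t assume t: "t \<in> T \<inter> {v. conn Z x v}"
      then obtain p where p: "p \<in> P" "t \<in> endvertices p" using T_joinD(5)[OF P] by blast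
      have "p \<in> PK" if pB: "p \<notin> B"
      proof -
        have "conn Z x v" if "v \<in> set (fst p)" for v
        proof -
          have "conn (path_edges p) t v"
            using path_verts_conn[OF path(1)[OF p(1)] _ that] path_ends(2)[OF path(1)[OF p(1)]] p by blast
          then have "conn Z t v" using pZ[OF p(1) pB] by (rule conn_mono)
          then show ?thesis using t conn_trans by blast
        qed
        then show ?thesis using p pB by (auto simp: PK_def)
      qed
      then show "t \<in> (\<Union>p\<in>B \<union> PK. endvertices p)" using p by blast
    qed
    ultimately show False using inf finite_subset by blast
  qed
  have PKP: "PK \<subseteq> P" by (auto simp: PK_def)
  have PKK: "conn Z x v" if "p \<in> PK" "v \<in> set (fst p)" for p v using that by (auto simp: PK_def)
  have "\<exists>p\<in>PK. \<forall>C e. x \<notin> C \<longrightarrow> C \<subseteq> {v. conn Z x v} \<longrightarrow> set (fst p) \<subseteq> C \<longrightarrow> cut Z C = {e} \<longrightarrow>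
      infinite (T \<inter> C)"
    by (rule unseparated_path[OF P PKP \<open>infinite PK\<close> ZE Znopend x PKK])
  then obtain p where p: "p \<in> PK"
    and unsep0: "\<forall>C e. x \<notin> C \<longrightarrow> C \<subseteq> {v. conn Z x v} \<longrightarrow> set (fst p) \<subseteq> C \<longrightarrow> cut Z C = {e} \<longrightarrow>
      infinite (T \<inter> C)"
    by (rule bexE)
  have unsep: "infinite (T \<inter> C)"
    if "x \<notin> C" "C \<subseteq> {v. conn Z x v}" "set (fst p) \<subseteq> C" "cut Z C = {e}" for C e
    using unsep0[rule_format, OF that] .
  have pP: "p \<in> P" "p \<notin> B" using p by (auto simp: PK_def)
  define s where "s = hd (fst p)"
  have s: "s \<in> set (fst p)" using path_ends(1,2)[OF path(1)[OF pP(1)]] by (auto simp: s_def)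
  have xs: "conn Z x s" by (rule PKK[OF p s])
  obtain Q where Q: "Q \<subseteq> Z" "finite Q" "conn Q x s" by (rule conn_finite[OF xs])
  define PQ where "PQ = {q \<in> P. q \<notin> B \<and> path_edges q \<inter> Q \<noteq> {}}"
  \<comment> \<open>Paths that meet \<open>Q\<close> are added as a whole, so that each unbroken
    path lies either inside \<open>Y1\<close> or outside it.\<close>
  define Y1 where "Y1 = Q \<union> path_edges p \<union> (\<Union>q\<in>PQ. path_edges q)"
  have "finite {q \<in> P. path_edges q \<inter> Q \<noteq> {}}"
    by (rule finite_meeting[OF Q(2) T_joinD(3)[OF P]])
  then have "finite PQ" by (rule rev_finite_subset) (auto simp: PQ_def)
  moreover have PQ: "q \<in> P" if "q \<in> PQ" for q using that by (simp add: PQ_def)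
  ultimately have Y1: "finite Y1" "Y1 \<subseteq> E"
  proof -
    assume "finite PQ"
    then show "finite Y1"
      unfolding Y1_def using Q(2) path_ends(3)[OF path(1)] pP(1) PQ by blast
    show "Y1 \<subseteq> E"
      unfolding Y1_def using Q(1) ZE path(2)[OF pP(1)] path(2)[OF PQ] by blast
  qed
  define Z1 where "Z1 = Z - Y1"
  \<comment> \<open>The target of the second route: vertices whose component still has infinitely
    many terminals after the deletion of \<open>Y1\<close>.\<close>
  define Ks where "Ks = {v. conn Z x v \<and> infinite (T \<inter> {w. conn Z1 v w})}"
  have small: "finite (T \<inter> ({v. conn Z x v} - Ks))"
  proof -
    have "T \<inter> ({v. conn Z x v} - Ks) = T \<inter> {v. conn Z x v \<and> finite (T \<inter> {w. conn Z1 v w})}"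
      by (auto simp: Ks_def)
    then show ?thesis using finite_small_components[OF Y1, of T Z x] by (simp add: Z1_def)
  qed
  have Ks_ne: "Ks \<noteq> {}"
    using small inf by auto
  have Ks_conn: "w \<in> Ks" if vw: "v \<in> Ks" "conn Z1 v w" for v w
  proof -
    have "conn Z v w" using vw(2) by (rule conn_mono) (auto simp: Z1_def)
    moreover have "{u. conn Z1 w u} = {u. conn Z1 v u}"
      using conn_trans[OF vw(2)] conn_trans[OF conn_sym[OF vw(2)]] by blast
    ultimately show ?thesis using vw(1) conn_trans[of Z x v w] by (simp add: Ks_def)
  qed
  \<comment> \<open>The routes are denied the edges outside \<open>Y1\<close> with both ends in
    \<open>Ks\<close>, so that they do not damage the component in which the trail is to
    continue.\<close>
  define H where "H = {e \<in> Z. e \<in> Y1 \<or> \<not> en e \<subseteq> Ks}"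
  have cutH: "cut H R \<noteq> {} \<and> (x \<notin> R \<longrightarrow> (\<forall>e. cut H R \<noteq> {e}))"
    if R: "set (fst p) \<subseteq> R" "R \<inter> Ks = {}" for R
  proof -
    \<comment> \<open>\<open>R\<close> avoids \<open>Ks\<close>, so an edge leaving \<open>R\<close>
      has an end outside \<open>Ks\<close> and belongs to \<open>H\<close>.\<close>
    have HZ: "cut H R = cut Z R"
      using R(2) unfolding cut_def H_def by fastforce
    obtain k where k: "k \<in> Ks" using Ks_ne by blast
    have "conn Z s k" using conn_trans[OF conn_sym[OF xs]] k by (auto simp: Ks_def)
    then have ne: "cut Z R \<noteq> {}" by (rule cut_nonempty) (use R s k in auto)
    have "cut Z R \<noteq> {e}" if xR: "x \<notin> R" for e
    proof
      assume e: "cut Z R = {e}"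
      \<comment> \<open>Restricted to the component of \<open>x\<close>, the side has the form for
        which \<open>p\<close> was chosen. It would contain infinitely many terminals, but only
        finitely many of that component lie outside \<open>Ks\<close>.\<close>
      let ?C = "R \<inter> {v. conn Z x v}"
      have "cut Z ?C \<subseteq> cut Z R"
      proof
        fix h assume "h \<in> cut Z ?C"
        then obtain a b where h: "h \<in> Z" "a \<in> ?C" "b \<notin> ?C" "en h = {a, b}" by (rule cutE)
        then have "conn Z x b" using conn_step[of Z x a h b] by blast
        then show "h \<in> cut Z R" using h by (intro cutI[of h Z a b]) auto
      qed
      moreover have "cut Z ?C \<noteq> {}" by (rule cut_nonempty'[OF xs]) (use R s xs xR in auto)
      ultimately have "cut Z ?C = {e}" using e by auto
      then have "infinite (T \<inter> ?C)" by (intro unsep) (use xR R PKK[OF p] in auto)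
      moreover have "T \<inter> ?C \<subseteq> T \<inter> ({v. conn Z x v} - Ks)" using R by auto
      ultimately show False using small finite_subset by blast
    qed
    then show ?thesis using ne HZ by simp
  qed
  have QH: "Q \<subseteq> H" using Q by (auto simp: H_def Y1_def)
  have "\<exists>A B a b y. A \<subseteq> H \<and> B \<subseteq> H \<and> A \<inter> B = {} \<and> a \<in> set (fst p) \<and> b \<in> set (fst p) \<and>
      y \<in> Ks \<and> conn A x a \<and> conn B b y"
    by (rule two_disjoint_conns[OF Q(2) QH Q(3) s cutH])
  then obtain A A' a b y where AB: "A \<subseteq> H" "A' \<subseteq> H" "A \<inter> A' = {}" "a \<in> set (fst p)" "b \<in> set (fst p)"
      "y \<in> Ks" "conn A x a" "conn A' b y"
    by (elim exE conjE)
  have "\<exists>Q F. finite Q \<and> Q \<subseteq> insert p {q \<in> P. path_edges q \<inter> (A \<union> A') \<noteq> {}} \<and> finite F \<and>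
      F \<subseteq> A \<union> A' \<and> (\<forall>q\<in>P. path_edges q \<inter> F = {}) \<and>
      absorbs (F \<union> (\<Union>q\<in>Q. path_edges q)) (\<Union>q\<in>Q. endvertices q) x y"
    by (rule absorb_route[OF P AB(7,8,3) pP(1) AB(4,5)])
  then obtain R F where RF: "finite R" "R \<subseteq> insert p {q \<in> P. path_edges q \<inter> (A \<union> A') \<noteq> {}}" "finite F"
      "F \<subseteq> A \<union> A'" "\<forall>q\<in>P. path_edges q \<inter> F = {}"
      "absorbs (F \<union> (\<Union>q\<in>R. path_edges q)) (\<Union>q\<in>R. endvertices q) x y"
    by (elim exE conjE)
  have AZ: "A \<union> A' \<subseteq> Z" using AB by (auto simp: H_def)
  have RP: "q \<in> P" "q \<notin> B" if "q \<in> R" for q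
  proof -
    have *: "q = p \<or> q \<in> P \<and> path_edges q \<inter> (A \<union> A') \<noteq> {}" using RF(2) that by blast
    then show "q \<in> P" using pP by auto
    show "q \<notin> B" using * pP BY[of q] AZ by (auto simp: Z_def)
  qed
  define D where "D = F \<union> (\<Union>q\<in>R. path_edges q)"
  have RY: "path_edges q \<inter> Y = {}" "path_edges q \<subseteq> E" "finite (path_edges q)" if "q \<in> R" for q
    using PY[OF RP[OF that]] path(2)[OF RP(1)[OF that]] path_ends(3)[OF path(1)[OF RP(1)[OF that]]]
    by auto
  have DY: "D \<inter> Y = {}"
  proof -
    have "F \<inter> Y = {}" using RF(4) AZ unfolding Z_def by blast
    then show ?thesis using RY(1) unfolding D_def by blast
  qed
  have DE: "D \<subseteq> E"
  proof -
    have "F \<subseteq> E" using RF(4) AZ ZE by blast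
    then show ?thesis using RY(2) unfolding D_def by blast
  qed
  have "finite D" using RF(1,3) RY(3) unfolding D_def by blast
  \<comment> \<open>A broken path loses all its edges, also those off the routes. If a broken path
    \<open>q\<close> had an edge of \<open>Z1\<close> with both ends in \<open>Ks\<close>, it would
    avoid \<open>Y1\<close> and thus stay within \<open>Ks\<close>; but then no edge of
    \<open>q\<close> lies in \<open>H\<close>, so no route could have met it.\<close>
  have yD: "conn (E - (Y \<union> D)) y w" if yw: "conn Z1 y w" for w
  proof (rule conn_mono[OF conn_component[OF yw]], rule subsetI)
    fix e assume "e \<in> {e \<in> Z1. \<forall>u\<in>en e. conn Z1 y u}"
    then have e: "e \<in> Z1" "en e \<subseteq> Ks" using Ks_conn[OF AB(6)] by auto
    then have eH: "e \<notin> H" by (auto simp: H_def Z1_def)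
    have "e \<notin> path_edges q" if q: "q \<in> R" for q
    proof
      assume eq: "e \<in> path_edges q"
      have eY1: "e \<notin> Y1" using e by (auto simp: Z1_def)
      then have "q \<noteq> p" using eq by (auto simp: Y1_def)
      then obtain h where h: "h \<in> path_edges q" "h \<in> H" using RF(2) q AB(1,2) by blast
      have "q \<notin> PQ" using eY1 eq by (auto simp: Y1_def)
      then have "path_edges q \<inter> Q = {}" using RP[OF q] by (simp add: PQ_def)
      moreover have "path_edges q \<inter> path_edges q' = {}" if "q' \<in> PQ \<or> q' = p" for q'
        using T_joinD(3)[OF P RP(1)[OF q], of q'] that PQ pP(1) \<open>q \<noteq> p\<close> \<open>q \<notin> PQ\<close> by blast
      ultimately have "path_edges q \<inter> Y1 = {}" unfolding Y1_def by blast
      then have qZ1: "path_edges q \<subseteq> Z1" using pZ[OF RP[OF q]] by (auto simp: Z1_def)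
      have qp: "is_path G q" using path RP[OF q] by blast
      obtain u where u: "u \<in> en e" using edgeE[of e] path_edge_verts(2)[OF qp eq] by blast
      have "v \<in> Ks" if "v \<in> set (fst q)" for v
      proof (rule Ks_conn)
        show "u \<in> Ks" using u e by blast
        have "u \<in> set (fst q)" using path_edge_verts(1)[OF qp eq] u by blast
        then show "conn Z1 u v" using path_verts_conn[OF qp _ that] qZ1 by (blast intro: conn_mono)
      qed
      then have "en h \<subseteq> Ks" using path_edge_verts(1)[OF qp h(1)] by blast
      moreover have "h \<notin> Y1" using h(1) qZ1 by (auto simp: Z1_def)
      ultimately show False using h(2) by (auto simp: H_def)
    qed
    moreover have "e \<notin> F" using eH RF(4) AB(1,2) by blast
    moreover have "e \<in> E" "e \<notin> Y" using e by (auto simp: Z1_def Z_def)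
    ultimately show "e \<in> E - (Y \<union> D)" by (auto simp: D_def)
  qed
  have "stage T P (Y \<union> D) (B \<union> R) y"
    unfolding stage_def
  proof (intro conjI ballI)
    show "finite (Y \<union> D)" "Y \<union> D \<subseteq> E" "finite (B \<union> R)" "B \<union> R \<subseteq> P"
      using Y \<open>finite D\<close> DE B RF(1) RP by auto
    show "path_edges q \<subseteq> Y \<union> D" if "q \<in> B \<union> R" for q using that BY[of q] by (auto simp: D_def)
    show "path_edges q \<inter> (Y \<union> D) = {}" if q: "q \<in> P - (B \<union> R)" for q
    proof -
      have "path_edges q \<inter> path_edges q' = {}" if "q' \<in> R" for q'
        using T_joinD(3)[OF P, of q q'] RP(1)[OF that] q that by blast
      then show ?thesis using q PY[of q] RF(5) by (auto simp: D_def)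
    qed
    have y: "conn Z x y" "infinite (T \<inter> {w. conn Z1 y w})" using AB(6) by (auto simp: Ks_def)
    show "y \<in> V" by (rule conn_V[OF y(1) ZE x])
    have "T \<inter> {w. conn Z1 y w} \<subseteq> T \<inter> {w. conn (E - (Y \<union> D)) y w}" using yD by blast
    then show "infinite (T \<inter> {v. conn (E - (Y \<union> D)) y v})" using y(2) finite_subset by blast
  qed
  moreover have "Y \<union> D - Y = D" "B \<union> R - B = R" using DY RP by auto
  ultimately show ?thesis using RF(6)
    by (intro exI[of _ "Y \<union> D"] exI[of _ "B \<union> R"] exI[of _ y]) (simp add: D_def)
qed

section \<open>The limit of the stages\<close>

lemma joinable_paths:
  assumes P: "T_join G T P" and Q: "Q \<subseteq> P"
  shows "joinable (\<Union>p\<in>Q. path_edges p) (\<Union>p\<in>Q. endvertices p)"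
proof (rule joinable_UN)
  fix p assume p: "p \<in> Q"
  then have path: "is_path G p" "card (endvertices p) = 2" using T_joinD(1,2)[OF P] Q by blast+
  then obtain u v where uv: "endvertices p = {u, v}" "u \<noteq> v" by (auto simp: card_2_iff)
  have "conn (path_edges p) u v"
    by (rule path_verts_conn[OF path(1)]) (use path_ends(2)[OF path(1)] uv in auto)
  then show "joinable (path_edges p) (endvertices p)" unfolding uv(1) using uv(2) by (rule joinable_pair)
  fix q assume "q \<in> Q" "p \<noteq> q"
  then show "path_edges p \<inter> path_edges q = {}" "endvertices p \<inter> endvertices q = {}"
    using T_joinD(3,4)[OF P, of p q] p Q by blast+
qed

text \<open>The terminal \<open>t1\<close> of a stage has a route to the vertex where the next stage
  starts and is joined there to the \<open>t0\<close> of that stage; at the start, \<open>t\<close>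
  takes this part. In the limit nothing is left over, and paths never broken up stay as they
  are.\<close>

lemma joinable_insert:
  assumes conn: "\<And>u v. u \<in> V \<Longrightarrow> v \<in> V \<Longrightarrow> conn E u v"
    and P: "T_join G T P" and T: "T \<subseteq> V" "infinite T" and t: "t \<in> V" "t \<notin> T"
    and nopend: "\<not> (\<exists>M. pendant_family E M)"
  shows "joinable E (insert t T)"
proof -
  have "T \<inter> {v. conn (E - {}) t v} = T" using conn t T by auto
  then have st0: "stage T P {} {} t" using t T by (simp add: stage_def)
  \<comment> \<open>The clause for \<open>n = 0\<close> pins the initial state inside the predicate
    that \<open>dependent_nat_choice\<close> maintains.\<close>
  have "\<exists>f. \<forall>n. (case f n of (Y, B, x) \<Rightarrow> stage T P Y B x \<and> (n = 0 \<longrightarrow> (Y, B, x) = ({}, {}, t))) \<and>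
      (case f n of (Y, B, x) \<Rightarrow> case f (Suc n) of (Y', B', y) \<Rightarrow>
        Y \<subseteq> Y' \<and> B \<subseteq> B' \<and> absorbs (Y' - Y) (\<Union>p\<in>B' - B. endvertices p) x y)"
  proof (rule dependent_nat_choice)
    show "\<exists>s. case s of (Y, B, x) \<Rightarrow> stage T P Y B x \<and> (0 = 0 \<longrightarrow> (Y, B, x) = ({}, {}, t))"
      by (rule exI[of _ "({}, {}, t)"]) (simp add: st0)
  next
    fix s n
    assume "case s of (Y, B, x) \<Rightarrow> stage T P Y B x \<and> (n = (0::nat) \<longrightarrow> (Y, B, x) = ({}, {}, t))"
    then obtain Y B x where s: "s = (Y, B, x)" "stage T P Y B x" by (cases s) auto
    obtain Y' B' y where "stage T P Y' B' y \<and> Y \<subseteq> Y' \<and> B \<subseteq> B' \<and>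
        absorbs (Y' - Y) (\<Union>p\<in>B' - B. endvertices p) x y"
      using stage_step[OF P T(1) nopend s(2)] by (elim exE)
    then show "\<exists>s'. (case s' of (Y, B, x) \<Rightarrow> stage T P Y B x \<and> (Suc n = 0 \<longrightarrow> (Y, B, x) = ({}, {}, t))) \<and>
      (case s of (Y, B, x) \<Rightarrow> case s' of (Y', B', y) \<Rightarrow>
        Y \<subseteq> Y' \<and> B \<subseteq> B' \<and> absorbs (Y' - Y) (\<Union>p\<in>B' - B. endvertices p) x y)"
      using s by (intro exI[of _ "(Y', B', y)"]) simp
  qed
  then obtain f where f: "\<forall>n. (case f n of (Y, B, x) \<Rightarrow> stage T P Y B x \<and> (n = 0 \<longrightarrow> (Y, B, x) = ({}, {}, t))) \<and>
      (case f n of (Y, B, x) \<Rightarrow> case f (Suc n) of (Y', B', y) \<Rightarrow>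
        Y \<subseteq> Y' \<and> B \<subseteq> B' \<and> absorbs (Y' - Y) (\<Union>p\<in>B' - B. endvertices p) x y)"
    by (elim exE)
  define Y B x where "Y n = fst (f n)" and "B n = fst (snd (f n))" and "x n = snd (snd (f n))" for n
  have f_eq: "f n = (Y n, B n, x n)" for n by (simp add: Y_def B_def x_def)
  have st: "stage T P (Y n) (B n) (x n)" for n
    using f f_eq by simp
  have zero: "Y 0 = {}" "B 0 = {}" "x 0 = t"
    using spec[OF f, of 0] f_eq[of 0] by simp_all
  define W where "W n = (\<Union>p\<in>B (Suc n) - B n. endvertices p)" for n
  define \<Delta> where "\<Delta> n = Y (Suc n) - Y n" for n
  have step: "Y n \<subseteq> Y (Suc n)" "B n \<subseteq> B (Suc n)" "absorbs (\<Delta> n) (W n) (x n) (x (Suc n))" for n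
    using f f_eq by (simp_all add: W_def \<Delta>_def)
  have "\<forall>n. \<exists>t0 t1 Za Zb Zc. t0 \<in> W n \<and> t1 \<in> W n \<and> t0 \<noteq> t1 \<and> Za \<union> Zb \<union> Zc \<subseteq> \<Delta> n \<and>
     Za \<inter> Zb = {} \<and> Za \<inter> Zc = {} \<and> Zb \<inter> Zc = {} \<and> conn Za (x n) t0 \<and> conn Zb t1 (x (Suc n)) \<and>
     joinable Zc (W n - {t0, t1})"
  proof
    fix n
    from step(3)[of n] obtain t0 t1 Za Zb Zc where "t0 \<in> W n" "t1 \<in> W n" "t0 \<noteq> t1"
      "Za \<union> Zb \<union> Zc \<subseteq> \<Delta> n" "Za \<inter> Zb = {}" "Za \<inter> Zc = {}" "Zb \<inter> Zc = {}"
      "conn Za (x n) t0" "conn Zb t1 (x (Suc n))" "joinable Zc (W n - {t0, t1})"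
      unfolding absorbs_def by (elim bexE exE conjE)
    then show "\<exists>t0 t1 Za Zb Zc. t0 \<in> W n \<and> t1 \<in> W n \<and> t0 \<noteq> t1 \<and> Za \<union> Zb \<union> Zc \<subseteq> \<Delta> n \<and>
       Za \<inter> Zb = {} \<and> Za \<inter> Zc = {} \<and> Zb \<inter> Zc = {} \<and> conn Za (x n) t0 \<and> conn Zb t1 (x (Suc n)) \<and>
       joinable Zc (W n - {t0, t1})"
      by (intro exI conjI)
  qed
  then obtain t0 t1 Za Zb Zc where *: "\<forall>n. t0 n \<in> W n \<and> t1 n \<in> W n \<and> t0 n \<noteq> t1 n \<and>
     Za n \<union> Zb n \<union> Zc n \<subseteq> \<Delta> n \<and> Za n \<inter> Zb n = {} \<and> Za n \<inter> Zc n = {} \<and> Zb n \<inter> Zc n = {} \<and>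
     conn (Za n) (x n) (t0 n) \<and> conn (Zb n) (t1 n) (x (Suc n)) \<and> joinable (Zc n) (W n - {t0 n, t1 n})"
    by metis
  then have t01: "t0 n \<in> W n" "t1 n \<in> W n" "t0 n \<noteq> t1 n" and
    Z\<Delta>: "Za n \<subseteq> \<Delta> n" "Zb n \<subseteq> \<Delta> n" "Zc n \<subseteq> \<Delta> n" and
    Zdisj: "Za n \<inter> Zb n = {}" "Za n \<inter> Zc n = {}" "Zb n \<inter> Zc n = {}" and
    Zconn: "conn (Za n) (x n) (t0 n)" "conn (Zb n) (t1 n) (x (Suc n))" and
    Zc: "joinable (Zc n) (W n - {t0 n, t1 n})" for n
    by auto
  have Y_mono: "Y m \<subseteq> Y n" and B_mono: "B m \<subseteq> B n" if "m \<le> n" for m n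
    using lift_Suc_mono_le[of Y, OF step(1) that] lift_Suc_mono_le[of B, OF step(2) that] by auto
  have \<Delta>_disj: "\<Delta> m \<inter> \<Delta> n = {}" if "m \<noteq> n" for m n
    using that Y_mono[of "Suc m" n] Y_mono[of "Suc n" m] unfolding \<Delta>_def
    by (cases "m < n") (auto simp: not_less Suc_le_eq)
  have BP: "B n \<subseteq> P" for n using st by (auto simp: stage_def)
  have W_disj: "W m \<inter> W n = {}" if "m \<noteq> n" for m n
  proof -
    have "(B (Suc m) - B m) \<inter> (B (Suc n) - B n) = {}"
      using that B_mono[of "Suc m" n] B_mono[of "Suc n" m]
      by (cases "m < n") (auto simp: not_less Suc_le_eq)
    then show ?thesis
      unfolding W_def using T_joinD(4)[OF P] BP[of "Suc m"] BP[of "Suc n"] by blast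
  qed
  have WT: "W n \<subseteq> T" for n
    using T_joinD(5)[OF P] BP[of "Suc n"] unfolding W_def by blast
  \<comment> \<open>\<open>u n\<close> is the terminal waiting at \<open>x n\<close>: first
    \<open>t\<close>, with an empty route since \<open>x 0 = t\<close>, and later the
    \<open>t1\<close> of the preceding stage, hence the shift of the index.\<close>
  define u where "u n = (case n of 0 \<Rightarrow> t | Suc k \<Rightarrow> t1 k)" for n
  define Zu where "Zu n = (case n of 0 \<Rightarrow> {} | Suc k \<Rightarrow> Zb k)" for n
  have u_conn: "conn (Zu n) (u n) (x n)" for n
    using Zconn zero by (cases n) (auto simp: u_def Zu_def)
  have t_W: "t \<notin> W n" for n using WT t by auto
  have t0_inj: "t0 m \<noteq> t0 n" and t1_inj: "t1 m \<noteq> t1 n" if "m \<noteq> n" for m n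
    using t01(1,2)[of m] t01(1,2)[of n] W_disj[OF that] by auto
  have t1_t0: "t1 m \<noteq> t0 n" for m n
    using t01[of m] t01[of n] W_disj[of m n] by (cases "m = n") auto
  have t_t01: "t \<noteq> t0 n" "t \<noteq> t1 n" for n using t01[of n] t_W[of n] by auto
  have u_inj: "u m \<noteq> u n" if "m \<noteq> n" for m n
    using that t1_inj t_t01 t_t01(2)[symmetric] by (cases m; cases n) (simp_all add: u_def)
  have u_t0: "u m \<noteq> t0 n" for m n
    using t1_t0 t_t01 by (cases m) (simp_all add: u_def)
  have Zb_disj: "Zb m \<inter> Zb n = {}" if "m \<noteq> n" for m n
    using Z\<Delta>(2)[of m] Z\<Delta>(2)[of n] \<Delta>_disj[OF that] by blast
  have Zu_disj: "Zu m \<inter> Zu n = {}" if "m \<noteq> n" for m n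
    using that Zb_disj by (cases m; cases n) (simp_all add: Zu_def)
  have Zua: "Zu m \<inter> Za n = {}" "Zu m \<inter> Zc n = {}" for m n
  proof -
    have "Zb k \<inter> Za n = {} \<and> Zb k \<inter> Zc n = {}" for k
      using Z\<Delta>[of n] Z\<Delta>[of k] \<Delta>_disj[of k n] Zdisj[of n] by (cases "k = n") blast+
    then show "Zu m \<inter> Za n = {}" "Zu m \<inter> Zc n = {}" by (auto simp: Zu_def split: nat.splits)
  qed
  have Za_disj: "Za m \<inter> Za n = {}" "Zc m \<inter> Zc n = {}" if "m \<noteq> n" for m n
    using Z\<Delta>[of n] Z\<Delta>[of m] \<Delta>_disj[OF that] by blast+
  have Zac: "Za m \<inter> Zc n = {}" for m n
    using Z\<Delta>[of n] Z\<Delta>[of m] \<Delta>_disj[of m n] Zdisj[of n] by (cases "m = n") blast+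
  have j1: "joinable (\<Union>n. Zu n \<union> Za n) (\<Union>n. {u n, t0 n})"
  proof (rule joinable_UN)
    fix n
    show "joinable (Zu n \<union> Za n) {u n, t0 n}"
      by (rule joinable_pair[OF conn_join[OF u_conn Zconn(1)] u_t0])
    fix m assume mn: "n \<noteq> (m::nat)"
    show "(Zu n \<union> Za n) \<inter> (Zu m \<union> Za m) = {}"
      using Zu_disj[OF mn] Za_disj(1)[OF mn] Zua(1)[of n m] Zua(1)[of m n] by blast
    show "{u n, t0 n} \<inter> {u m, t0 m} = {}"
      using u_inj[OF mn] t0_inj[OF mn] u_t0[of n m] u_t0[of m n] by auto
  qed
  have j2: "joinable (\<Union>n. Zc n) (\<Union>n. W n - {t0 n, t1 n})"
    by (rule joinable_UN[OF Zc]) (use Za_disj(2) W_disj in blast)+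
  have j12: "joinable ((\<Union>n. Zu n \<union> Za n) \<union> (\<Union>n. Zc n)) ((\<Union>n. {u n, t0 n}) \<union> (\<Union>n. W n - {t0 n, t1 n}))"
  proof (rule joinable_Un[OF j1 j2])
    show "(\<Union>n. Zu n \<union> Za n) \<inter> (\<Union>n. Zc n) = {}" using Zua(2) Zac by blast
    have "{u n, t0 n} \<inter> (W m - {t0 m, t1 m}) = {}" for m n
    proof -
      have "t0 n \<notin> W m - {t0 m, t1 m}" "t1 n \<notin> W m - {t0 m, t1 m}" for n
        using t01[of n] W_disj[of n m] by (cases "n = m"; blast)+
      then show ?thesis using t_W[of m] by (cases n) (auto simp: u_def)
    qed
    then show "(\<Union>n. {u n, t0 n}) \<inter> (\<Union>n. W n - {t0 n, t1 n}) = {}" by blast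
  qed
  have T12: "(\<Union>n. {u n, t0 n}) \<union> (\<Union>n. W n - {t0 n, t1 n}) = insert t (\<Union>n. W n)"
  proof (intro equalityI subsetI)
    fix v assume "v \<in> (\<Union>n. {u n, t0 n}) \<union> (\<Union>n. W n - {t0 n, t1 n})"
    moreover have "u n \<in> insert t (\<Union>n. W n)" for n using t01(2) by (cases n) (auto simp: u_def)
    ultimately show "v \<in> insert t (\<Union>n. W n)" using t01(1) by blast
  next
    fix v assume "v \<in> insert t (\<Union>n. W n)"
    then consider "v = u 0" | n where "v \<in> W n - {t0 n, t1 n}" | n where "v = t0 n" | n where "v = u (Suc n)"
      by (auto simp: u_def)
    then show "v \<in> (\<Union>n. {u n, t0 n}) \<union> (\<Union>n. W n - {t0 n, t1 n})" by cases blast+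
  qed
  define Q where "Q = P - (\<Union>n. B n)"
  have j3: "joinable (\<Union>p\<in>Q. path_edges p) (\<Union>p\<in>Q. endvertices p)"
    by (rule joinable_paths[OF P]) (auto simp: Q_def)
  have \<Delta>Q: "\<Delta> n \<inter> path_edges p = {}" if "p \<in> Q" for n p
    using st[of "Suc n"] that by (auto simp: stage_def \<Delta>_def Q_def)
  have WQ: "W n \<inter> endvertices p = {}" if p: "p \<in> Q" for n p
  proof -
    have "endvertices q \<inter> endvertices p = {}" if "q \<in> B (Suc n)" for q
      using T_joinD(4)[OF P, of q p] p that BP[of "Suc n"] unfolding Q_def by blast
    then show ?thesis unfolding W_def by blast
  qed
  have Zu\<Delta>: "Zu n \<subseteq> (\<Union>n. \<Delta> n)" for n using Z\<Delta>(2) by (auto simp: Zu_def split: nat.splits)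
  have edges\<Delta>: "(\<Union>n. Zu n \<union> Za n) \<union> (\<Union>n. Zc n) \<subseteq> (\<Union>n. \<Delta> n)"
  proof -
    have "Za n \<subseteq> (\<Union>n. \<Delta> n)" "Zc n \<subseteq> (\<Union>n. \<Delta> n)" for n using Z\<Delta>(1,3)[of n] by auto
    then show ?thesis by (intro Un_least UN_least Zu\<Delta>)
  qed
  have "joinable (((\<Union>n. Zu n \<union> Za n) \<union> (\<Union>n. Zc n)) \<union> (\<Union>p\<in>Q. path_edges p))
      (insert t (\<Union>n. W n) \<union> (\<Union>p\<in>Q. endvertices p))"
  proof (rule joinable_Un[OF j12[unfolded T12] j3])
    show "((\<Union>n. Zu n \<union> Za n) \<union> (\<Union>n. Zc n)) \<inter> (\<Union>p\<in>Q. path_edges p) = {}"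
      using edges\<Delta> \<Delta>Q by blast
    have "t \<notin> endvertices p" if "p \<in> Q" for p
      using T_joinD(5)[OF P] t(2) that unfolding Q_def by blast
    then show "insert t (\<Union>n. W n) \<inter> (\<Union>p\<in>Q. endvertices p) = {}" using WQ by blast
  qed
  moreover have "insert t (\<Union>n. W n) \<union> (\<Union>p\<in>Q. endvertices p) = insert t T"
  proof -
    \<comment> \<open>A broken path has a first stage at which it is broken, and this is not stage 0
      because \<open>B 0\<close> is empty.\<close>
    have "p \<in> Q \<or> (\<exists>n. p \<in> B (Suc n) - B n)" if "p \<in> P" for p
    proof (cases "p \<in> Q")
      case False
      then have ex: "\<exists>n. p \<in> B n" using that by (auto simp: Q_def)
      define n where "n = (LEAST n. p \<in> B n)"
      have n: "p \<in> B n" unfolding n_def using ex by (rule LeastI_ex)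
      then obtain k where k: "n = Suc k" using zero(2) by (cases n) auto
      then have "p \<notin> B k" using not_less_Least[of k "\<lambda>n. p \<in> B n"] by (simp add: n_def)
      then show ?thesis using n k by blast
    qed simp
    then have parts: "p \<in> Q \<or> (\<exists>n. endvertices p \<subseteq> W n)" if "p \<in> P" for p
      using that unfolding W_def by fast
    have "T \<subseteq> (\<Union>n. W n) \<union> (\<Union>p\<in>Q. endvertices p)"
    proof
      fix v assume "v \<in> T"
      then have "v \<in> (\<Union>p\<in>P. endvertices p)" by (simp only: T_joinD(5)[OF P])
      then obtain p where "p \<in> P" "v \<in> endvertices p" by (rule UN_E)
      then show "v \<in> (\<Union>n. W n) \<union> (\<Union>p\<in>Q. endvertices p)" using parts[of p] by auto
    qed
    moreover have "(\<Union>p\<in>Q. endvertices p) \<subseteq> T" using T_joinD(5)[OF P] by (auto simp: Q_def)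
    ultimately show ?thesis using WT by blast
  qed
  moreover have "((\<Union>n. Zu n \<union> Za n) \<union> (\<Union>n. Zc n)) \<union> (\<Union>p\<in>Q. path_edges p) \<subseteq> E"
  proof -
    have "\<Delta> n \<subseteq> E" for n using st[of "Suc n"] by (auto simp: stage_def \<Delta>_def)
    moreover have "path_edges p \<subseteq> E" if "p \<in> Q" for p
      using path_edge_verts(2)[OF T_joinD(1)[OF P, of p]] that unfolding Q_def by blast
    ultimately show ?thesis using edges\<Delta> by blast
  qed
  ultimately show ?thesis by (metis joinable_mono)
qed

lemma T_join_exists:
  assumes conn: "\<And>u v. u \<in> V \<Longrightarrow> v \<in> V \<Longrightarrow> conn E u v"
    and T: "T \<subseteq> V" "infinite T" and nopend: "\<not> (\<exists>M. pendant_family E M)"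
  shows "\<exists>P. T_join G T P"
proof -
  obtain r where r: "r \<in> T" using T(2) by fastforce
  have "joinable E T \<or> (\<exists>t\<in>T. joinable E (T - {t}))"
    by (rule joinable_almost[of r]) (use conn r T in auto)
  then have "joinable E T"
  proof
    assume "\<exists>t\<in>T. joinable E (T - {t})"
    then obtain t where t: "t \<in> T" "joinable E (T - {t})" by blast
    then obtain P where P: "T_join G (T - {t}) P" using joinable_T_join T by blast
    have "joinable E (insert t (T - {t}))"
      by (rule joinable_insert[where P = P]) (use conn P t T nopend in auto)
    then show ?thesis using t by (simp add: insert_absorb)
  qed
  then show ?thesis using joinable_T_join T by blast
qed

subsection \<open>Components and pendant families\<close>

lemma components_delete_verts:
  "components (delete_verts G U) = (\<lambda>v. {w. conn {e \<in> E. en e \<inter> U = {}} v w}) ` (V - U)"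
proof -
  let ?D = "delete_verts G U"
  interpret D: wf_graph ?D
    by unfold_locales (use wf in \<open>auto simp: wf_multigraph_def delete_verts_def\<close>)
  \<comment> \<open>\<open>conn\<close> depends on the graph only through \<open>ends\<close>, which
    the deletion leaves unchanged.\<close>
  have "D.conn = conn"
    unfolding D.conn_def[abs_def] conn_def[abs_def] by (simp add: delete_verts_def)
  then have "joined ?D v w \<longleftrightarrow> conn {e \<in> E. en e \<inter> U = {}} v w" if "v \<in> V - U" for v w
    using D.joined_iff[of v w] that by (simp add: delete_verts_def)
  then show ?thesis
    unfolding components_def by (auto simp: delete_verts_def intro!: image_cong)
qed

text \<open>An edge between two members would be the only boundary edge of each, so their union
  would have no boundary although \<open>G\<close> is connected. A member that fell apart would need
  a boundary edge for each piece, but its only boundary edge has one end in it.\<close>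

lemma pendant_components:
  assumes conn: "\<And>u v. u \<in> V \<Longrightarrow> v \<in> V \<Longrightarrow> conn E u v" and M: "pendant_family E M"
  defines "U \<equiv> V - \<Union>M"
  shows "components (delete_verts G U) = M" "\<And>C. C \<in> M \<Longrightarrow> \<exists>!e. e \<in> edges_between G C U"
proof -
  have inf: "infinite M" and disj: "\<And>C C'. C \<in> M \<Longrightarrow> C' \<in> M \<Longrightarrow> C \<noteq> C' \<Longrightarrow> C \<inter> C' = {}"
    and MV: "\<And>C. C \<in> M \<Longrightarrow> C \<subseteq> V" and ne: "\<And>C. C \<in> M \<Longrightarrow> C \<noteq> {}"
    and cut1: "\<And>C. C \<in> M \<Longrightarrow> \<exists>e. cut E C = {e}"
    using M by (auto simp: pendant_family_def)
  let ?E' = "{e \<in> E. en e \<inter> U = {}}"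
  have to_U: "b \<in> U" if C: "C \<in> M" and e: "e \<in> E" "a \<in> C" "b \<notin> C" "en e = {a, b}" for C e a b
  proof (rule ccontr)
    assume "b \<notin> U"
    moreover have "b \<in> V" using e wf by (auto simp: wf_multigraph_def)
    ultimately obtain C' where C': "C' \<in> M" "b \<in> C'" by (auto simp: U_def)
    have "C \<noteq> C'" using C' e by auto
    then have "a \<notin> C'" using disj[OF C C'(1)] e by auto
    have "e \<in> cut E C" "e \<in> cut E C'"
      using cutI[of e E a b C] cutI[of e E b a C'] e C' \<open>a \<notin> C'\<close> by (auto simp: insert_commute)
    then have "cut E C = {e}" "cut E C' = {e}" using cut1 C C'(1) by fastforce+
    then have "cut E (C \<union> C') \<subseteq> {e}" using cut_Un[of E C C'] by blast
    moreover have "e \<notin> cut E (C \<union> C')" using e C' by (auto simp: cut_def doubleton_eq_iff)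
    ultimately have none: "cut E (C \<union> C') = {}" by blast
    \<comment> \<open>A third member supplies a vertex outside \<open>C \<union> C'\<close>, to
      which there must be a connection.\<close>
    have "infinite (M - {C, C'})" using inf by simp
    then obtain D where "D \<in> M" "D \<noteq> C" "D \<noteq> C'" by (metis Diff_iff finite.emptyI insertCI ex_in_conv)
    then obtain d where d: "d \<in> D" "d \<in> V" "d \<notin> C \<union> C'"
      using disj[of D C] disj[of D C'] ne[of D] MV[of D] C C' by blast
    have "a \<in> V" using e MV[OF C] by auto
    then show False
      using cut_nonempty[OF conn[OF \<open>a \<in> V\<close> d(2)], of "C \<union> C'"] d e none by auto
  qed
  have comp: "{w. conn ?E' v w} = C" if C: "C \<in> M" and v: "v \<in> C" for C v
  proof -
    let ?X = "{w. conn ?E' v w}"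
    obtain e where e: "cut E C = {e}" using cut1 C by blast
    then have "e \<in> cut E C" by simp
    then obtain a b where ab: "e \<in> E" "a \<in> C" "b \<notin> C" "en e = {a, b}" by (rule cutE)
    have b: "b \<in> U" "b \<in> V" using to_U[OF C ab] by (auto simp: U_def)
    have X_closed: "d \<in> ?X" if "h \<in> E" "c \<in> ?X" "en h = {c, d}" "c \<in> C" "d \<in> C" for h c d
    proof -
      have "en h \<inter> U = {}" using that C by (auto simp: U_def)
      then show ?thesis using that conn_step[of ?E' v c h d] by blast
    qed
    have XC: "?X \<subseteq> C"
    proof
      fix w assume w: "w \<in> ?X"
      show "w \<in> C"
      proof (rule ccontr)
        assume "w \<notin> C"
        then obtain h where "h \<in> cut ?E' C" using cut_nonempty[of ?E' v w C] w v by blast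
        then obtain c d where "h \<in> ?E'" "c \<in> C" "d \<notin> C" "en h = {c, d}" by (rule cutE)
        then show False using to_U[OF C, of h c d] by auto
      qed
    qed
    have "C \<subseteq> ?X"
    proof
      fix w assume w: "w \<in> C"
      show "w \<in> ?X"
      proof (rule ccontr)
        assume wX: "w \<notin> ?X"
        \<comment> \<open>Each of the two pieces of \<open>C\<close> is connected to
          \<open>b\<close> in \<open>G\<close> but not to the other piece by an edge, so
          \<open>e\<close> must leave both.\<close>
        have eS: "e \<in> cut E S \<and> S \<subseteq> C" if S: "S = ?X \<or> S = C - ?X" for S
        proof -
          have "\<exists>s\<in>S. s \<in> V" using S v w wX MV[OF C] by auto
          then obtain s where s: "s \<in> S" "s \<in> V" by blast
          have "b \<notin> S" using S XC ab by auto
          then obtain h where h: "h \<in> cut E S" using cut_nonempty[OF conn[OF s(2) b(2)]] s by blast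
          then obtain c d where cd: "h \<in> E" "c \<in> S" "d \<notin> S" "en h = {c, d}" by (rule cutE)
          have "d \<notin> C"
          proof
            assume d: "d \<in> C"
            then have "c \<in> C" using S XC cd by auto
            then show False
              using X_closed[of h c d] X_closed[of h d c] S cd d by (auto simp: insert_commute)
          qed
          moreover have "c \<in> C" using S XC cd by auto
          ultimately have "h \<in> cut E C" using cd cutI by blast
          then show ?thesis using e h S XC by auto
        qed
        have "a \<in> ?X" using eS[of ?X] ab by (auto simp: cut_def doubleton_eq_iff)
        moreover have "a \<in> C - ?X" using eS[of "C - ?X"] ab by (auto simp: cut_def doubleton_eq_iff)
        ultimately show False by blast
      qed
    qed
    then show ?thesis using XC by blast
  qed
  have VU: "V - U = \<Union>M" using MV by (auto simp: U_def)
  show "components (delete_verts G U) = M"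
    unfolding components_delete_verts VU
  proof (intro equalityI subsetI)
    fix C assume "C \<in> (\<lambda>v. {w. conn ?E' v w}) ` \<Union>M"
    then obtain v D where "D \<in> M" "v \<in> D" "C = {w. conn ?E' v w}" by blast
    then show "C \<in> M" using comp by simp
  next
    fix C assume C: "C \<in> M"
    then obtain v where "v \<in> C" using ne by blast
    then show "C \<in> (\<lambda>v. {w. conn ?E' v w}) ` \<Union>M" using comp[OF C] C by blast
  qed
  fix C assume C: "C \<in> M"
  have "edges_between G C U = cut E C"
  proof (intro equalityI subsetI)
    fix e assume "e \<in> edges_between G C U"
    then obtain a b where "e \<in> E" "a \<in> C" "b \<in> U" "en e = {a, b}" by (auto simp: edges_between_def)
    moreover have "b \<notin> C" using \<open>b \<in> U\<close> C by (auto simp: U_def)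
    ultimately show "e \<in> cut E C" by (intro cutI)
  next
    fix e assume "e \<in> cut E C"
    then obtain a b where ab: "e \<in> E" "a \<in> C" "b \<notin> C" "en e = {a, b}" by (rule cutE)
    then show "e \<in> edges_between G C U" using to_U[OF C ab] by (auto simp: edges_between_def)
  qed
  then show "\<exists>!e. e \<in> edges_between G C U" using cut1[OF C] by auto
qed

lemma pendant_no_T_join:
  assumes U: "U \<subseteq> V" and one: "\<And>C. C \<in> components (delete_verts G U) \<Longrightarrow> \<exists>!e. e \<in> edges_between G C U"
    and inf: "infinite {C \<in> components (delete_verts G U). \<not> is_singleton C}"
  shows "\<exists>T\<subseteq>V. infinite T \<and> \<not> (\<exists>P. T_join G T P)"
proof -
  let ?E' = "{e \<in> E. en e \<inter> U = {}}"
  define N where "N = {C \<in> components (delete_verts G U). \<not> is_singleton C}"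
  have compE: "\<exists>v\<in>V - U. C = {w. conn ?E' v w}" if "C \<in> N" for C
    using that unfolding N_def components_delete_verts by blast
  have sub: "C \<subseteq> V - U" if C: "C \<in> N" for C
  proof
    fix w assume w: "w \<in> C"
    obtain v where v: "v \<in> V - U" "C = {w. conn ?E' v w}" using compE[OF C] by blast
    then have "conn ?E' v w" using w by simp
    then show "w \<in> V - U"
    proof (induction rule: conn_induct)
      case (step a b e)
      then show ?case using wf by (auto simp: wf_multigraph_def)
    qed (use v in simp)
  qed
  have disj: "C = D" if CD: "C \<in> N" "D \<in> N" "v \<in> C" "v \<in> D" for C D v
  proof -
    obtain c d where "C = {w. conn ?E' c w}" "D = {w. conn ?E' d w}"
      using compE CD(1,2) by meson
    moreover from this have "conn ?E' c v" "conn ?E' d v" using CD by auto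
    ultimately show ?thesis using conn_trans conn_sym by blast
  qed
  have "\<exists>a b. a \<in> C \<and> b \<in> C \<and> a \<noteq> b" if C: "C \<in> N" for C
  proof -
    obtain v where "v \<in> C" using compE[OF C] conn_refl by blast
    moreover have "C \<noteq> {v}" using C by (auto simp: N_def is_singleton_def)
    ultimately show ?thesis by blast
  qed
  then obtain a b where ab: "\<And>C. C \<in> N \<Longrightarrow> a C \<in> C \<and> b C \<in> C \<and> a C \<noteq> b C" by metis
  obtain C0 where C0: "C0 \<in> N" using inf unfolding N_def[symmetric] by fastforce
  \<comment> \<open>A component has an edge to \<open>U\<close>, so \<open>U\<close> is
    nonempty.\<close>
  then obtain u where u: "u \<in> U" using one[of C0] by (auto simp: N_def edges_between_def)
  let ?T = "insert u (a ` N \<union> b ` N)"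
  have "inj_on a N" using ab disj by (intro inj_onI) metis
  then have "infinite ?T" using inf unfolding N_def[symmetric] by (auto dest: finite_imageD)
  moreover have "?T \<subseteq> V" using u U ab sub by auto
  moreover have "\<not> T_join G ?T P" for P
  proof
    assume P: "T_join G ?T P"
    have T_C: "t = a C \<or> t = b C" if tC: "t \<in> ?T" "C \<in> N" "t \<in> C" for t C
    proof -
      have "t \<noteq> u" using tC(2,3) sub u by blast
      then obtain D where "D \<in> N" "t = a D \<or> t = b D" using tC(1) by blast
      moreover from this have "D = C" using disj[of D C t] ab[of D] tC(2,3) by auto
      ultimately show ?thesis by simp
    qed
    have crossing: "e \<in> edges_between G C U" if C: "C \<in> N" and e: "e \<in> cut E C" for C e
    proof -
      obtain c d where cd: "e \<in> E" "c \<in> C" "d \<notin> C" "en e = {c, d}" using e by (rule cutE)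
      have "d \<in> U"
      proof (rule ccontr)
        assume "d \<notin> U"
        then have "e \<in> ?E'" using cd sub[OF C] by auto
        moreover obtain v where v: "C = {w. conn ?E' v w}" using compE[OF C] by blast
        ultimately have "conn ?E' v d" using cd conn_step[of ?E' v c e d] by blast
        then show False using cd v by blast
      qed
      then show ?thesis using cd by (auto simp: edges_between_def)
    qed
    have leave: "\<exists>e\<in>path_edges p. e \<in> edges_between G C U"
      if C: "C \<in> N" and p: "p \<in> P" and st: "endvertices p = {s, t}" "s \<in> C" "t \<notin> C" for C p s t
    proof -
      have path: "is_path G p" by (rule T_joinD(1)[OF P p])
      have "conn (path_edges p) s t"
        by (rule path_verts_conn[OF path]) (use path_ends(2)[OF path] st in auto)
      then obtain e where "e \<in> cut (path_edges p) C" using cut_nonempty st by blast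
      then have "e \<in> path_edges p" "e \<in> cut E C"
        using path_edge_verts(2)[OF path] by (auto simp: cut_def)
      then show ?thesis using crossing[OF C] by blast
    qed
    have partner: "\<exists>p\<in>P. \<exists>s. endvertices p = {t, s} \<and> t \<noteq> s \<and> s \<in> ?T" if t: "t \<in> ?T" for t
    proof -
      obtain p where p: "p \<in> P" "t \<in> endvertices p" using T_joinD(5)[OF P] t by blast
      obtain v w where "endvertices p = {v, w}" "v \<noteq> w" using T_joinD(2)[OF P p(1)] by (auto simp: card_2_iff)
      moreover have "endvertices p \<subseteq> ?T" using T_joinD(5)[OF P] p(1) by blast
      ultimately show ?thesis using p by (intro bexI[OF _ p(1)]) (auto simp: insert_commute)
    qed
    obtain p s where p: "p \<in> P" "endvertices p = {u, s}" "u \<noteq> s" "s \<in> ?T" using partner[of u] by auto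
    then obtain C where C: "C \<in> N" "s \<in> C" using ab by auto
    \<comment> \<open>The other terminal of \<open>C\<close>. Its partner lies outside
      \<open>C\<close>, because the only further terminal in \<open>C\<close> is \<open>s\<close>,
      which is already taken by \<open>u\<close>. Two edge-disjoint paths would then use the single
      edge between \<open>C\<close> and \<open>U\<close>.\<close>
    define s' where "s' = (if s = a C then b C else a C)"
    have s': "s' \<in> C" "s' \<noteq> s" "s' \<in> ?T" using ab[OF C(1)] C by (auto simp: s'_def)
    have uC: "u \<notin> C" using sub[OF C(1)] u by auto
    obtain q s2 where q: "q \<in> P" "endvertices q = {s', s2}" "s' \<noteq> s2" "s2 \<in> ?T" using partner[OF s'(3)] by blast
    have "q \<noteq> p" using q p s' uC by (auto simp: doubleton_eq_iff)
    then have dj: "endvertices p \<inter> endvertices q = {}" "path_edges p \<inter> path_edges q = {}"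
      using T_joinD(3,4)[OF P p(1) q(1)] by auto
    have "s2 \<notin> C"
    proof
      assume "s2 \<in> C"
      then have "s2 = a C \<or> s2 = b C" using T_C q(4) C(1) by blast
      moreover have "s = a C \<or> s = b C" "s' = a C \<or> s' = b C" using T_C p(4) s' C by blast+
      moreover have "s2 \<noteq> s" using dj p q by auto
      ultimately show False using q(3) s'(2) by auto
    qed
    then obtain e where e: "e \<in> path_edges q" "e \<in> edges_between G C U" using leave[OF C(1) q(1,2) s'(1)] by blast
    have "endvertices p = {s, u}" using p by auto
    then obtain e' where e': "e' \<in> path_edges p" "e' \<in> edges_between G C U" using leave[OF C(1) p(1) _ C(2) uC] by blast
    have "e = e'" using one[of C] C(1) e(2) e'(2) by (auto simp: N_def)
    then show False using e e' dj by auto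
  qed
  then have "\<not> (\<exists>P. T_join G ?T P)" by blast
  ultimately show ?thesis by (intro exI[of _ ?T] conjI)
qed

end

theorem theorem2:
  fixes G :: "('a, 'e) multigraph"
  assumes "wf_multigraph G"
    and "connected_multigraph G"
    and "\<not> finite_multigraph G"
  shows "(\<forall>T\<subseteq>verts G. infinite T \<longrightarrow> (\<exists>P. T_join G T P)) \<longleftrightarrow>
    \<not> (\<exists>U\<subseteq>verts G.
         (\<forall>C\<in>components (delete_verts G U). \<exists>!e. e \<in> edges_between G C U) \<and>
         infinite {C \<in> components (delete_verts G U). \<not> is_singleton C})"
proof -
  interpret wf_graph G by unfold_locales (rule assms(1))
  have conn: "conn E u v" if "u \<in> V" "v \<in> V" for u v
    using assms(2) that joined_iff by (auto simp: connected_multigraph_def)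
  show ?thesis
  proof (intro iffI notI)
    assume "\<forall>T\<subseteq>V. infinite T \<longrightarrow> (\<exists>P. T_join G T P)"
      and "\<exists>U\<subseteq>V. (\<forall>C\<in>components (delete_verts G U). \<exists>!e. e \<in> edges_between G C U) \<and>
         infinite {C \<in> components (delete_verts G U). \<not> is_singleton C}"
    then show False using pendant_no_T_join by meson
  next
    assume no: "\<not> (\<exists>U\<subseteq>V. (\<forall>C\<in>components (delete_verts G U). \<exists>!e. e \<in> edges_between G C U) \<and>
         infinite {C \<in> components (delete_verts G U). \<not> is_singleton C})"
    have "\<not> (\<exists>M. pendant_family E M)"
    proof
      assume "\<exists>M. pendant_family E M"
      then obtain M where M: "pendant_family E M" by blast
      \<comment> \<open>Deleting all vertices outside the family turns its members into the
        components.\<close>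
      let ?U = "V - \<Union>M"
      have comps: "components (delete_verts G ?U) = M" by (rule pendant_components(1)[OF conn M])
      have "\<exists>!e. e \<in> edges_between G C ?U" if "C \<in> M" for C
        by (rule pendant_components(2)[OF conn M that])
      moreover have "{C \<in> M. \<not> is_singleton C} = M"
        using M by (auto simp: pendant_family_def is_singleton_def)
      moreover have "infinite M" using M by (simp add: pendant_family_def)
      ultimately have "(\<forall>C\<in>components (delete_verts G ?U). \<exists>!e. e \<in> edges_between G C ?U) \<and>
          infinite {C \<in> components (delete_verts G ?U). \<not> is_singleton C}"
        unfolding comps by simp
      then show False using no by blast
    qed
    then show "\<forall>T\<subseteq>V. infinite T \<longrightarrow> (\<exists>P. T_join G T P)" using T_join_exists conn by blast
  qed
qed

end
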